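(* Let $n\ge 1$ and let $\psi:[0,\infty)\to[0,\infty)$ be a continuous increasing function such that $\psi(x)\to\infty$ as $x\to\infty$. Then the following are equivalent: (1) $\displaystyle\int_0^\infty \frac{\psi(x)}{1+x^2}\,dx=\infty$. (2) For every set $\Lambda=\Lambda_1\times\cdots\times\Lambda_n\subset\mathbb{R}^n$, where each $\Lambda_j\subset\mathbb{R}$ is a closed set of positive Lebesgue measure, $\Phi_\Lambda(\mathbb{R}^n)$ is dense in $(C_\psi(\mathbb{R}^n),\|\cdot\|_\psi)$. (3) If $\mu$ is a complex Borel measure on $\mathbb{R}^n$ such that $\displaystyle\int_{\mathbb{R}^n}e^{\psi(|x|)}\,d|\mu|(x)<\infty$ and $\widehat{\mu}$ vanishes on some set $\Lambda_1\times\cdots\times\Lambda_n$, where each $\Lambda_j\subset\mathbb{R}$ is a closed set of positive Lebesgue measure, then $\mu$ is identically zero.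
   Context: $|x|$ is the Euclidean norm and $x\cdot y$ the Euclidean inner product on $\mathbb{R}^n$. "Increasing" means $x\le y\Rightarrow\psi(x)\le\psi(y)$. Complex Borel measures are finite; $|\mu|$ denotes the total variation measure of $\mu$, and $\widehat{\mu}(\lambda)=\int_{\mathbb{R}^n}e^{-i\lambda\cdot x}\,d\mu(x)$ for $\lambda\in\mathbb{R}^n$. $C_\psi(\mathbb{R}^n)$ is the space of continuous functions $f:\mathbb{R}^n\to\mathbb{C}$ with $\lim_{|x|\to\infty} f(x)/e^{\psi(|x|)}=0$, with norm $\|f\|_\psi=\sup_{x\in\mathbb{R}^n}|f(x)|/e^{\psi(|x|)}$. For $\Lambda\subset\mathbb{R}^n$, $\Phi_\Lambda(\mathbb{R}^n)$ is the complex linear span of $\{e_\lambda:\lambda\in\Lambda\}$, where $e_\lambda(x)=e^{-i\lambda\cdot x}$. *)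

theory Defs
  imports "HOL-Analysis.Analysis"
begin

text \<open>A complex measure is represented by its set function; only the values on \<open>sets M\<close> matter.
  Taking all \<open>A i\<close> empty forces \<open>\<mu> {} = 0\<close>.\<close>

definition complex_measure :: "'a measure \<Rightarrow> ('a set \<Rightarrow> complex) \<Rightarrow> bool" where
  "complex_measure M \<mu> \<longleftrightarrow>
     (\<forall>A :: nat \<Rightarrow> 'a set. range A \<subseteq> sets M \<longrightarrow> disjoint_family A \<longrightarrow>
        (\<lambda>i. \<mu> (A i)) sums \<mu> (\<Union>i. A i))"

definition total_variation :: "'a measure \<Rightarrow> ('a set \<Rightarrow> complex) \<Rightarrow> 'a measure" where
  "total_variation M \<mu> = measure_of (space M) (sets M)
     (\<lambda>E. SUP A \<in> {A :: nat \<Rightarrow> 'a set. range A \<subseteq> sets M \<and> disjoint_family A \<and> (\<Union>i. A i) = E}.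
        (\<Sum>i. ennreal (cmod (\<mu> (A i)))))"

text \<open>The positive part of the Jordan decomposition of a finite signed measure \<open>\<nu>\<close>; the negative
  part is the positive part of \<open>-\<nu>\<close>.  Since \<open>B = {}\<close> is admissible, it is harmless that
  \<open>ennreal\<close> truncates negative values to \<open>0\<close>.\<close>

definition positive_variation :: "'a measure \<Rightarrow> ('a set \<Rightarrow> real) \<Rightarrow> 'a measure" where
  "positive_variation M \<nu> = measure_of (space M) (sets M)
     (\<lambda>E. SUP B \<in> {B \<in> sets M. B \<subseteq> E}. ennreal (\<nu> B))"

definition complex_measure_integral ::
    "'a measure \<Rightarrow> ('a set \<Rightarrow> complex) \<Rightarrow> ('a \<Rightarrow> complex) \<Rightarrow> complex" where
  "complex_measure_integral M \<mu> f =
     ((\<integral>x. f x \<partial>positive_variation M (\<lambda>A. Re (\<mu> A)))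
      - (\<integral>x. f x \<partial>positive_variation M (\<lambda>A. - Re (\<mu> A))))
   + \<i> * ((\<integral>x. f x \<partial>positive_variation M (\<lambda>A. Im (\<mu> A)))
      - (\<integral>x. f x \<partial>positive_variation M (\<lambda>A. - Im (\<mu> A))))"

definition expo :: "'a::euclidean_space \<Rightarrow> 'a \<Rightarrow> complex" where
  "expo l x = exp (- \<i> * complex_of_real (l \<bullet> x))"

definition fourier :: "('a::euclidean_space set \<Rightarrow> complex) \<Rightarrow> 'a \<Rightarrow> complex" where
  "fourier \<mu> l = complex_measure_integral borel \<mu> (expo l)"

definition Phi :: "'a::euclidean_space set \<Rightarrow> ('a \<Rightarrow> complex) set" where
  "Phi \<Lambda> = {\<lambda>x. \<Sum>l\<in>F. c l * expo l x | F c. finite F \<and> F \<subseteq> \<Lambda>}"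

text \<open>The weight \<open>\<psi>\<close> is a function on \<open>[0,\<infinity>)\<close>; below it is only evaluated at norms.\<close>

definition C_psi :: "(real \<Rightarrow> real) \<Rightarrow> ('a::euclidean_space \<Rightarrow> complex) set" where
  "C_psi \<psi> = {f. continuous_on UNIV f \<and>
     ((\<lambda>x. f x / complex_of_real (exp (\<psi> (norm x)))) \<longlongrightarrow> 0) at_infinity}"

definition norm_psi :: "(real \<Rightarrow> real) \<Rightarrow> ('a::euclidean_space \<Rightarrow> complex) \<Rightarrow> real" where
  "norm_psi \<psi> f = (SUP x. cmod (f x) / exp (\<psi> (norm x)))"

definition dense_in_C_psi :: "(real \<Rightarrow> real) \<Rightarrow> ('a::euclidean_space \<Rightarrow> complex) set \<Rightarrow> bool" where
  "dense_in_C_psi \<psi> S \<longleftrightarrow>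
     S \<subseteq> C_psi \<psi> \<and> (\<forall>f\<in>C_psi \<psi>. \<forall>\<epsilon>>0. \<exists>g\<in>S. norm_psi \<psi> (\<lambda>x. f x - g x) < \<epsilon>)"

definition box_prod :: "('n::finite \<Rightarrow> real set) \<Rightarrow> (real ^ 'n) set" where
  "box_prod L = {x. \<forall>j. x $ j \<in> L j}"

text \<open>The supremum defining \<open>norm_psi\<close> is a genuine one on \<open>C_psi \<psi>\<close>, and so also on the
  differences occurring in \<open>dense_in_C_psi\<close>.\<close>

lemma C_psi_bdd:
  fixes f :: "'a::euclidean_space \<Rightarrow> complex"
  assumes "\<And>t. t \<ge> 0 \<Longrightarrow> \<psi> t \<ge> 0" "f \<in> C_psi \<psi>"
  shows "bdd_above (range (\<lambda>x. cmod (f x) / exp (\<psi> (norm x))))"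
proof -
  from assms(2) have c: "continuous_on UNIV f"
    and l: "((\<lambda>x. f x / complex_of_real (exp (\<psi> (norm x)))) \<longlongrightarrow> 0) at_infinity"
    by (auto simp: C_psi_def)
  from tendstoD[OF l, of 1] obtain R where R:
    "\<And>x. norm x \<ge> R \<Longrightarrow> cmod (f x / complex_of_real (exp (\<psi> (norm x)))) < 1"
    by (auto simp: eventually_at_infinity)
  have "compact (f ` cball 0 R)"
    by (intro compact_continuous_image continuous_on_subset[OF c]) auto
  from compact_imp_bounded[OF this] obtain B where "\<forall>x\<in>cball 0 R. cmod (f x) \<le> B"
    by (auto simp: bounded_iff)
  then have B: "\<And>x. norm x \<le> R \<Longrightarrow> cmod (f x) \<le> B"
    by simp
  have "cmod (f x) / exp (\<psi> (norm x)) \<le> max 1 B" for x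
  proof (cases "norm x \<le> R")
    case True
    have "cmod (f x) / exp (\<psi> (norm x)) \<le> cmod (f x)"
      using assms(1)[of "norm x"] by (simp add: divide_le_eq mult_le_cancel_left1)
    with B[OF True] show ?thesis by simp
  next
    case False
    then show ?thesis using R[of x] by (simp add: norm_divide le_max_iff_disj less_imp_le)
  qed
  then show ?thesis by (auto intro!: bdd_aboveI)
qed

lemma C_psi_diff:
  assumes "f \<in> C_psi \<psi>" "g \<in> C_psi \<psi>"
  shows "(\<lambda>x. f x - g x) \<in> C_psi \<psi>"
  using assms tendsto_diff[of "\<lambda>x. f x / complex_of_real (exp (\<psi> (norm x)))" 0 at_infinity
      "\<lambda>x. g x / complex_of_real (exp (\<psi> (norm x)))" 0]
  by (auto simp: C_psi_def diff_divide_distrib intro!: continuous_on_diff)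

end

theory Submission
  imports Defs "HOL-Probability.Characteristic_Functions" "HOL-Probability.Sinc_Integral"
    "HOL-Complex_Analysis.Cauchy_Integral_Formula"
begin

text \<open>(1) implies (2).  Let \<open>d(x)\<close> be the distance of the exponential of frequency \<open>x\<close> from
  \<open>Phi \<Lambda>\<close> in dimension one; it vanishes on \<open>\<Lambda>\<close>.  If \<open>d \<le> exp (- \<psi> X)\<close> on half of an interval of length
  about \<open>\<psi> X / X\<close>, then Lagrange interpolation in the frequency, with about \<open>\<psi> X\<close> nodes, gives
  \<open>d \<le> exp (- \<psi> X / 2)\<close> on the whole interval: for \<open>|t| \<le> X\<close> the interpolation error of \<open>exp (- i x t)\<close>
  is small, for \<open>|t| > X\<close> the weight makes everything small.  Taking \<open>\<psi> (X\<^sub>k) = 2\<^sup>k\<close> and descending from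
  large \<open>k\<close>, the interval to the right of a density point of \<open>\<Lambda>\<close> grows by a multiple of \<open>2\<^sup>k / X\<^sub>k\<close> at
  each step.  Divergence of the logarithmic integral is divergence of \<open>\<Sum> 2\<^sup>k / X\<^sub>k\<close>, so every frequency
  is reached, at every level.  Product sets are treated one coordinate at a time, and trigonometric
  polynomials with arbitrary frequencies are dense.

  (2) implies (3): integration against \<open>\<mu>\<close> is continuous for the weighted norm.

  (3) implies (1): if the logarithmic integral converges, there is a nonvanishing function \<open>u\<close>, analytic
  in the upper half plane, with \<open>|u x| \<le> K exp (- \<psi> |x|) / (1 + x\<^sup>2)\<close> on the real line; the measure
  \<open>u x dx\<close> on a coordinate axis has a Fourier transform vanishing on a half space.\<close>

subsection \<open>Lagrange interpolation of exponentials\<close>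

text \<open>With \<open>M\<close> nodes every loss in the interpolation step is an
  \<open>M\<close>-th power. The Lebesgue constant \<open>12 ^ M\<close> is beaten by the error at
  the nodes and by the weight beyond \<open>X\<close>, both of size \<open>exp (- (8 * M))\<close>;
  it is beaten by the Taylor remainder because the interval is short. What survives is
  \<open>exp (- (4 * M))\<close>. Halving the exponent is the reason for levels with dyadic values:
  one step leads exactly from a level to the next lower one. The halving looks fatal, since a
  descent soon uses up the accuracy it started with. It is harmless because the starting level is
  free: for a given frequency and a given final accuracy the descent starts high enough for the tail
  of the divergent series to supply the length. A descent starts on an arbitrarily short interval,
  where only the frequencies in the given set are under control. Hence the set has to fill half of
  every short interval to the right of one fixed point. The two directions discretize the
  logarithmic integral differently: by dyadic values of \<open>\<psi>\<close> for divergence, by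
  dyadic arguments for convergence.\<close>

lemma power_self_le_fact_exp: "real n ^ n \<le> fact n * exp (real n)"
proof -
  have s: "(\<lambda>k. (real n)^k / fact k) sums exp (real n)"
    using exp_converges[of "real n"] by (simp add: divide_inverse mult.commute)
  have "(\<Sum>k\<in>{n}. (real n)^k / fact k) \<le> (\<Sum>k. (real n)^k / fact k)"
    using s by (intro sum_le_suminf) (auto simp: sums_iff)
  then show ?thesis using s by (simp add: sums_iff divide_le_eq mult.commute)
qed

definition lagrange_coeff :: "(nat \<Rightarrow> 'a::field) \<Rightarrow> nat \<Rightarrow> 'a \<Rightarrow> nat \<Rightarrow> 'a" where
  "lagrange_coeff y M x i = (\<Prod>r\<in>{..<M} - {i}. (x - y r) / (y i - y r))"

text \<open>Both \<open>p\<close> and its interpolating polynomial have degree below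
  \<open>M\<close>, and they agree at \<open>M\<close> distinct nodes.\<close>

lemma lagrange_reproduces_poly:
  fixes p :: "'a::field poly"
  assumes inj: "inj_on y {..<M}" and deg: "degree p < M"
  shows "(\<Sum>i<M. lagrange_coeff y M x i * poly p (y i)) = poly p x"
proof -
  define b where "b i = (\<Prod>r\<in>{..<M} - {i}. smult (1 / (y i - y r)) [:- y r, 1:])" for i
  define q where "q = (\<Sum>i<M. smult (poly p (y i)) (b i))"
  have pb: "poly (b i) z = lagrange_coeff y M z i" for i z
    by (auto simp: b_def poly_prod lagrange_coeff_def diff_divide_distrib intro!: prod.cong)
  have diag: "lagrange_coeff y M (y s) i = (if i = s then 1 else 0)" if "s < M" "i < M" for s i
  proof (cases "i = s")
    case True
    have "y s \<noteq> y r" if "r \<in> {..<M} - {s}" for r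
      using inj that \<open>s < M\<close> by (auto dest: inj_onD)
    then have "lagrange_coeff y M (y s) s = 1"
      unfolding lagrange_coeff_def by (intro prod.neutral) auto
    then show ?thesis using True by simp
  next
    case False
    then have "s \<in> {..<M} - {i}" using that by auto
    then show ?thesis using False by (auto simp: lagrange_coeff_def prod_zero_iff)
  qed
  have "degree (b i) \<le> M - 1" if "i < M" for i
  proof -
    have "degree (b i) \<le> sum (degree \<circ> (\<lambda>r. smult (1 / (y i - y r)) [:- y r, 1:])) ({..<M} - {i})"
      unfolding b_def by (rule degree_prod_sum_le) auto
    also have "\<dots> \<le> (\<Sum>r\<in>{..<M} - {i}. 1)"
      by (intro sum_mono) (auto simp: degree_smult_le)
    also have "\<dots> = M - 1" using that by simp
    finally show ?thesis .
  qed
  then have "degree q \<le> M - 1"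
    unfolding q_def by (intro degree_sum_le) (auto intro: order_trans[OF degree_smult_le])
  then have dq: "degree q < M" using deg by linarith
  have "p = q"
  proof (rule poly_eqI_degree)
    show "degree p < card (y ` {..<M})" "degree q < card (y ` {..<M})"
      using inj deg dq by (simp_all add: card_image)
    fix z assume "z \<in> y ` {..<M}"
    then obtain s where s: "s < M" "z = y s" by auto
    have "poly q z = (\<Sum>i<M. poly p (y i) * (if i = s then 1 else 0))"
      using s by (auto simp: q_def poly_sum pb diag intro!: sum.cong)
    also have "\<dots> = poly p z" using s by (simp add: if_distrib cong: if_cong)
    finally show "poly p z = poly q z" ..
  qed
  then have "poly p x = poly q x" by simp
  then show ?thesis by (simp add: q_def poly_sum pb mult.commute)
qed

text \<open>The Lagrange denominators for equally spaced nodes: the factors below \<open>i\<close>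
  multiply to \<open>fact i\<close>, those above to \<open>fact (m - i)\<close>.\<close>

lemma prod_abs_diff_eq_fact:
  assumes "i \<le> m"
  shows "(\<Prod>r\<in>{..<Suc m} - {i}. \<bar>real i - real r\<bar>) = fact i * fact (m - i)"
proof -
  have "(\<Prod>r<i. \<bar>real i - real r\<bar>) = (\<Prod>k=1..i. real k)"
    by (rule prod.reindex_bij_witness[of _ "\<lambda>k. i - k" "\<lambda>r. i - r"]) (auto simp: of_nat_diff)
  moreover have "(\<Prod>r\<in>{i<..m}. \<bar>real i - real r\<bar>) = (\<Prod>k=1..m-i. real k)"
    by (rule prod.reindex_bij_witness[of _ "\<lambda>k. i + k" "\<lambda>r. r - i"]) (use assms in \<open>auto simp: of_nat_diff\<close>)
  moreover have "(\<Prod>r\<in>{..<i} \<union> {i<..m}. \<bar>real i - real r\<bar>) =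
      (\<Prod>r<i. \<bar>real i - real r\<bar>) * (\<Prod>r\<in>{i<..m}. \<bar>real i - real r\<bar>)"
    by (rule prod.union_disjoint) auto
  moreover have "{..<Suc m} - {i} = {..<i} \<union> {i<..m}" using assms by auto
  ultimately show ?thesis
    by (simp only: fact_prod of_nat_prod of_nat_id)
qed

text \<open>Numerators are at most \<open>j\<close>, denominators at least those of equally spaced
  nodes with step \<open>j / (2 * M)\<close>. The reciprocal factorials are then binomial
  coefficients over \<open>fact m\<close>, and their sum contributes \<open>2 ^ m\<close>. The step
  is the one that a set filling half of an interval of length \<open>j\<close> can provide.\<close>

lemma sum_abs_lagrange_coeff_le:
  fixes y :: "nat \<Rightarrow> real"
  assumes M: "M \<ge> 1" and j: "j > 0"
    and gap: "\<And>i r. i < r \<Longrightarrow> r < M \<Longrightarrow> y r - y i \<ge> j / (2 * real M) * (real r - real i)"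
    and near: "\<And>i. i < M \<Longrightarrow> \<bar>y i - x\<bar> \<le> j"
  shows "(\<Sum>i<M. \<bar>lagrange_coeff y M x i\<bar>) \<le> 12 ^ M"
proof -
  obtain m where Mm: "M = Suc m" using M by (cases M) auto
  have coeff: "\<bar>lagrange_coeff y M x i\<bar> \<le> (2 * real M) ^ m / (fact i * fact (m - i))" if i: "i < M" for i
  proof -
    have "\<bar>lagrange_coeff y M x i\<bar> = (\<Prod>r\<in>{..<M} - {i}. \<bar>x - y r\<bar> / \<bar>y i - y r\<bar>)"
      by (simp add: lagrange_coeff_def abs_prod)
    also have "\<dots> \<le> (\<Prod>r\<in>{..<M} - {i}. (2 * real M) / \<bar>real i - real r\<bar>)"
    proof (rule prod_mono, safe)
      fix r assume r: "r < M" "r \<noteq> i"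
      have g: "\<bar>y i - y r\<bar> \<ge> j / (2 * real M) * \<bar>real i - real r\<bar>"
        using gap[of i r] gap[of r i] r i by (cases "i < r") (auto simp: abs_if)
      have pos: "j / (2 * real M) * \<bar>real i - real r\<bar> > 0" using r M j by auto
      have "\<bar>x - y r\<bar> / \<bar>y i - y r\<bar> \<le> j / (j / (2 * real M) * \<bar>real i - real r\<bar>)"
        using near[OF r(1)] g pos by (intro frac_le) auto
      then show "\<bar>x - y r\<bar> / \<bar>y i - y r\<bar> \<le> (2 * real M) / \<bar>real i - real r\<bar>"
        using j by simp
    qed auto
    also have "\<dots> = (2 * real M) ^ m / (fact i * fact (m - i))"
      using i by (simp add: prod_dividef Mm prod_abs_diff_eq_fact del: lessThan_Suc)
    finally show ?thesis .
  qed
  have "(\<Sum>i<M. \<bar>lagrange_coeff y M x i\<bar>) \<le> (\<Sum>i<M. (2 * real M) ^ m / (fact i * fact (m - i)))"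
    using coeff by (intro sum_mono) auto
  also have "\<dots> = (\<Sum>i\<le>m. (2 * real M) ^ m / fact m * real (m choose i))"
    by (auto simp: Mm lessThan_Suc_atMost binomial_fact intro!: sum.cong)
  also have "\<dots> = (2 * real M) ^ m / fact m * 2 ^ m"
    unfolding sum_distrib_left[symmetric] of_nat_sum[symmetric] choose_row_sum by simp
  also have "\<dots> = 4 ^ m * (real M ^ M / fact M)"
  proof -
    \<comment> \<open>Cancelling one factor \<open>M\<close> makes the exponent match, so that the
      weak Stirling bound applies at \<open>M\<close> itself.\<close>
    have "real M ^ M / fact M = real M ^ m / fact m"
      unfolding Mm power_Suc fact_Suc of_nat_mult of_nat_fact
      by (rule mult_divide_mult_cancel_left) simp
    moreover have "(2 * real M) ^ m * 2 ^ m = 4 ^ m * real M ^ m"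
      unfolding power_mult_distrib[symmetric] by (simp add: mult.commute)
    ultimately show ?thesis by (simp only: times_divide_eq_left times_divide_eq_right)
  qed
  also have "\<dots> \<le> 4 ^ m * exp (real M)"
    using power_self_le_fact_exp[of M] by (intro mult_left_mono) (auto simp: divide_le_eq mult.commute)
  also have "\<dots> \<le> 4 ^ M * 3 ^ M"
  proof -
    have "exp (real M) = exp 1 ^ M" by (simp add: exp_of_nat_mult[symmetric])
    also have "\<dots> \<le> 3 ^ M" using exp_le by (intro power_mono) auto
    finally show ?thesis by (intro mult_mono) (auto simp: Mm)
  qed
  also have "\<dots> = 12 ^ M" by (simp flip: power_mult_distrib)
  finally show ?thesis .
qed

text \<open>Interpolation is exact in degree at most \<open>M - 1\<close>, so only the Taylor
  remainders about \<open>x\<close> at the nodes matter. Each is at most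
  \<open>(j * \<bar>t\<bar>) ^ M / fact M\<close>, and the Lebesgue constant sums them.\<close>

lemma exp_interpolation_error:
  fixes y :: "nat \<Rightarrow> real" and x j t :: real
  assumes M: "M \<ge> 1" and j: "j > 0"
    and gap: "\<And>i r. i < r \<Longrightarrow> r < M \<Longrightarrow> y r - y i \<ge> j / (2 * real M) * (real r - real i)"
    and near: "\<And>i. i < M \<Longrightarrow> \<bar>y i - x\<bar> \<le> j"
  shows "cmod (expo x t - (\<Sum>i<M. of_real (lagrange_coeff y M x i) * expo (y i) t))
           \<le> 12 ^ M * ((j * \<bar>t\<bar>) ^ M / fact M)"
proof -
  obtain m where Mm: "M = Suc m" using M by (cases M) auto
  let ?l = "lagrange_coeff y M x"
  define T where "T i = (\<Sum>k\<le>m. (\<i> * complex_of_real (- (t * (y i - x)))) ^ k / fact k)" for i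
  have inj: "inj_on y {..<M}"
  proof (rule inj_onI)
    fix a b assume ab: "a \<in> {..<M}" "b \<in> {..<M}" "y a = y b"
    have *: "j / (2 * real M) * (real b - real a) > 0" if "a < b" for a b :: nat
      using that j M by auto
    show "a = b" using gap[of a b] gap[of b a] *[of a b] *[of b a] ab by (cases a b rule: linorder_cases) auto
  qed
  have pow: "(\<Sum>i<M. ?l i * (y i - x) ^ k) = (if k = 0 then 1 else 0)" if "k \<le> m" for k
  proof -
    have "degree ([:- x, 1:] ^ k) < M" using that by (simp add: degree_power_eq Mm)
    from lagrange_reproduces_poly[OF inj this, of x] show ?thesis
      by (simp add: algebra_simps power_0_left)
  qed
  have "(\<Sum>i<M. of_real (?l i) * T i) =
        (\<Sum>i<M. \<Sum>k\<le>m. (- \<i> * t) ^ k / fact k * of_real (?l i * (y i - x) ^ k))"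
    unfolding T_def sum_distrib_left
    by (intro sum.cong refl) (simp add: power_mult_distrib[symmetric] mult_ac flip: power_mult_distrib)
  also have "\<dots> = (\<Sum>k\<le>m. (- \<i> * t) ^ k / fact k * of_real (\<Sum>i<M. ?l i * (y i - x) ^ k))"
    by (subst sum.swap) (simp add: sum_distrib_left)
  also have "\<dots> = (\<Sum>k\<le>m. if k = 0 then 1 else 0)"
    by (intro sum.cong refl) (auto simp: pow)
  \<comment> \<open>\<open>T i\<close> is the Taylor polynomial about \<open>x\<close> evaluated at
    node \<open>i\<close>; interpolation returns its value at \<open>x\<close>, where only the
    constant term is left.\<close>
  finally have one: "(\<Sum>i<M. of_real (?l i) * T i) = 1" by simp
  have fac: "expo (y i) t = expo x t * exp (\<i> * complex_of_real (- (t * (y i - x))))" for i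
    by (simp add: expo_def exp_add[symmetric] algebra_simps)
  have "expo x t - (\<Sum>i<M. of_real (?l i) * expo (y i) t)
      = expo x t * (\<Sum>i<M. of_real (?l i) * (T i - exp (\<i> * complex_of_real (- (t * (y i - x))))))"
    unfolding right_diff_distrib sum_subtractf one
    by (simp add: fac sum_distrib_left right_diff_distrib mult_ac)
  also have "cmod \<dots> = cmod (\<Sum>i<M. of_real (?l i) * (T i - exp (\<i> * complex_of_real (- (t * (y i - x))))))"
    by (simp add: norm_mult expo_def)
  also have "\<dots> \<le> (\<Sum>i<M. \<bar>?l i\<bar> * ((j * \<bar>t\<bar>) ^ M / fact M))"
  proof (rule sum_norm_le)
    fix i assume "i \<in> {..<M}"
    then have "\<bar>t * (y i - x)\<bar> \<le> j * \<bar>t\<bar>" using near[of i] by (simp add: abs_mult mult.commute[of "\<bar>t\<bar>"] mult_right_mono)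
    then have "\<bar>t * (y i - x)\<bar> ^ M / fact M \<le> (j * \<bar>t\<bar>) ^ M / fact M"
      by (intro divide_right_mono power_mono) auto
    moreover have "cmod (T i - exp (\<i> * complex_of_real (- (t * (y i - x))))) \<le> \<bar>t * (y i - x)\<bar> ^ M / fact M"
      using iexp_approx1[of "- (t * (y i - x))" m] by (simp add: T_def Mm norm_minus_commute del: power_Suc fact_Suc)
    ultimately show "cmod (of_real (?l i) * (T i - exp (\<i> * complex_of_real (- (t * (y i - x))))))
        \<le> \<bar>?l i\<bar> * ((j * \<bar>t\<bar>) ^ M / fact M)"
      unfolding norm_mult norm_of_real by (meson abs_ge_zero mult_left_mono order_trans)
  qed
  also have "\<dots> \<le> 12 ^ M * ((j * \<bar>t\<bar>) ^ M / fact M)"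
    unfolding sum_distrib_right[symmetric] using j
    by (intro mult_right_mono sum_abs_lagrange_coeff_le[OF assms]) auto
  finally show ?thesis .
qed

text \<open>Greedy choice: take the least point \<open>a\<close> of \<open>S\<close> and continue
  with the part of \<open>S\<close> beyond \<open>a + \<eta>\<close>. Each point costs measure at
  most \<open>\<eta>\<close>.\<close>

lemma spaced_points_exist:
  fixes S :: "real set"
  assumes "compact S" "\<eta> > 0" "measure lborel S \<ge> real M * \<eta>"
  shows "\<exists>y. (\<forall>i<M. y i \<in> S) \<and> (\<forall>i r. i < r \<longrightarrow> r < M \<longrightarrow> y r - y i \<ge> \<eta> * (real r - real i))"
  using assms
proof (induction M arbitrary: S)
  case 0
  then show ?case by auto
next
  case (Suc M)
  have "0 < real (Suc M) * \<eta>" using Suc.prems by simp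
  then have "S \<noteq> {}" using Suc.prems(3) by (metis less_le_not_le measure_empty)
  then obtain a where a: "a \<in> S" "\<And>z. z \<in> S \<Longrightarrow> a \<le> z"
    using compact_attains_inf[OF Suc.prems(1)] by blast
  let ?S = "S \<inter> {a+\<eta>..}"
  have fin: "emeasure lborel S < \<infinity>" using emeasure_compact_finite[OF Suc.prems(1)] .
  have S: "S \<in> sets lborel" using Suc.prems(1) by (simp add: borel_compact)
  have cS: "compact ?S" using Suc.prems(1) by (simp add: compact_Int_closed)
  have "measure lborel S \<le> measure lborel ({a..a+\<eta>} \<union> ?S)"
    by (rule measure_mono_fmeasurable)
      (use a S cS in \<open>auto simp: fmeasurable_compact intro!: fmeasurable.Un\<close>)
  also have "\<dots> \<le> measure lborel {a..a+\<eta>} + measure lborel ?S"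
    by (rule measure_Un_le) (use S in auto)
  finally have "measure lborel ?S \<ge> real M * \<eta>" using Suc.prems by (simp add: algebra_simps)
  from Suc.IH[OF cS Suc.prems(2) this] obtain y where y: "\<And>i. i < M \<Longrightarrow> y i \<in> ?S"
    "\<And>i r. i < r \<Longrightarrow> r < M \<Longrightarrow> y r - y i \<ge> \<eta> * (real r - real i)" by blast
  define z where "z i = (case i of 0 \<Rightarrow> a | Suc i \<Rightarrow> y i)" for i
  have "z r - z i \<ge> \<eta> * (real r - real i)" if ir: "i < r" "r < Suc M" for i r
  proof -
    obtain r' where r': "r = Suc r'" using ir by (cases r) auto
    show ?thesis
    proof (cases i)
      case 0
      have "y r' \<ge> a + \<eta> + \<eta> * real r'"
        using y(1)[of 0] y(2)[of 0 r'] ir r' by (cases r') auto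
      then show ?thesis using 0 r' by (simp add: z_def algebra_simps)
    next
      case (Suc i')
      then show ?thesis using y(2)[of i' r'] ir r' by (simp add: z_def)
    qed
  qed
  moreover have "z i \<in> S" if "i < Suc M" for i
    using that a y(1) by (cases i) (auto simp: z_def)
  ultimately show ?case by blast
qed

subsection \<open>Approximation by exponential sums in the weighted norm\<close>

lemma norm_expo [simp]: "cmod (expo l x) = 1"
  by (simp add: expo_def)

lemma Phi_expo: "l \<in> \<Lambda> \<Longrightarrow> expo l \<in> Phi \<Lambda>"
  unfolding Phi_def by (auto intro!: exI[of _ "{l}"] exI[of _ "\<lambda>_. 1"])

lemma Phi_zero: "(\<lambda>x. 0) \<in> Phi \<Lambda>"
  unfolding Phi_def by (auto intro!: exI[of _ "{}"])

lemma Phi_mono: "\<Lambda> \<subseteq> \<Lambda>' \<Longrightarrow> Phi \<Lambda> \<subseteq> Phi \<Lambda>'"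
  unfolding Phi_def by blast

lemma Phi_cmult:
  assumes "u \<in> Phi \<Lambda>"
  shows "(\<lambda>x. a * u x) \<in> Phi \<Lambda>"
proof -
  obtain F c where F: "finite F" "F \<subseteq> \<Lambda>" "u = (\<lambda>x. \<Sum>l\<in>F. c l * expo l x)"
    using assms by (auto simp: Phi_def)
  then show ?thesis unfolding Phi_def
    by (auto intro!: exI[of _ F] exI[of _ "\<lambda>l. a * c l"] simp: sum_distrib_left mult_ac)
qed

lemma Phi_add:
  assumes "u \<in> Phi \<Lambda>" "v \<in> Phi \<Lambda>"
  shows "(\<lambda>x. u x + v x) \<in> Phi \<Lambda>"
proof -
  obtain F c where F: "finite F" "F \<subseteq> \<Lambda>" "u = (\<lambda>x. \<Sum>l\<in>F. c l * expo l x)"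
    using assms by (auto simp: Phi_def)
  obtain G d where G: "finite G" "G \<subseteq> \<Lambda>" "v = (\<lambda>x. \<Sum>l\<in>G. d l * expo l x)"
    using assms by (auto simp: Phi_def)
  define e where "e l = (if l \<in> F then c l else 0) + (if l \<in> G then d l else 0)" for l
  have "(\<Sum>l\<in>F. c l * expo l x) = (\<Sum>l\<in>F \<union> G. (if l \<in> F then c l else 0) * expo l x)" for x
    by (rule sum.mono_neutral_cong_left) (use F G in auto)
  moreover have "(\<Sum>l\<in>G. d l * expo l x) = (\<Sum>l\<in>F \<union> G. (if l \<in> G then d l else 0) * expo l x)" for x
    by (rule sum.mono_neutral_cong_left) (use F G in auto)
  ultimately have "(\<lambda>x. u x + v x) = (\<lambda>x. \<Sum>l\<in>F \<union> G. e l * expo l x)"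
    unfolding F G e_def distrib_right sum.distrib by simp
  then show ?thesis using F G unfolding Phi_def by blast
qed

lemma Phi_sum:
  assumes "finite I" "\<And>i. i \<in> I \<Longrightarrow> u i \<in> Phi \<Lambda>"
  shows "(\<lambda>x. \<Sum>i\<in>I. u i x) \<in> Phi \<Lambda>"
  using assms by (induction I) (auto intro: Phi_zero Phi_add)

text \<open>Distance at most \<open>\<epsilon>\<close> in the weighted norm, written pointwise so
  that errors can be added without handling suprema.\<close>

definition psi_approx ::
    "(real \<Rightarrow> real) \<Rightarrow> ('a::euclidean_space \<Rightarrow> complex) set \<Rightarrow> real \<Rightarrow> ('a \<Rightarrow> complex) \<Rightarrow> bool" where
  "psi_approx \<psi> S \<epsilon> f \<longleftrightarrow> (\<exists>g\<in>S. \<forall>x. cmod (f x - g x) \<le> \<epsilon> * exp (\<psi> (norm x)))"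

lemma psi_approx_mono: "psi_approx \<psi> S \<epsilon> f \<Longrightarrow> \<epsilon> \<le> \<epsilon>' \<Longrightarrow> psi_approx \<psi> S \<epsilon>' f"
  unfolding psi_approx_def by (meson exp_ge_zero mult_right_mono order_trans)

lemma psi_approx_self: "f \<in> S \<Longrightarrow> \<epsilon> \<ge> 0 \<Longrightarrow> psi_approx \<psi> S \<epsilon> f"
  unfolding psi_approx_def by (auto intro!: bexI[of _ f])

text \<open>Inherited errors are multiplied by the sum of the moduli of the coefficients; for
  Lagrange coefficients this is the Lebesgue constant.\<close>

lemma psi_approx_lincomb:
  assumes "finite I" "\<And>i. i \<in> I \<Longrightarrow> psi_approx \<psi> (Phi \<Lambda>) \<epsilon> (u i)"
    and "\<And>x. cmod (f x - (\<Sum>i\<in>I. c i * u i x)) \<le> \<delta> * exp (\<psi> (norm x))"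
  shows "psi_approx \<psi> (Phi \<Lambda>) (\<delta> + (\<Sum>i\<in>I. cmod (c i)) * \<epsilon>) f"
proof -
  obtain g where g: "\<And>i. i \<in> I \<Longrightarrow> g i \<in> Phi \<Lambda>"
    "\<And>i x. i \<in> I \<Longrightarrow> cmod (u i x - g i x) \<le> \<epsilon> * exp (\<psi> (norm x))"
    using assms(2) unfolding psi_approx_def by metis
  have "cmod (f x - (\<Sum>i\<in>I. c i * g i x)) \<le> (\<delta> + (\<Sum>i\<in>I. cmod (c i)) * \<epsilon>) * exp (\<psi> (norm x))" for x
  proof -
    have "f x - (\<Sum>i\<in>I. c i * g i x) = (f x - (\<Sum>i\<in>I. c i * u i x)) + (\<Sum>i\<in>I. c i * (u i x - g i x))"
      by (simp add: right_diff_distrib sum_subtractf)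
    also have "cmod \<dots> \<le> cmod (f x - (\<Sum>i\<in>I. c i * u i x)) + cmod (\<Sum>i\<in>I. c i * (u i x - g i x))"
      by (rule norm_triangle_ineq)
    also have "cmod (\<Sum>i\<in>I. c i * (u i x - g i x)) \<le> (\<Sum>i\<in>I. cmod (c i) * (\<epsilon> * exp (\<psi> (norm x))))"
      using g(2) by (intro sum_norm_le) (auto simp: norm_mult intro!: mult_left_mono)
    also have "(\<Sum>i\<in>I. cmod (c i) * (\<epsilon> * exp (\<psi> (norm x)))) = (\<Sum>i\<in>I. cmod (c i)) * \<epsilon> * exp (\<psi> (norm x))"
      unfolding sum_distrib_right by (simp add: mult.assoc)
    finally show ?thesis using assms(3)[of x] by (simp add: distrib_right)
  qed
  moreover have "(\<lambda>x. \<Sum>i\<in>I. c i * g i x) \<in> Phi \<Lambda>"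
    using assms(1) g(1) by (intro Phi_sum Phi_cmult) auto
  ultimately show ?thesis unfolding psi_approx_def by (intro bexI[of _ "\<lambda>x. \<Sum>i\<in>I. c i * g i x"]) auto
qed

text \<open>The order of choices matters: a combination with error \<open>\<epsilon>/2\<close> is
  fixed first, and only then are its finitely many exponentials replaced, with an error adapted to
  the size \<open>C\<close> of its coefficients. The \<open>+ 1\<close> covers
  \<open>C = 0\<close>.\<close>

lemma psi_approx_trans:
  assumes 1: "\<And>l \<epsilon>. l \<in> \<Lambda>' \<Longrightarrow> \<epsilon> > 0 \<Longrightarrow> psi_approx \<psi> (Phi \<Lambda>) \<epsilon> (expo l)"
    and 2: "\<And>\<epsilon>. \<epsilon> > 0 \<Longrightarrow> psi_approx \<psi> (Phi \<Lambda>') \<epsilon> f" and "\<epsilon> > 0"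
  shows "psi_approx \<psi> (Phi \<Lambda>) \<epsilon> f"
proof -
  obtain g where g: "g \<in> Phi \<Lambda>'" "\<And>x. cmod (f x - g x) \<le> \<epsilon>/2 * exp (\<psi> (norm x))"
    using 2[of "\<epsilon>/2"] \<open>\<epsilon> > 0\<close> by (auto simp: psi_approx_def)
  obtain F c where F: "finite F" "F \<subseteq> \<Lambda>'" "g = (\<lambda>x. \<Sum>l\<in>F. c l * expo l x)"
    using g(1) by (auto simp: Phi_def)
  define C where "C = (\<Sum>l\<in>F. cmod (c l))"
  have C: "C \<ge> 0" by (auto simp: C_def intro: sum_nonneg)
  have "psi_approx \<psi> (Phi \<Lambda>) (\<epsilon>/2 + C * (\<epsilon> / (2 * (C + 1)))) f"
    unfolding C_def
  proof (rule psi_approx_lincomb[OF F(1)])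
    show "cmod (f x - (\<Sum>l\<in>F. c l * expo l x)) \<le> \<epsilon>/2 * exp (\<psi> (norm x))" for x
      using g(2)[of x] by (simp add: F(3))
    show "psi_approx \<psi> (Phi \<Lambda>) (\<epsilon> / (2 * ((\<Sum>l\<in>F. cmod (c l)) + 1))) (expo l)" if "l \<in> F" for l
      using 1[of l] that F(2) \<open>\<epsilon> > 0\<close> C by (auto simp: C_def)
  qed
  moreover have "\<epsilon>/2 + C * (\<epsilon> / (2 * (C + 1))) \<le> \<epsilon>"
    using C \<open>\<epsilon> > 0\<close> by (simp add: field_simps)
  ultimately show ?thesis by (rule psi_approx_mono)
qed

text \<open>The three summands below are the interpolation error for \<open>|t| \<le> X\<close>, the trivial bound for
  \<open>|t| > X\<close>, and the error inherited from the nodes; \<open>12 ^ M\<close> bounds the Lebesgue constant.\<close>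

lemma spread_numeric_bound:
  assumes M: "M \<ge> 2" and u: "0 \<le> u" "u \<le> 16 * real M / 100000"
  shows "12 ^ M * (u ^ M / fact M) + (1 + 2 * 12 ^ M) * exp (- (8 * real M)) \<le> exp (- (4 * real M))"
proof -
  \<comment> \<open>The unit of comparison is \<open>q ^ M = exp (- (4 * M))\<close>; the bounds
    \<open>5/2\<close> and \<open>3\<close> for \<open>exp 1\<close> place \<open>q\<close> between
    1/81 and 16/625.\<close>
  define q where "q = exp (- 4 :: real)"
  have e1: "exp 1 \<ge> (5/2 :: real)" using exp_lower_Taylor_quadratic[of 1] by simp
  have e4: "exp (4::real) = exp 1 ^ 4" by (simp add: exp_of_nat_mult[symmetric])
  have "exp (4::real) \<ge> (5/2)^4" unfolding e4 using e1 by (intro power_mono) auto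
  then have q1: "q \<le> 16/625" by (simp add: q_def exp_minus inverse_eq_divide divide_simps)
  have "exp (4::real) \<le> 3^4" unfolding e4 using exp_le by (intro power_mono) auto
  then have q2: "q \<ge> 1/81" by (simp add: q_def exp_minus inverse_eq_divide divide_simps)
  have q0: "q > 0" by (simp add: q_def)
  have qM: "exp (- (4 * real M)) = q ^ M" "exp (- (8 * real M)) = q ^ M * q ^ M"
    by (simp_all add: q_def exp_of_nat_mult[symmetric] exp_add[symmetric] algebra_simps)
  have "12 ^ M * (u ^ M / fact M) \<le> 12 ^ M * ((16 * real M / 100000) ^ M / fact M)"
    using u by (intro mult_left_mono divide_right_mono power_mono) auto
  also have "\<dots> = (12 * 16 / 100000) ^ M * (real M ^ M / fact M)"
  proof -
    have "16 * real M / 100000 = 16 / 100000 * real M" by simp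
    then show ?thesis by (simp only: power_mult_distrib times_divide_eq_right) (simp only: power_mult_distrib[symmetric] mult.assoc[symmetric] times_divide_eq_right)
  qed
  also have "real M ^ M / fact M \<le> exp (real M)"
    using power_self_le_fact_exp[of M] by (simp add: divide_le_eq mult.commute)
  also have "exp (real M) = exp 1 ^ M" by (simp add: exp_of_nat_mult[symmetric])
  also have "exp 1 ^ M \<le> (3::real) ^ M" using exp_le by (intro power_mono) auto
  also have "(12 * 16 / 100000) ^ M * (3::real) ^ M = (3 * 12 * 16 / 100000) ^ M"
    unfolding power_mult_distrib[symmetric] by simp
  \<comment> \<open>This is what the constant \<open>100000\<close> is for: 576/100000 is below
    1/162, hence below \<open>q / 2\<close>. With \<open>M \<ge> 2\<close> the interpolation error
    uses a quarter of \<open>q ^ M\<close> and leaves three quarters for the rest.\<close>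
  also have "\<dots> \<le> (1/2 * q) ^ M" using q2 by (intro power_mono) auto
  also have "\<dots> = (1/2) ^ M * q ^ M" by (rule power_mult_distrib)
  also have "\<dots> \<le> (1/2)^2 * q ^ M" using M q0 by (intro mult_right_mono power_decreasing) auto
  finally have A: "12 ^ M * (u ^ M / fact M) \<le> 1/4 * q ^ M" by (simp add: power2_eq_square)
  have "(1 + 2 * 12 ^ M) * (q ^ M * q ^ M) \<le> (3 * 12 ^ M) * (q ^ M * q ^ M)"
    using q0 by (intro mult_right_mono) auto
  also have "\<dots> = 3 * (12 * q) ^ M * q ^ M" by (simp add: power_mult_distrib)
  also have "(12 * q) ^ M \<le> (12 * (16/625)) ^ M" using q0 q1 by (intro power_mono) auto
  also have "\<dots> \<le> (12 * (16/625)) ^ 2" using M by (intro power_decreasing) auto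
  finally have "(1 + 2 * 12 ^ M) * (q ^ M * q ^ M) \<le> 3/4 * q ^ M"
    using q0 by (simp add: power2_eq_square mult_right_mono order_trans[OF _ mult_right_mono])
  with A show ?thesis unfolding qM by linarith
qed

text \<open>One interpolation step. Accuracy \<open>exp (- (8 * M))\<close> on a subset filling half
  of \<open>{a..b}\<close> becomes accuracy \<open>exp (- (4 * M))\<close> on all of
  \<open>{a..b}\<close>, provided that the weight has reached \<open>8 * M\<close> at
  \<open>X\<close> and the interval is short compared with \<open>M / X\<close>.\<close>

lemma approx_spread:
  fixes S :: "real set"
  assumes mono: "mono_on {0..} \<psi>" and nonneg: "\<And>x. x \<ge> 0 \<Longrightarrow> \<psi> x \<ge> 0"
    and M: "M \<ge> 2" and X: "X \<ge> 0" "\<psi> X \<ge> 8 * real M"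
    and S: "compact S" "S \<subseteq> {a..b}" "measure lborel S \<ge> (b - a) / 2" "a < b"
    and len: "(b - a) * X \<le> 16 * real M / 100000"
    and app: "\<And>s. s \<in> S \<Longrightarrow> psi_approx \<psi> (Phi \<Lambda>) (exp (- (8 * real M))) (expo s)"
    and x: "x \<in> {a..b}"
  shows "psi_approx \<psi> (Phi \<Lambda>) (exp (- (4 * real M))) (expo x)"
proof -
  define j where "j = b - a"
  have j: "j > 0" using S by (simp add: j_def)
  have "real M * (j / (2 * real M)) = (b - a) / 2" using M by (simp add: j_def)
  then obtain y where y: "\<And>i. i < M \<Longrightarrow> y i \<in> S"
    and gap: "\<And>i r. i < r \<Longrightarrow> r < M \<Longrightarrow> y r - y i \<ge> j / (2 * real M) * (real r - real i)"
    using spaced_points_exist[OF S(1), of "j / (2 * real M)" M] S(3) j M by auto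
  have near: "\<bar>y i - x\<bar> \<le> j" if "i < M" for i
    using subsetD[OF S(2) y[OF that]] x by (auto simp: j_def)
  have M1: "M \<ge> 1" using M by simp
  let ?l = "lagrange_coeff y M x"
  define E where "E = 12 ^ M * ((j * X) ^ M / fact M)"
  have E0: "E \<ge> 0" using j X by (simp add: E_def)
  note sl = sum_abs_lagrange_coeff_le[OF M1 j gap near]
  have "cmod (expo x t - (\<Sum>i<M. of_real (?l i) * expo (y i) t))
      \<le> (E + (1 + 12 ^ M) * exp (- (8 * real M))) * exp (\<psi> (norm t))" for t
  proof (cases "\<bar>t\<bar> \<le> X")
    case True
    have "cmod (expo x t - (\<Sum>i<M. of_real (?l i) * expo (y i) t)) \<le> 12 ^ M * ((j * \<bar>t\<bar>) ^ M / fact M)"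
      by (rule exp_interpolation_error[OF M1 j gap near])
    also have "\<dots> \<le> E * 1" unfolding E_def mult_1_right
      using True j by (intro mult_left_mono divide_right_mono power_mono) auto
    also have "\<dots> \<le> (E + (1 + 12 ^ M) * exp (- (8 * real M))) * exp (\<psi> (norm t))"
      using E0 nonneg[of "norm t"] by (intro mult_mono) auto
    finally show ?thesis .
  next
    case False
    have "\<psi> X \<le> \<psi> (norm t)" using False X by (intro mono_onD[OF mono]) auto
    \<comment> \<open>Beyond \<open>X\<close> the weight outgrows \<open>exp (8 * M)\<close>, so the
      crude bound \<open>1 + 12 ^ M\<close> for the difference already has the required
      form.\<close>
    then have e: "1 \<le> exp (- (8 * real M)) * exp (\<psi> (norm t))"
      using X by (simp add: exp_add[symmetric])
    have "cmod (expo x t - (\<Sum>i<M. of_real (?l i) * expo (y i) t))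
        \<le> cmod (expo x t) + cmod (\<Sum>i<M. of_real (?l i) * expo (y i) t)"
      by (rule norm_triangle_ineq4)
    also have "cmod (\<Sum>i<M. of_real (?l i) * expo (y i) t) \<le> (\<Sum>i<M. \<bar>?l i\<bar>)"
      by (rule sum_norm_le) (simp add: norm_mult)
    also note sl
    also have "cmod (expo x t) + 12 ^ M \<le> (1 + 12 ^ M) * (exp (- (8 * real M)) * exp (\<psi> (norm t)))"
      using mult_left_mono[OF e, of "1 + 12 ^ M"] by simp
    also have "\<dots> \<le> (E + (1 + 12 ^ M) * exp (- (8 * real M))) * exp (\<psi> (norm t))"
      using E0 by (simp add: distrib_right)
    finally show ?thesis by simp
  qed
  then have "psi_approx \<psi> (Phi \<Lambda>) (E + (1 + 12 ^ M) * exp (- (8 * real M))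
      + (\<Sum>i<M. cmod (of_real (?l i))) * exp (- (8 * real M))) (expo x)"
    using app y by (intro psi_approx_lincomb) auto
  moreover have "E + (1 + 12 ^ M) * exp (- (8 * real M))
      + (\<Sum>i<M. cmod (of_real (?l i))) * exp (- (8 * real M)) \<le> exp (- (4 * real M))"
  proof -
    have "(\<Sum>i<M. cmod (of_real (?l i))) * exp (- (8 * real M)) \<le> 12 ^ M * exp (- (8 * real M))"
      using sl by (intro mult_right_mono) auto
    moreover have "E + (1 + 2 * 12 ^ M) * exp (- (8 * real M)) \<le> exp (- (4 * real M))"
      unfolding E_def using len j X by (intro spread_numeric_bound M) (auto simp: j_def)
    ultimately show ?thesis unfolding distrib_right by linarith
  qed
  ultimately show ?thesis by (rule psi_approx_mono)
qed

subsection \<open>One-sided density points\<close>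

lemma fmeasurable_Int_Icc:
  assumes "A \<in> sets borel"
  shows "A \<inter> {u..v::real} \<in> fmeasurable lborel"
  by (rule fmeasurableI2[of "{u..v}"]) (use assms in \<open>auto intro: fmeasurable_compact\<close>)

lemma measure_Int_Icc_diff:
  assumes A: "A \<in> sets borel" and "a \<le> x" "x \<le> (z::real)"
  shows "measure lborel (A \<inter> {a..z}) = measure lborel (A \<inter> {a..x}) + measure lborel (A \<inter> {x..z})"
proof -
  have f: "A \<inter> {u..v} \<in> fmeasurable lborel" for u v
    using A by (rule fmeasurable_Int_Icc)
  have "measure lborel (A \<inter> {a..z}) = measure lborel (A \<inter> {a..x}) + measure lborel ((A \<inter> {x..z}) - {x})"
  proof -
    have "A \<inter> {a..z} = (A \<inter> {a..x}) \<union> ((A \<inter> {x..z}) - {x})" using assms by auto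
    moreover have "(A \<inter> {a..x}) \<inter> ((A \<inter> {x..z}) - {x}) = {}" by auto
    moreover have "A \<inter> {x..z} - {x} \<in> fmeasurable lborel"
      by (rule fmeasurable.Diff[OF f]) (auto intro: fmeasurable_compact)
    ultimately show ?thesis
      using f[of a x] measure_Union[of lborel "A \<inter> {a..x}" "A \<inter> {x..z} - {x}"]
      by (metis fmeasurableD fmeasurableD2 infinity_ennreal_def)
  qed
  also have "measure lborel ((A \<inter> {x..z}) - {x}) = measure lborel (A \<inter> {x..z})"
    by (rule measure_Diff_null_set) (use A in auto)
  finally show ?thesis .
qed

text \<open>The point is where \<open>x \<mapsto> |A \<inter> [a, x]| - (x - a) / 2\<close> attains its minimum over \<open>[a, b]\<close>.\<close>

lemma one_sided_density_point:
  fixes A :: "real set"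
  assumes A: "A \<in> sets borel" and dense: "measure lborel (A \<inter> {a..b}) > (b - a) / 2" and ab: "a \<le> b"
  obtains x\<^sub>0 where "x\<^sub>0 \<in> {a..<b}"
    "\<And>x. x \<in> {x\<^sub>0..b} \<Longrightarrow> measure lborel (A \<inter> {x\<^sub>0..x}) \<ge> (x - x\<^sub>0) / 2"
proof -
  define g where "g x = measure lborel (A \<inter> {a..x}) - (x - a) / 2" for x
  have lip: "\<bar>measure lborel (A \<inter> {a..z}) - measure lborel (A \<inter> {a..x})\<bar> \<le> \<bar>z - x\<bar>"
    if "a \<le> x" "x \<le> z" for x z
  proof -
    have "measure lborel (A \<inter> {x..z}) \<le> measure lborel {x..z}"
      using A by (intro measure_mono_fmeasurable) (auto intro: fmeasurable_compact)
    then show ?thesis using measure_Int_Icc_diff[OF A that] that by auto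
  qed
  have "continuous_on {a..b} (\<lambda>x. measure lborel (A \<inter> {a..x}))"
    unfolding continuous_on_iff dist_real_def
  proof (intro ballI allI impI)
    fix x e :: real assume x: "x \<in> {a..b}" "e > 0"
    show "\<exists>d>0. \<forall>x'\<in>{a..b}. \<bar>x' - x\<bar> < d \<longrightarrow> \<bar>measure lborel (A \<inter> {a..x'}) - measure lborel (A \<inter> {a..x})\<bar> < e"
    proof (intro exI[of _ e] conjI ballI impI x)
      fix x' assume "x' \<in> {a..b}" "\<bar>x' - x\<bar> < e"
      then show "\<bar>measure lborel (A \<inter> {a..x'}) - measure lborel (A \<inter> {a..x})\<bar> < e"
        using lip[of x x'] lip[of x' x] x by (cases "x \<le> x'") (auto simp: abs_minus_commute)
    qed
  qed
  then have "continuous_on {a..b} g" unfolding g_def by (intro continuous_intros) auto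
  then obtain x0 where x0: "x0 \<in> {a..b}" "\<And>x. x \<in> {a..b} \<Longrightarrow> g x0 \<le> g x"
    using continuous_attains_inf[of "{a..b}" g] ab by auto
  have "A \<inter> {a..a} \<subseteq> {a}" by auto
  then have "measure lborel (A \<inter> {a..a}) \<le> measure lborel {a..a}"
    using A by (intro measure_mono_fmeasurable) (auto intro: fmeasurable_compact)
  then have "g a \<le> 0" by (simp add: g_def)
  moreover have "g b > 0" using dense by (simp add: g_def)
  \<comment> \<open>Strictness in \<open>dense\<close> enters here: \<open>g a \<le> 0 < g b\<close>
    excludes the right endpoint as the minimum, so the interval to the right of \<open>x0\<close> is
    not degenerate.\<close>
  ultimately have "x0 \<noteq> b" using x0(2)[of a] ab by auto
  moreover have "measure lborel (A \<inter> {x0..x}) \<ge> (x - x0) / 2" if "x \<in> {x0..b}" for x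
    using x0(2)[of x] measure_Int_Icc_diff[OF A, of a x0 x] that x0(1) by (auto simp: g_def field_simps)
  ultimately show ?thesis using x0(1) by (intro that[of x0]) auto
qed

text \<open>A weak form of the Lebesgue density theorem. Otherwise take a bounded part
  \<open>B\<close> of \<open>A\<close> with positive measure and an open \<open>U\<close> around it
  of measure below twice that of \<open>B\<close>. Covering \<open>B\<close> by nonoverlapping
  intervals inside \<open>U\<close>, each at most half filled, gives \<open>B\<close> at most half
  the measure of \<open>U\<close>, a contradiction.\<close>

lemma exists_half_dense_interval:
  fixes A :: "real set"
  assumes A: "A \<in> sets borel" and pos: "emeasure lborel A > 0"
  shows "\<exists>a b. a \<le> b \<and> measure lborel (A \<inter> {a..b}) > (b - a) / 2"
proof (rule ccontr)
  assume "\<not> ?thesis"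
  then have half: "measure lborel (A \<inter> {a..b}) \<le> (b - a) / 2" if "a \<le> b" for a b
    using that by (meson not_le)
  have "\<exists>n::nat. emeasure lborel (A \<inter> {- real n..real n}) > 0"
  proof (rule ccontr)
    assume "\<not> ?thesis"
    then have "A \<inter> {- real n..real n} \<in> null_sets lborel" for n :: nat
      using A by (auto simp: null_sets_def not_less)
    then have "(\<Union>n::nat. A \<inter> {- real n..real n}) \<in> null_sets lborel"
      by (intro null_sets_UN) auto
    moreover have "(\<Union>n::nat. A \<inter> {- real n..real n}) = A"
    proof -
      have "\<exists>n::nat. x \<in> {- real n..real n}" for x :: real
      proof -
        obtain n :: nat where "\<bar>x\<bar> \<le> real n" using real_arch_simple by blast
        then show ?thesis by (intro exI[of _ n]) auto
      qed
      then show ?thesis by blast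
    qed
    ultimately show False using pos by (simp add: null_sets_def)
  qed
  then obtain n :: nat where n: "emeasure lborel (A \<inter> {- real n..real n}) > 0" by blast
  define B where "B = A \<inter> {- real n..real n}"
  have B: "B \<in> sets borel" using A by (simp add: B_def)
  have fB: "B \<in> fmeasurable lborel"
    unfolding B_def using A by (rule fmeasurable_Int_Icc)
  have mB: "measure lborel B > 0" using n fB by (simp add: B_def measure_def enn2real_positive_iff fmeasurable_def)
  obtain U where U: "open U" "B \<subseteq> U" "emeasure lborel (U - B) < ennreal (measure lborel B)"
    using outer_regular_lborel[OF B mB] by blast
  \<comment> \<open>The gauge forces the covering intervals, whose tags lie in \<open>B\<close>, to
    stay inside \<open>U\<close>; the other branch only completes \<open>g\<close> to a
    gauge.\<close>
  define g where "g x = (if x \<in> U then ball x (SOME r. r > 0 \<and> ball x r \<subseteq> U) else ball x 1)" for x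
  have gx: "x \<in> g x" "open (g x)" "x \<in> U \<Longrightarrow> g x \<subseteq> U" for x
  proof -
    have "(SOME r. r > 0 \<and> ball x r \<subseteq> U) > 0 \<and> ball x (SOME r. r > 0 \<and> ball x r \<subseteq> U) \<subseteq> U" if "x \<in> U"
      by (rule someI_ex) (use U(1) that in \<open>auto simp: open_contains_ball\<close>)
    then show "x \<in> g x" "open (g x)" "x \<in> U \<Longrightarrow> g x \<subseteq> U" by (auto simp: g_def)
  qed
  have "B \<subseteq> cbox (- real n) (real n + 1)" by (auto simp: B_def)
  moreover have "box (- real n) (real n + 1) \<noteq> {}" by (simp add: box_real)
  moreover have "gauge g" using gx by (auto simp: gauge_def)
  ultimately obtain D where D: "countable D"
      "\<And>K. K \<in> D \<Longrightarrow> interior K \<noteq> {} \<and> (\<exists>c d. K = cbox c d)"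
      "pairwise (\<lambda>P Q. interior P \<inter> interior Q = {}) D"
      "\<And>K. K \<in> D \<Longrightarrow> \<exists>x \<in> B \<inter> K. K \<subseteq> g x" "B \<subseteq> \<Union>D"
    by (rule covering_lemma) blast
  have KU: "K \<subseteq> U" if "K \<in> D" for K using D(4)[OF that] gx(3) U(2) by blast
  have disj: "disjoint_family_on (\<lambda>K. C \<inter> interior K) D" for C
    using D(3) by (auto simp: disjoint_family_on_def pairwise_def)
  have K: "emeasure lborel (B \<inter> interior K) \<le> ennreal (1/2) * emeasure lborel (interior K)" if KD: "K \<in> D" for K
  proof -
    obtain c d where cd: "K = {c..d}" "c < d"
      using D(2)[OF KD] by (metis box_ne_empty(2) box_real(1) cbox_interval greaterThanLessThan_empty_iff2 interior_cbox linorder_not_le)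
    have "measure lborel (A \<inter> {c..d}) \<le> (d - c) / 2" using half cd by auto
    moreover have "measure lborel (B \<inter> {c<..<d}) \<le> measure lborel (A \<inter> {c..d})"
      using A B by (intro measure_mono_fmeasurable fmeasurable_Int_Icc) (auto simp: B_def)
    moreover have "emeasure lborel (B \<inter> {c<..<d}) = ennreal (measure lborel (B \<inter> {c<..<d}))"
      using fB by (intro emeasure_eq_measure2 fmeasurable_Int_fmeasurable) auto
    moreover have "ennreal (1/2) * emeasure lborel {c<..<d} = ennreal ((d - c) / 2)"
      using cd by (simp add: ennreal_mult[symmetric] del: ennreal_half)
    ultimately show ?thesis unfolding cd(1) interior_atLeastAtMost_real
      by (simp add: ennreal_leI)
  qed
  \<comment> \<open>Only the interiors of the covering intervals are disjoint. Passing to them loses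
    countably many endpoints, a null set.\<close>
  have "(\<Union>K\<in>D. K - interior K) \<in> null_sets lborel"
  proof (rule null_sets_UN'[OF D(1)])
    fix K assume "K \<in> D"
    then obtain c d where "K = {c..d}" using D(2) by (metis cbox_interval)
    then have "K - interior K \<subseteq> {c, d}" by (auto simp: interior_atLeastAtMost_real)
    then show "K - interior K \<in> null_sets lborel"
      by (meson countable_imp_null_set_lborel countable_subset countable_insert countable_empty)
  qed
  then have "emeasure lborel B = emeasure lborel (B - (\<Union>K\<in>D. K - interior K))"
    using B by (simp add: emeasure_Diff_null_set)
  also have "\<dots> \<le> emeasure lborel (\<Union>K\<in>D. B \<inter> interior K)"
  proof (rule emeasure_mono)
    show "B - (\<Union>K\<in>D. K - interior K) \<subseteq> (\<Union>K\<in>D. B \<inter> interior K)" using D(5) by blast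
    show "(\<Union>K\<in>D. B \<inter> interior K) \<in> sets lborel"
      using B by (intro sets.countable_UN'' D(1)) auto
  qed
  also have "\<dots> = (\<integral>\<^sup>+K. emeasure lborel (B \<inter> interior K) \<partial>count_space D)"
    using B disj by (intro emeasure_UN_countable D(1)) auto
  also have "\<dots> \<le> (\<integral>\<^sup>+K. ennreal (1/2) * emeasure lborel (interior K) \<partial>count_space D)"
    using K by (intro nn_integral_mono) auto
  also have "\<dots> = ennreal (1/2) * (\<integral>\<^sup>+K. emeasure lborel (UNIV \<inter> interior K) \<partial>count_space D)"
    by (simp add: nn_integral_cmult)
  also have "(\<integral>\<^sup>+K. emeasure lborel (UNIV \<inter> interior K) \<partial>count_space D) = emeasure lborel (\<Union>K\<in>D. UNIV \<inter> interior K)"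
    using disj[of UNIV] by (intro emeasure_UN_countable[symmetric] D(1)) auto
  finally have "emeasure lborel B \<le> ennreal (1/2) * emeasure lborel (\<Union>K\<in>D. UNIV \<inter> interior K)" .
  also have "\<dots> \<le> ennreal (1/2) * emeasure lborel U"
  proof (intro mult_left_mono emeasure_mono)
    show "(\<Union>K\<in>D. UNIV \<inter> interior K) \<subseteq> U" using KU interior_subset by fastforce
  qed (use U in auto)
  finally have le: "emeasure lborel B \<le> ennreal (1/2) * emeasure lborel U" .
  have "emeasure lborel U \<le> emeasure lborel (U - B) + emeasure lborel B"
    using emeasure_subadditive[of "U - B" lborel B] U B by (simp add: Un_absorb2)
  also have "\<dots> < ennreal (measure lborel B) + ennreal (measure lborel B)"
    using U(3) fB by (simp add: emeasure_eq_measure2 ennreal_add_left_cancel_less add.commute)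
  also have "\<dots> = ennreal (2 * measure lborel B)"
    by (simp flip: ennreal_plus)
  finally have lt: "emeasure lborel U < ennreal (2 * measure lborel B)" .
  then obtain u where u: "u \<ge> 0" "emeasure lborel U = ennreal u"
    by (cases "emeasure lborel U") auto
  have "ennreal (measure lborel B) \<le> ennreal (u / 2)"
    using le u fB by (simp add: emeasure_eq_measure2 del: ennreal_half flip: ennreal_mult)
  moreover have "u < 2 * measure lborel B" using lt u by (simp add: ennreal_less_iff)
  ultimately show False using u(1) by (simp add: ennreal_le_iff)
qed

subsection \<open>Divergent logarithmic integral on the line\<close>

locale increasing_weight =
  fixes \<psi> :: "real \<Rightarrow> real"
  assumes cont: "continuous_on {0..} \<psi>"
    and mono: "mono_on {0..} \<psi>"
    and nonneg: "\<And>x. x \<ge> 0 \<Longrightarrow> \<psi> x \<ge> 0"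
    and lim: "filterlim \<psi> at_top at_top"

context increasing_weight
begin

lemma mono': "0 \<le> x \<Longrightarrow> x \<le> y \<Longrightarrow> \<psi> x \<le> \<psi> y"
  using mono by (auto simp: mono_on_def)

lemma attains_level:
  assumes "c \<ge> \<psi> 0"
  shows "\<exists>x\<ge>0. \<psi> x = c"
proof -
  obtain b where b: "\<And>x. x \<ge> b \<Longrightarrow> \<psi> x \<ge> c"
    using lim by (auto simp: filterlim_at_top eventually_at_top_linorder)
  have "\<exists>x\<ge>0. x \<le> max 0 b \<and> \<psi> x = c"
    using assms b by (intro IVT' continuous_on_subset[OF cont]) auto
  then show ?thesis by auto
qed

text \<open>With the integrand as a density, cutting the logarithmic integral into countably many
  pieces is (sub)additivity of a measure. The indicator restricts to the half line on which the
  weight is controlled.\<close>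

definition log_measure :: "real measure" where
  "log_measure = density lborel (\<lambda>x. ennreal (indicat_real {0..} x *\<^sub>R (\<psi> x / (1 + x\<^sup>2))))"

lemma sets_log_measure [simp]: "sets log_measure = sets borel"
  by (simp add: log_measure_def)

lemma emeasure_log_measure:
  assumes "B \<subseteq> {0..}" "B \<in> sets borel"
  shows "emeasure log_measure B = (\<integral>\<^sup>+x\<in>B. ennreal (\<psi> x / (1 + x\<^sup>2)) \<partial>lborel)"
proof -
  have "(\<lambda>x. indicat_real {0..} x *\<^sub>R (\<psi> x / (1 + x\<^sup>2))) \<in> borel_measurable borel"
    by (intro borel_measurable_continuous_on_indicator continuous_intros cont)
      (auto simp: add_nonneg_eq_0_iff)
  then show ?thesis
    using assms unfolding log_measure_def
    by (auto simp: emeasure_density indicator_def intro!: nn_integral_cong)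
qed

text \<open>From \<open>X k\<close> to \<open>X (Suc k)\<close> the weight is at most
  \<open>2 ^ Suc k\<close>, and the integral of \<open>1 / x\<^sup>2\<close> there is at most
  \<open>1 / X k\<close>. So the logarithmic integral is bounded by a constant plus twice the
  series.\<close>

lemma dyadic_level_sum_diverges:
  fixes X :: "nat \<Rightarrow> real"
  assumes X: "\<And>k. k \<ge> K \<Longrightarrow> X k > 0" "\<And>k. k \<ge> K \<Longrightarrow> \<psi> (X k) = 2 ^ k"
    and div: "(\<integral>\<^sup>+x\<in>{0..}. ennreal (\<psi> x / (1 + x\<^sup>2)) \<partial>lborel) = \<infinity>"
  shows "\<not> summable (\<lambda>i. 2 ^ (K + i) / X (K + i))"
proof
  assume summ: "summable (\<lambda>i. 2 ^ (K + i) / X (K + i))"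
  have inc: "X (K + i) \<le> X (K + j)" if "i \<le> j" for i j
  proof (rule ccontr)
    assume gt: "\<not> X (K + i) \<le> X (K + j)"
    then have "\<psi> (X (K + j)) \<le> \<psi> (X (K + i))" "X (K + j) < X (K + i)"
      using X(1)[of "K + j"] by (auto intro!: mono')
    then have "j \<le> i" using X(2)[of "K+i"] X(2)[of "K+j"] by simp
    then show False using that gt by simp
  qed
  have cover: "{0..} \<subseteq> {0..X K} \<union> (\<Union>i. {X (K + i)..X (K + Suc i)})"
  proof
    fix x :: real assume x: "x \<in> {0..}"
    show "x \<in> {0..X K} \<union> (\<Union>i. {X (K + i)..X (K + Suc i)})"
    proof (cases "x \<le> X K")
      case False
      have "\<exists>i. x < X (K + i)"
      proof -
        obtain n where n: "\<psi> x < 2 ^ n" using real_arch_pow[of 2 "\<psi> x"] by auto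
        have "(2::real) ^ n \<le> 2 ^ (K + n)" by simp
        then have "\<psi> x < \<psi> (X (K + n))" using n X(2)[of "K + n"] by linarith
        then have "x < X (K + n)" using mono'[of "X (K + n)" x] X(1)[of "K + n"] by fastforce
        then show ?thesis ..
      qed
      define i where "i = (LEAST i. x < X (K + i))"
      have i: "x < X (K + i)" unfolding i_def by (rule LeastI_ex) fact
      have "i \<noteq> 0" using i False by (intro notI) simp
      then obtain i' where i': "i = Suc i'" by (cases i) auto
      have "\<not> x < X (K + i')" using not_less_Least[of i' "\<lambda>i. x < X (K + i)"] i' by (simp add: i_def)
      then show ?thesis using i i' by (intro UnI2 UN_I[of i']) auto
    qed (use x in auto)
  qed
  have first: "(\<integral>\<^sup>+x\<in>{0..X K}. ennreal (\<psi> x / (1 + x\<^sup>2)) \<partial>lborel) \<le> ennreal (2 ^ K * X K)"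
  proof -
    have "(\<integral>\<^sup>+x\<in>{0..X K}. ennreal (\<psi> x / (1 + x\<^sup>2)) \<partial>lborel) \<le> (\<integral>\<^sup>+x. ennreal (2 ^ K) * indicator {0..X K} x \<partial>lborel)"
    proof (intro nn_integral_mono)
      fix x
      have "\<psi> x / (1 + x\<^sup>2) \<le> 2 ^ K" if "0 \<le> x" "x \<le> X K"
      proof -
        have "0 < 1 + x\<^sup>2" "1 \<le> 1 + x\<^sup>2" by (simp_all add: add_pos_nonneg)
        then have "\<psi> x / (1 + x\<^sup>2) \<le> \<psi> x"
          using divide_left_mono[of 1 "1 + x\<^sup>2" "\<psi> x"] nonneg[OF that(1)] by (metis div_by_1 mult.right_neutral)
        also have "\<dots> \<le> 2 ^ K" using mono'[OF that] X(2)[of K] by simp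
        finally show ?thesis .
      qed
      then show "ennreal (\<psi> x / (1 + x\<^sup>2)) * indicator {0..X K} x \<le> ennreal (2 ^ K) * indicator {0..X K} x"
        by (auto simp: indicator_def ennreal_leI simp del: ennreal_power)
    qed
    also have "\<dots> = ennreal (2 ^ K * X K)"
      using X(1)[of K] by (simp add: nn_integral_cmult_indicator ennreal_mult)
    finally show ?thesis .
  qed
  have piece: "(\<integral>\<^sup>+x\<in>{X (K + i)..X (K + Suc i)}. ennreal (\<psi> x / (1 + x\<^sup>2)) \<partial>lborel)
      \<le> ennreal (2 * (2 ^ (K + i) / X (K + i)))" for i
  proof -
    let ?a = "X (K + i)" and ?b = "X (K + Suc i)"
    have ab: "0 < ?a" "?a \<le> ?b" using X(1)[of "K + i"] inc[of i "Suc i"] by auto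
    have "(\<integral>\<^sup>+x\<in>{?a..?b}. ennreal (\<psi> x / (1 + x\<^sup>2)) \<partial>lborel)
        \<le> (\<integral>\<^sup>+x\<in>{?a..?b}. ennreal (2 ^ (K + Suc i) / x\<^sup>2) \<partial>lborel)"
    proof (intro nn_integral_mono)
      fix x
      have "\<psi> x / (1 + x\<^sup>2) \<le> 2 ^ (K + Suc i) / x\<^sup>2" if "?a \<le> x" "x \<le> ?b"
      proof (rule frac_le)
        show "\<psi> x \<le> 2 ^ (K + Suc i)" using mono'[of x ?b] X(2)[of "K + Suc i"] that ab by auto
      qed (use that ab in auto)
      then show "ennreal (\<psi> x / (1 + x\<^sup>2)) * indicator {?a..?b} x
          \<le> ennreal (2 ^ (K + Suc i) / x\<^sup>2) * indicator {?a..?b} x"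
        by (auto simp: indicator_def ennreal_leI)
    qed
    also have "\<dots> = ennreal ((\<lambda>x. - (2 ^ (K + Suc i) / x)) ?b - (\<lambda>x. - (2 ^ (K + Suc i) / x)) ?a)"
    proof (rule nn_integral_FTC_Icc)
      fix x assume x: "x \<in> {?a..?b}"
      show "((\<lambda>x. - (2 ^ (K + Suc i) / x)) has_real_derivative 2 ^ (K + Suc i) / x\<^sup>2) (at x)"
        using x ab by (auto simp: power2_eq_square intro!: derivative_eq_intros)
    qed (use ab in auto)
    also have "\<dots> \<le> ennreal (2 * (2 ^ (K + i) / ?a))"
      using ab by (intro ennreal_leI) simp
    finally show ?thesis .
  qed
  have sub: "{X (K + i)..X (K + Suc i)} \<subseteq> {0..}" for i using X(1)[of "K + i"] by auto
  have "\<infinity> = emeasure (log_measure) {0..}" using div by (simp add: emeasure_log_measure)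
  also have "\<dots> \<le> emeasure (log_measure) ({0..X K} \<union> (\<Union>i. {X (K + i)..X (K + Suc i)}))"
    by (intro emeasure_mono cover) auto
  also have "\<dots> \<le> emeasure (log_measure) {0..X K} + emeasure (log_measure) (\<Union>i. {X (K + i)..X (K + Suc i)})"
    by (intro emeasure_subadditive) auto
  also have "emeasure (log_measure) (\<Union>i. {X (K + i)..X (K + Suc i)})
      \<le> (\<Sum>i. emeasure (log_measure) {X (K + i)..X (K + Suc i)})"
    by (intro emeasure_subadditive_countably) auto
  also have "\<dots> \<le> (\<Sum>i. ennreal (2 * (2 ^ (K + i) / X (K + i))))"
  proof (intro suminf_le summableI)
    show "emeasure (log_measure) {X (K + i)..X (K + Suc i)} \<le> ennreal (2 * (2 ^ (K + i) / X (K + i)))" for i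
      using piece[of i] emeasure_log_measure[OF sub[of i]] by simp
  qed
  also have "\<dots> = ennreal (\<Sum>i. 2 * (2 ^ (K + i) / X (K + i)))"
    using X(1) summ by (intro suminf_ennreal2 summable_mult) (auto intro: less_imp_le)
  also have "emeasure (log_measure) {0..X K} \<le> ennreal (2 ^ K * X K)"
    using first by (simp add: emeasure_log_measure)
  finally have "\<infinity> \<le> ennreal (2 ^ K * X K) + ennreal (\<Sum>i. 2 * (2 ^ (K + i) / X (K + i)))"
    by (simp add: add_right_mono)
  then show False by (simp add: top_unique)
qed

text \<open>Descending through the levels \<open>\<psi> (X k) = 2 ^ k\<close>, the interval of approximable frequencies to the
  right of a density point grows by \<open>\<rho> k\<close> at level \<open>k\<close>, and \<open>\<Sum> \<rho> k = \<infinity>\<close>.  While the interval is shorter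
  than \<open>\<rho> k\<close>, the nodes are taken from \<open>E\<close> itself.\<close>

lemma approx_half_line:
  assumes div: "(\<integral>\<^sup>+x\<in>{0..}. ennreal (\<psi> x / (1 + x\<^sup>2)) \<partial>lborel) = \<infinity>"
    and E: "closed E" "emeasure lborel E > 0" "E \<subseteq> {..c}"
    and \<xi>: "\<xi> \<ge> c" and \<epsilon>: "\<epsilon> > 0"
  shows "psi_approx \<psi> (Phi E) \<epsilon> (expo (\<xi>::real))"
proof -
  have Eb: "E \<in> sets borel" using E(1) by simp
  obtain a b where "a \<le> b" "measure lborel (E \<inter> {a..b}) > (b - a) / 2"
    using exists_half_dense_interval[OF Eb E(2)] by blast
  then obtain x0 where x0: "x0 \<in> {a..<b}"
      "\<And>x. x \<in> {x0..b} \<Longrightarrow> measure lborel (E \<inter> {x0..x}) \<ge> (x - x0) / 2"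
    using one_sided_density_point[OF Eb] by blast
  define l0 where "l0 = b - x0"
  have l0: "l0 > 0" using x0(1) by (simp add: l0_def)
  have "measure lborel (E \<inter> {x0..b}) > 0" using x0(2)[of b] x0(1) by auto
  then have "E \<inter> {x0..b} \<noteq> {}" by (metis less_irrefl measure_empty)
  then have x0\<xi>: "x0 \<le> \<xi>" using E(3) \<xi> by fastforce
  obtain K0 where K0: "\<psi> 0 < 2 ^ K0" using real_arch_pow[of 2 "\<psi> 0"] by auto
  \<comment> \<open>The summand 4 makes the number \<open>2 ^ (k - 2)\<close> of nodes used at level
    \<open>k\<close> at least 2.\<close>
  define K where "K = K0 + 4"
  have lev: "\<psi> 0 < 2 ^ k" if "k \<ge> K" for k
  proof -
    have "(2::real) ^ K0 \<le> 2 ^ k" using that by (simp add: K_def)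
    then show ?thesis using K0 by linarith
  qed
  have "\<exists>X. X > 0 \<and> \<psi> X = 2 ^ k" if k: "k \<ge> K" for k
  proof -
    obtain X where X: "X \<ge> 0" "\<psi> X = 2 ^ k" using attains_level[of "2 ^ k"] lev[OF k] by auto
    then have "X \<noteq> 0" using lev[OF k] by auto
    then show ?thesis using X by (intro exI[of _ X]) auto
  qed
  then obtain X where X: "\<And>k. k \<ge> K \<Longrightarrow> X k > 0" "\<And>k. k \<ge> K \<Longrightarrow> \<psi> (X k) = 2 ^ k" by metis
  \<comment> \<open>The first entry is the length allowed by \<open>approx_spread\<close>. The cap
    \<open>l0 / 2\<close> keeps an interval of length \<open>2 * \<rho> k\<close> from
    \<open>x0\<close> inside the range where the density bound holds.\<close>
  define \<rho> where "\<rho> k = min (2 ^ k / (100000 * X k)) (l0 / 2)" for k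
  have \<rho>: "\<rho> k > 0" if "k \<ge> K" for k using X(1)[OF that] l0 by (simp add: \<rho>_def)
  define near where "near k x \<longleftrightarrow> psi_approx \<psi> (Phi E) (exp (- (2 ^ k))) (expo x)" for k :: nat and x
  have near_mono: "near k x" if "near (Suc k) x" for k x
    using that unfolding near_def by (rule psi_approx_mono) simp
  \<comment> \<open>For \<open>s = 0\<close> the hypothesis is void: this is the start of a descent,
    where nothing is known at the level above.\<close>
  have step: "near k x"
    if k: "k \<ge> K" and s: "s \<ge> 0" "\<And>x. s > 0 \<Longrightarrow> x \<in> {x0..x0 + s} \<Longrightarrow> near (Suc k) x"
      and x: "x \<in> {x0..x0 + s + \<rho> (Suc k)}" for k s x
  proof -
    \<comment> \<open>Chosen so that \<open>8 * M\<close> is the level \<open>2 ^ Suc k\<close> come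
      from and \<open>4 * M\<close> the level \<open>2 ^ k\<close> to be reached.\<close>
    define M :: nat where "M = 2 ^ (k - 2)"
    define r where "r = \<rho> (Suc k)"
    have k4: "k \<ge> 4" using k by (simp add: K_def)
    have "(2::nat) ^ 1 \<le> 2 ^ (k - 2)" using k4 by (intro power_increasing) auto
    then have M2: "M \<ge> 2" by (simp add: M_def)
    have M4: "4 * real M = 2 ^ k"
    proof -
      have "4 * real M = 2 ^ 2 * 2 ^ (k - 2)" by (simp add: M_def)
      also have "\<dots> = 2 ^ (2 + (k - 2))" by (rule power_add[symmetric])
      also have "2 + (k - 2) = k" using k4 by simp
      finally show ?thesis .
    qed
    have M8: "8 * real M = 2 ^ Suc k" using M4 by simp
    have XX: "X (Suc k) > 0" "\<psi> (X (Suc k)) = 2 ^ Suc k" using X[of "Suc k"] k by auto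
    have r: "r > 0" "2 * r \<le> l0" "2 * r * X (Suc k) \<le> 16 * real M / 100000"
    proof -
      show "r > 0" using \<rho>[of "Suc k"] k by (simp add: r_def)
      show "2 * r \<le> l0" by (simp add: r_def \<rho>_def)
      have "r * X (Suc k) \<le> 2 ^ Suc k / (100000 * X (Suc k)) * X (Suc k)"
        unfolding r_def \<rho>_def using XX by (intro mult_right_mono) auto
      then show "2 * r * X (Suc k) \<le> 16 * real M / 100000" using XX M8 by (simp add: field_simps)
    qed
    have spread: "near k x"
      if S: "compact S" "S \<subseteq> {u..v}" "measure lborel S \<ge> (v - u) / 2" "u < v" "v - u \<le> 2 * r"
        and ns: "\<And>y. y \<in> S \<Longrightarrow> near (Suc k) y" and xuv: "x \<in> {u..v}" for S u v
    proof -
      have "(v - u) * X (Suc k) \<le> 2 * r * X (Suc k)" using S(5) XX by (intro mult_right_mono) auto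
      then have len: "(v - u) * X (Suc k) \<le> 16 * real M / 100000" using r(3) by linarith
      have app: "psi_approx \<psi> (Phi E) (exp (- (8 * real M))) (expo y)" if "y \<in> S" for y
        using ns[OF that] unfolding near_def M8 .
      have "psi_approx \<psi> (Phi E) (exp (- (4 * real M))) (expo x)"
        by (rule approx_spread[OF mono nonneg M2 _ _ S(1-4) len app xuv]) (use XX M8 in auto)
      then show ?thesis by (simp add: near_def M4)
    qed
    show ?thesis
    proof (cases "s \<ge> r")
      case True
      show ?thesis
      proof (cases "x \<le> x0 + s")
        case True
        show ?thesis by (rule near_mono[OF s(2)]) (use True \<open>s \<ge> r\<close> r x in auto)
      next
        case False
        \<comment> \<open>The last stretch of length \<open>r\<close> already reached is the left
          half of an interval of length \<open>2 * r\<close> whose right half is new.\<close>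
        show ?thesis
          by (rule spread[of "{x0 + s - r..x0 + s}" "x0 + s - r" "x0 + s + r"])
            (use False True s r x in \<open>auto simp: r_def\<close>)
      qed
    next
      case False
      \<comment> \<open>Here the interval has length below \<open>2 * r\<close>, hence at most
        \<open>l0\<close>. The choice of \<open>x0\<close> makes \<open>E\<close> fill half of it,
        and exponentials with frequency in \<open>E\<close> are in the span without any
        error.\<close>
      have "x0 + s + r \<in> {x0..b}" using False r s by (auto simp: l0_def)
      from x0(2)[OF this] have m: "measure lborel (E \<inter> {x0..x0 + s + r}) \<ge> (s + r) / 2" by simp
      show ?thesis
      proof (rule spread[of "E \<inter> {x0..x0 + s + r}" x0 "x0 + s + r"])
        show "near (Suc k) y" if "y \<in> E \<inter> {x0..x0 + s + r}" for y
          using that unfolding near_def by (intro psi_approx_self Phi_expo) auto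
      qed (use m False r s x E(1) in \<open>auto simp: r_def closed_Int_compact\<close>)
    qed
  qed
  \<comment> \<open>The descent starts \<open>n\<close> levels above \<open>K + m\<close>; the
    induction removes the lowest level by passing to \<open>Suc m\<close>. Positivity of the sum
    excludes an empty descent, which would yield nothing even at \<open>x0\<close>.\<close>
  have iter: "near (K + m) x"
    if "x \<in> {x0..x0 + (\<Sum>i<n. \<rho> (K + Suc m + i))}" "(\<Sum>i<n. \<rho> (K + Suc m + i)) > 0" for m n x
    using that
  proof (induction n arbitrary: m x)
    case 0
    then show ?case by simp
  next
    case (Suc n)
    have "(\<Sum>i<Suc n. \<rho> (K + Suc m + i)) = \<rho> (Suc (K + m)) + (\<Sum>i<n. \<rho> (K + Suc (Suc m) + i))"
      by (subst sum.lessThan_Suc_shift) simp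
    then have x: "x \<in> {x0..x0 + (\<Sum>i<n. \<rho> (K + Suc (Suc m) + i)) + \<rho> (Suc (K + m))}"
      using Suc.prems(1) by simp
    show ?case
    proof (rule step[OF _ _ _ x])
      show "(\<Sum>i<n. \<rho> (K + Suc (Suc m) + i)) \<ge> 0"
        using \<rho> by (intro sum_nonneg less_imp_le) auto
      show "near (Suc (K + m)) y"
        if "(\<Sum>i<n. \<rho> (K + Suc (Suc m) + i)) > 0" "y \<in> {x0..x0 + (\<Sum>i<n. \<rho> (K + Suc (Suc m) + i))}" for y
        using Suc.IH[OF that(2,1)] by simp
    qed simp
  qed
  have "\<not> summable (\<lambda>i. \<rho> (K + i))"
  proof
    assume summ: "summable (\<lambda>i. \<rho> (K + i))"
    then have "(\<lambda>i. \<rho> (K + i)) \<longlonglongrightarrow> 0" by (rule summable_LIMSEQ_zero)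
    then have "eventually (\<lambda>i. \<rho> (K + i) < l0 / 2) sequentially"
      using l0 by (intro order_tendstoD) auto
    \<comment> \<open>If the series of the \<open>\<rho>\<close> converged, its terms would tend to
      0 and the cap would eventually be inactive, so that the dyadic series would converge
      too.\<close>
    then have "eventually (\<lambda>i. 2 ^ (K + i) / X (K + i) = 100000 * \<rho> (K + i)) sequentially"
    proof eventually_elim
      case (elim i)
      then show ?case by (auto simp: \<rho>_def min_def split: if_splits)
    qed
    then have "summable (\<lambda>i. 2 ^ (K + i) / X (K + i)) \<longleftrightarrow> summable (\<lambda>i. 100000 * \<rho> (K + i))"
      by (rule summable_cong)
    then show False
      using dyadic_level_sum_diverges[OF X div] summ by (simp add: summable_mult)
  qed
  then have nsum: "\<not> summable (\<lambda>i. \<rho> (K + Suc m + i))" for m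
    using summable_iff_shift[of "\<lambda>i. \<rho> (K + i)" "Suc m"] by (simp add: algebra_simps)
  have all: "near (K + m) \<xi>" for m
  proof -
    \<comment> \<open>The final level \<open>K + m\<close> is fixed and only the height
      \<open>n\<close> of the start grows.\<close>
    have "\<exists>n. (\<Sum>i<n. \<rho> (K + Suc m + i)) > \<xi> - x0"
    proof (rule ccontr)
      assume "\<not> ?thesis"
      then have "summable (\<lambda>i. \<rho> (K + Suc m + i))"
        using \<rho> by (intro summableI_nonneg_bounded[of _ "\<xi> - x0"]) (auto simp: not_less intro: less_imp_le)
      then show False using nsum by simp
    qed
    then obtain n where n: "(\<Sum>i<n. \<rho> (K + Suc m + i)) > \<xi> - x0" ..
    then show ?thesis using x0\<xi> by (intro iter[where n = n]) auto
  qed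
  obtain m :: nat where m: "- ln \<epsilon> < real m" using reals_Archimedean2 by blast
  have "real m < 2 ^ m" by (rule of_nat_less_two_power)
  also have "(2::real) ^ m \<le> 2 ^ (K + m)" by (intro power_increasing) auto
  finally have "- (2 ^ (K + m)) \<le> ln \<epsilon>" using m by linarith
  then have "exp (- (2 ^ (K + m))) \<le> exp (ln \<epsilon>)" by (simp only: exp_le_cancel_iff)
  then have "exp (- (2 ^ (K + m))) \<le> \<epsilon>" using \<epsilon> by simp
  then show ?thesis using all[of m] unfolding near_def by (rule psi_approx_mono[rotated])
qed

text \<open>Replacing \<open>x\<close> by \<open>- x\<close> leaves the weight unchanged and negates
  every frequency.\<close>

lemma psi_approx_reflect:
  assumes "psi_approx \<psi> (Phi F) \<epsilon> (expo \<xi>)"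
  shows "psi_approx \<psi> (Phi (uminus ` F)) \<epsilon> (expo (- \<xi>))"
proof -
  obtain G c where G: "finite G" "G \<subseteq> F"
      "\<And>x. cmod (expo \<xi> x - (\<Sum>l\<in>G. c l * expo l x)) \<le> \<epsilon> * exp (\<psi> (norm x))"
    using assms by (auto simp: psi_approx_def Phi_def)
  have "(\<Sum>l\<in>G. c l * expo l (- x)) = (\<Sum>l\<in>uminus ` G. c (- l) * expo l x)" for x
    by (simp add: sum.reindex expo_def)
  then have "cmod (expo (- \<xi>) x - (\<Sum>l\<in>uminus ` G. c (- l) * expo l x)) \<le> \<epsilon> * exp (\<psi> (norm x))" for x
    using G(3)[of "- x"] by (simp add: expo_def)
  moreover have "(\<lambda>x. \<Sum>l\<in>uminus ` G. c (- l) * expo l x) \<in> Phi (uminus ` F)"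
    using G(1,2) unfolding Phi_def by (intro CollectI exI[of _ "uminus ` G"] exI[of _ "\<lambda>l. c (- l)"]) auto
  ultimately show ?thesis unfolding psi_approx_def by (intro bexI) auto
qed

text \<open>A bounded-above part of \<open>E\<close> gives only the frequencies from some
  \<open>c\<close> to the right. These contain \<open>{c..c + 1}\<close>, and the reflection of this
  interval gives everything to the left of \<open>c\<close>.\<close>

lemma approx_line:
  assumes div: "(\<integral>\<^sup>+x\<in>{0..}. ennreal (\<psi> x / (1 + x\<^sup>2)) \<partial>lborel) = \<infinity>"
    and E: "closed E" "emeasure lborel E > 0" and \<epsilon>: "\<epsilon> > 0"
  shows "psi_approx \<psi> (Phi E) \<epsilon> (expo (\<xi>::real))"
proof -
  have "\<exists>n::nat. emeasure lborel (E \<inter> {..real n}) > 0"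
  proof (rule ccontr)
    assume "\<not> ?thesis"
    then have "E \<inter> {..real n} \<in> null_sets lborel" for n :: nat
      using E by (auto simp: null_sets_def not_less)
    then have "(\<Union>n::nat. E \<inter> {..real n}) \<in> null_sets lborel" by (intro null_sets_UN) auto
    moreover have "(\<Union>n::nat. E \<inter> {..real n}) = E" using real_arch_simple by blast
    ultimately show False using E by (simp add: null_sets_def)
  qed
  then obtain n :: nat where n: "emeasure lborel (E \<inter> {..real n}) > 0" ..
  define c where "c = real n"
  have right: "psi_approx \<psi> (Phi E) \<epsilon> (expo \<xi>)" if "\<xi> \<ge> c" "\<epsilon> > 0" for \<xi> \<epsilon>
  proof -
    have "psi_approx \<psi> (Phi (E \<inter> {..c})) \<epsilon> (expo \<xi>)"
      using n E that by (intro approx_half_line[OF div]) (auto simp: c_def)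
    then show ?thesis using Phi_mono[of "E \<inter> {..c}" E] unfolding psi_approx_def by blast
  qed
  show ?thesis
  proof (cases "\<xi> \<ge> c")
    case False
    have left: "psi_approx \<psi> (Phi {c..c + 1}) \<epsilon> (expo \<xi>)" if "\<epsilon> > 0" for \<epsilon>
    proof -
      have "psi_approx \<psi> (Phi {- c - 1..- c}) \<epsilon> (expo (- \<xi>))"
        using False that by (intro approx_half_line[OF div, where c = "- c"]) auto
      from psi_approx_reflect[OF this] show ?thesis by (simp add: add.commute)
    qed
    show ?thesis
      by (rule psi_approx_trans[OF _ left \<epsilon>]) (use right in auto)
  qed (use right \<epsilon> in auto)
qed

end

subsection \<open>Density in several variables\<close>

lemma expo_add: "expo (l + k) x = expo l x * expo k x"
  by (simp add: expo_def inner_add_left exp_add[symmetric] algebra_simps)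

lemma expo_zero: "expo 0 = (\<lambda>x. 1)"
  by (auto simp: expo_def)

lemma Phi_mult:
  assumes "u \<in> Phi UNIV" "v \<in> Phi UNIV"
  shows "(\<lambda>x. u x * v x) \<in> Phi UNIV"
proof -
  obtain F c where F: "finite F" "u = (\<lambda>x. \<Sum>l\<in>F. c l * expo l x)"
    using assms by (auto simp: Phi_def)
  obtain G d where G: "finite G" "v = (\<lambda>x. \<Sum>k\<in>G. d k * expo k x)"
    using assms by (auto simp: Phi_def)
  have "(\<lambda>x. u x * v x) = (\<lambda>x. \<Sum>l\<in>F. c l * (\<Sum>k\<in>G. d k * expo (l + k) x))"
    unfolding F G sum_distrib_left sum_distrib_right
    by (subst sum.swap) (simp add: expo_add mult_ac)
  also have "\<dots> \<in> Phi UNIV"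
    using F G by (intro Phi_sum Phi_cmult Phi_expo) auto
  finally show ?thesis .
qed

lemma Phi_const: "(\<lambda>x. a) \<in> Phi UNIV"
  using Phi_cmult[OF Phi_expo, of 0 UNIV a] by (simp add: expo_zero)

lemma Phi_sin: "(\<lambda>x. of_real (sin (l \<bullet> x))) \<in> Phi UNIV"
proof -
  have "(\<lambda>x. of_real (sin (l \<bullet> x))) = (\<lambda>x. (\<i> / 2) * expo l x + (- \<i> / 2) * expo (- l) x)"
    by (auto simp: expo_def sin_exp_eq field_simps simp flip: sin_of_real)
  also have "\<dots> \<in> Phi UNIV" by (intro Phi_add Phi_cmult Phi_expo) auto
  finally show ?thesis .
qed

lemma Phi_real_polynomial:
  fixes s :: "'a::euclidean_space \<Rightarrow> 'b::euclidean_space"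
  assumes "real_polynomial_function p"
    and s: "\<And>b. b \<in> Basis \<Longrightarrow> (\<lambda>x. of_real (s x \<bullet> b)) \<in> Phi UNIV"
  shows "(\<lambda>x. of_real (p (s x))) \<in> Phi UNIV"
  using assms(1)
proof induction
  case (linear f)
  have "f (s x) = (\<Sum>b\<in>Basis. f b * (s x \<bullet> b))" for x
  proof -
    interpret f: bounded_linear f by fact
    have "f (s x) = f (\<Sum>b\<in>Basis. (s x \<bullet> b) *\<^sub>R b)" by (simp add: euclidean_representation)
    then show ?thesis by (simp add: f.sum f.scaleR mult.commute)
  qed
  then show ?case using s by (auto intro!: Phi_sum Phi_cmult)
qed (auto intro: Phi_const Phi_add Phi_mult)

lemma Phi_polynomial:
  fixes s :: "'a::euclidean_space \<Rightarrow> 'b::euclidean_space" and p :: "'b \<Rightarrow> complex"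
  assumes p: "polynomial_function p"
    and s: "\<And>b. b \<in> Basis \<Longrightarrow> (\<lambda>x. of_real (s x \<bullet> b)) \<in> Phi UNIV"
  shows "(\<lambda>x. p (s x)) \<in> Phi UNIV"
proof -
  have "real_polynomial_function (\<lambda>x. Re (p x))" "real_polynomial_function (\<lambda>x. Im (p x))"
    using p bounded_linear_Re bounded_linear_Im unfolding polynomial_function_def o_def by auto
  note * = this[THEN Phi_real_polynomial, OF s]
  have "(\<lambda>x. p (s x)) = (\<lambda>x. of_real (Re (p (s x))) + \<i> * of_real (Im (p (s x))))"
    by (simp add: complex_eq[symmetric])
  also have "\<dots> \<in> Phi UNIV" by (intro Phi_add Phi_cmult *)
  finally show ?thesis .
qed

text \<open>Composing with \<open>x \<mapsto> sin (x / A)\<close> folds the whole space onto a cube, so that a polynomial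
  approximation on the cube becomes a globally bounded trigonometric one.\<close>

lemma bounded_trigonometric_approximation:
  fixes g :: "real ^ 'n \<Rightarrow> complex"
  assumes g: "continuous_on UNIV g" "\<And>x. cmod (g x) \<le> B" and R: "R > 0" and e: "e > 0"
  shows "\<exists>T\<in>Phi UNIV. (\<forall>x. norm x \<le> R \<longrightarrow> cmod (g x - T x) < e) \<and> (\<forall>x. cmod (T x) \<le> B + e)"
proof -
  \<comment> \<open>For \<open>norm x \<le> R\<close> each \<open>x $ j / A\<close> lies between
    \<open>- pi / 2\<close> and \<open>pi / 2\<close>, where \<open>arcsin\<close> inverts
    \<open>sin\<close>.\<close>
  define A where "A = 2 * R / pi"
  have A: "A > 0" using R by (simp add: A_def)
  define Q :: "(real ^ 'n) set" where "Q = cbox (- 1) 1"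
  have Q: "y \<in> Q \<longleftrightarrow> (\<forall>j. - 1 \<le> y $ j \<and> y $ j \<le> 1)" for y
    by (simp add: Q_def mem_box_cart)
  define s :: "real ^ 'n \<Rightarrow> real ^ 'n" where "s x = (\<chi> j. sin (x $ j / A))" for x
  \<comment> \<open>\<open>G (s x) = g x\<close> holds only on the ball of radius \<open>R\<close>;
    elsewhere \<open>G\<close> is still bounded by \<open>B\<close>, and this gives the global
    bound.\<close>
  define G where "G y = g (\<chi> j. A * arcsin (y $ j))" for y :: "real ^ 'n"
  have "continuous_on Q (\<lambda>y. \<chi> j. A * arcsin (y $ j))"
    by (intro continuous_on_vec_lambda continuous_intros) (auto simp: Q)
  then have cG: "continuous_on Q G"
    unfolding G_def by (intro continuous_on_compose2[OF g(1)]) auto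
  have "compact Q" by (simp add: Q_def)
  then obtain p where p: "polynomial_function p" "\<And>y. y \<in> Q \<Longrightarrow> cmod (G y - p y) < e"
    using Stone_Weierstrass_polynomial_function[OF _ cG e] by blast
  have sQ: "s x \<in> Q" for x by (simp add: Q s_def)
  have "(\<lambda>x. p (s x)) \<in> Phi UNIV"
  proof (rule Phi_polynomial[OF p(1)])
    fix b :: "real ^ 'n" assume "b \<in> Basis"
    then obtain j where j: "b = axis j 1" by (auto simp: Basis_vec_def)
    have "(s x \<bullet> b) = sin ((axis j (1 / A)) \<bullet> x)" for x
      by (simp add: j s_def inner_axis inner_axis')
    then show "(\<lambda>x. of_real (s x \<bullet> b)) \<in> Phi UNIV" by (simp only: Phi_sin)
  qed
  moreover have "cmod (g x - p (s x)) < e" if x: "norm x \<le> R" for x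
  proof -
    have "A * arcsin (sin (x $ j / A)) = x $ j" for j
    proof -
      have "\<bar>x $ j\<bar> \<le> R" using component_le_norm_cart[of x j] x by linarith
      then have "\<bar>x $ j\<bar> / A \<le> R / A" using A by (intro divide_right_mono) auto
      then have "\<bar>x $ j / A\<bar> \<le> pi / 2" using A R by (simp add: A_def abs_divide abs_mult)
      then have "arcsin (sin (x $ j / A)) = x $ j / A" by (intro arcsin_sin) linarith+
      then show ?thesis using A by simp
    qed
    then have "G (s x) = g x" by (simp add: G_def s_def)
    then show ?thesis using p(2)[OF sQ[of x]] by simp
  qed
  moreover have "cmod (p (s x)) \<le> B + e" for x
  proof -
    have "cmod (p (s x)) \<le> cmod (G (s x)) + cmod (G (s x) - p (s x))"
      using norm_triangle_ineq4[of "G (s x)" "G (s x) - p (s x)"] by simp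
    then show ?thesis using p(2)[OF sQ[of x]] g(2)[of "\<chi> j. A * arcsin (s x $ j)"] by (simp add: G_def)
  qed
  ultimately show ?thesis by (intro bexI[of _ "\<lambda>x. p (s x)"]) auto
qed

text \<open>A cutoff makes the function bounded at small weighted cost. The bounded function is
  approximated on a large ball; outside it the weight dominates the bounds of both functions, so no
  closeness is required there.\<close>

lemma C_psi_trigonometric_approximation:
  fixes f :: "real ^ 'n \<Rightarrow> complex"
  assumes f: "f \<in> C_psi \<psi>" and nonneg: "\<And>x. x \<ge> 0 \<Longrightarrow> \<psi> x \<ge> 0"
    and lim: "filterlim \<psi> at_top at_top" and e: "\<epsilon> > 0"
  shows "psi_approx \<psi> (Phi UNIV) \<epsilon> f"
proof -
  have c: "continuous_on UNIV f"
    and l: "((\<lambda>x. f x / complex_of_real (exp (\<psi> (norm x)))) \<longlongrightarrow> 0) at_infinity"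
    using f by (auto simp: C_psi_def)
  obtain R0 where R0: "\<And>x. norm x \<ge> R0 \<Longrightarrow> cmod (f x / complex_of_real (exp (\<psi> (norm x)))) < \<epsilon> / 4"
    using tendstoD[OF l, of "\<epsilon> / 4"] e by (auto simp: eventually_at_infinity)
  define cut where "cut x = max 0 (min 1 (R0 + 1 - norm x))" for x :: "real ^ 'n"
  define g where "g x = of_real (cut x) * f x" for x
  have cut: "0 \<le> cut x" "cut x \<le> 1" "norm x \<le> R0 \<Longrightarrow> cut x = 1" "norm x \<ge> R0 + 1 \<Longrightarrow> cut x = 0" for x
    by (auto simp: cut_def)
  have cg: "continuous_on UNIV g" unfolding g_def cut_def by (intro continuous_intros c)
  have "compact (f ` cball 0 (R0 + 1))"
    by (intro compact_continuous_image continuous_on_subset[OF c]) auto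
  from compact_imp_bounded[OF this] obtain B where B: "B > 0" "\<And>x. norm x \<le> R0 + 1 \<Longrightarrow> cmod (f x) \<le> B"
    unfolding bounded_pos by auto
  have gB: "cmod (g x) \<le> B" for x
  proof (cases "norm x \<le> R0 + 1")
    case True
    have "cmod (g x) \<le> 1 * cmod (f x)" unfolding g_def norm_mult using cut[of x] by (intro mult_right_mono) auto
    then show ?thesis using B(2)[OF True] by simp
  qed (use B(1) cut(4)[of x] in \<open>auto simp: g_def\<close>)
  have fg: "cmod (f x - g x) \<le> \<epsilon> / 4 * exp (\<psi> (norm x))" for x
  proof (cases "norm x \<le> R0")
    case False
    have "f x - g x = of_real (1 - cut x) * f x" by (simp add: g_def algebra_simps)
    then have "cmod (f x - g x) = \<bar>1 - cut x\<bar> * cmod (f x)" by (simp only: norm_mult norm_of_real)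
    also have "\<dots> \<le> 1 * cmod (f x)" using cut[of x] by (intro mult_right_mono) auto
    also have "\<dots> \<le> \<epsilon> / 4 * exp (\<psi> (norm x))"
      using R0[of x] False by (simp add: norm_divide divide_less_eq)
    finally show ?thesis .
  qed (use cut(3)[of x] e in \<open>auto simp: g_def\<close>)
  obtain R1 where R1: "\<And>x. x \<ge> R1 \<Longrightarrow> \<psi> x \<ge> ln (4 * (2 * B + \<epsilon>) / \<epsilon>)"
    using lim by (auto simp: filterlim_at_top eventually_at_top_linorder)
  obtain T where T: "T \<in> Phi UNIV" "\<And>x. norm x \<le> max 1 R1 \<Longrightarrow> cmod (g x - T x) < \<epsilon> / 4"
      "\<And>x. cmod (T x) \<le> B + \<epsilon> / 4"
    using bounded_trigonometric_approximation[OF cg gB, of "max 1 R1" "\<epsilon> / 4"] e by (meson divide_pos_pos less_max_iff_disj zero_less_numeral zero_less_one)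
  have gT: "cmod (g x - T x) \<le> \<epsilon> / 4 * exp (\<psi> (norm x))" for x
  proof (cases "norm x \<le> max 1 R1")
    case True
    have "\<epsilon> / 4 * 1 \<le> \<epsilon> / 4 * exp (\<psi> (norm x))" using nonneg[of "norm x"] e by (intro mult_left_mono) auto
    then show ?thesis using T(2)[OF True] by simp
  next
    case False
    have pos: "4 * (2 * B + \<epsilon>) / \<epsilon> > 0" using B e by simp
    have "4 * (2 * B + \<epsilon>) / \<epsilon> = exp (ln (4 * (2 * B + \<epsilon>) / \<epsilon>))" using pos by simp
    also have "\<dots> \<le> exp (\<psi> (norm x))" using R1[of "norm x"] False by simp
    finally have "2 * B + \<epsilon> \<le> \<epsilon> / 4 * exp (\<psi> (norm x))" using e by (simp add: field_simps)
    moreover have "cmod (g x - T x) \<le> cmod (g x) + cmod (T x)" by (rule norm_triangle_ineq4)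
    ultimately show ?thesis using gB[of x] T(3)[of x] e by linarith
  qed
  have "cmod (f x - T x) \<le> \<epsilon> * exp (\<psi> (norm x))" for x
  proof -
    have "cmod (f x - T x) \<le> cmod (f x - g x) + cmod (g x - T x)"
      using norm_triangle_ineq[of "f x - g x" "g x - T x"] by simp
    also have "\<dots> \<le> \<epsilon> / 2 * exp (\<psi> (norm x))" using fg[of x] gT[of x] by simp
    also have "\<dots> \<le> \<epsilon> * exp (\<psi> (norm x))" using e by simp
    finally show ?thesis .
  qed
  then show ?thesis using T(1) unfolding psi_approx_def by blast
qed

lemma continuous_on_expo: "continuous_on UNIV (expo l)"
  unfolding expo_def by (intro continuous_intros)

lemma bounded_continuous_in_C_psi:
  fixes f :: "'a::euclidean_space \<Rightarrow> complex"
  assumes lim: "filterlim \<psi> at_top at_top" and f: "continuous_on UNIV f" "\<And>x. cmod (f x) \<le> K"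
  shows "f \<in> C_psi \<psi>"
proof -
  have "((\<lambda>x. f x / complex_of_real (exp (\<psi> (norm x)))) \<longlongrightarrow> 0) at_infinity"
  proof (rule tendsto_0_le[where K = 1])
    have "filterlim (\<lambda>x. exp (\<psi> (norm x))) at_top (at_infinity :: 'a filter)"
      by (intro filterlim_compose[OF exp_at_top] filterlim_compose[OF lim] filterlim_norm_at_top)
    then show "((\<lambda>x. K / exp (\<psi> (norm x))) \<longlongrightarrow> 0) (at_infinity :: 'a filter)"
      by (intro tendsto_divide_0[OF tendsto_const] filterlim_at_top_imp_at_infinity)
    show "\<forall>\<^sub>F x in at_infinity. norm (f x / complex_of_real (exp (\<psi> (norm x)))) \<le> norm (K / exp (\<psi> (norm x))) * 1"
      using f(2) by (auto intro!: always_eventually divide_right_mono order_trans[OF _ abs_ge_self] simp: norm_divide)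
  qed
  then show ?thesis using f by (simp add: C_psi_def)
qed

lemma Phi_subset_C_psi:
  assumes lim: "filterlim \<psi> at_top at_top"
  shows "Phi \<Lambda> \<subseteq> C_psi \<psi>"
proof
  fix v assume "v \<in> Phi \<Lambda>"
  then obtain F c where F: "finite F" "v = (\<lambda>x. \<Sum>l\<in>F. c l * expo l x)"
    by (auto simp: Phi_def)
  have "cmod (v x) \<le> (\<Sum>l\<in>F. cmod (c l))" for x
    unfolding F by (rule sum_norm_le) (simp add: norm_mult)
  moreover have "continuous_on UNIV v" unfolding F by (intro continuous_intros continuous_on_expo)
  ultimately show "v \<in> C_psi \<psi>" by (intro bounded_continuous_in_C_psi[OF lim])
qed

text \<open>Induction on the coordinates in which the frequency is not yet in \<open>L\<close>. A
  one-dimensional approximation in \<open>x $ i\<close> is multiplied by an exponential of modulus 1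
  in the other coordinates; since \<open>norm (x $ i) \<le> norm x\<close>, monotonicity makes the
  one-dimensional weight the smaller one.\<close>

lemma approx_box_prod:
  fixes L :: "'n::finite \<Rightarrow> real set"
  assumes mono: "mono_on {0..} \<psi>"
    and line: "\<And>j l \<epsilon>. \<epsilon> > 0 \<Longrightarrow> psi_approx \<psi> (Phi (L j)) \<epsilon> (expo l)" and e: "\<epsilon> > 0"
  shows "psi_approx \<psi> (Phi (box_prod L)) \<epsilon> (expo l)"
proof -
  have "psi_approx \<psi> (Phi (box_prod L)) \<epsilon> (expo l)"
    if "finite J" "\<epsilon> > 0" "\<forall>j. j \<notin> J \<longrightarrow> l $ j \<in> L j" for J \<epsilon> l
    using that
  proof (induction J arbitrary: l \<epsilon>)
    case empty
    then show ?case by (intro psi_approx_self Phi_expo) (auto simp: box_prod_def)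
  next
    case (insert i J)
    define U where "U = {l :: real ^ 'n. \<forall>j. j \<notin> J \<longrightarrow> l $ j \<in> L j}"
    have U: "psi_approx \<psi> (Phi (box_prod L)) \<epsilon> (expo k)" if "k \<in> U" "\<epsilon> > 0" for k \<epsilon>
      using insert.IH that by (auto simp: U_def)
    have lU: "psi_approx \<psi> (Phi U) \<epsilon> (expo l)" if eps: "\<epsilon> > 0" for \<epsilon>
    proof -
      obtain F c where F: "finite F" "F \<subseteq> L i"
        "\<And>t. cmod (expo (l $ i) t - (\<Sum>k\<in>F. c k * expo k t)) \<le> \<epsilon> * exp (\<psi> (norm t))"
        using line[OF eps, of i "l $ i"] by (auto simp: psi_approx_def Phi_def)
      \<comment> \<open>Replaces coordinate \<open>i\<close> of the frequency; the exponential then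
        splits off a factor depending on \<open>x $ i\<close> alone.\<close>
      define r where "r k = (\<chi> j. if j = i then k else l $ j)" for k
      have r: "expo (r k) x = expo (r 0) x * expo k (x $ i)" for k x
      proof -
        have "r k = r 0 + axis i k" by (auto simp: r_def vec_eq_iff axis_def)
        then show ?thesis by (simp add: expo_add) (simp add: expo_def inner_axis' )
      qed
      have lr: "l = r (l $ i)" by (auto simp: r_def vec_eq_iff)
      have "cmod (expo l x - (\<Sum>k\<in>F. c k * expo (r k) x)) \<le> \<epsilon> * exp (\<psi> (norm x))" for x
      proof -
        have "expo l x = expo (r 0) x * expo (l $ i) (x $ i)" by (subst lr) (rule r)
        moreover have "(\<Sum>k\<in>F. c k * expo (r k) x) = expo (r 0) x * (\<Sum>k\<in>F. c k * expo k (x $ i))"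
          by (subst r) (simp add: sum_distrib_left mult_ac)
        ultimately have "cmod (expo l x - (\<Sum>k\<in>F. c k * expo (r k) x))
            = cmod (expo (r 0) x * (expo (l $ i) (x $ i) - (\<Sum>k\<in>F. c k * expo k (x $ i))))"
          by (simp add: right_diff_distrib)
        also have "\<dots> \<le> \<epsilon> * exp (\<psi> (norm (x $ i)))" using F(3)[of "x $ i"] by (simp add: norm_mult)
        also have "\<dots> \<le> \<epsilon> * exp (\<psi> (norm x))"
          using eps component_le_norm_cart[of x i] by (auto intro!: mult_left_mono mono_onD[OF mono])
        finally show ?thesis .
      qed
      moreover have "(\<lambda>x. \<Sum>k\<in>F. c k * expo (r k) x) \<in> Phi U"
        using F(1,2) insert.prems insert.hyps by (intro Phi_sum Phi_cmult Phi_expo) (auto simp: U_def r_def)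
      ultimately show ?thesis unfolding psi_approx_def by (intro bexI) auto
    qed
    show ?case by (rule psi_approx_trans[OF U lU insert.prems(1)])
  qed
  from this[of UNIV] e show ?thesis by simp
qed

lemma dense_in_C_psi_of_approx:
  fixes \<Lambda> :: "(real ^ 'n) set"
  assumes nonneg: "\<And>x. x \<ge> 0 \<Longrightarrow> \<psi> x \<ge> 0" and lim: "filterlim \<psi> at_top at_top"
    and app: "\<And>l \<epsilon>. \<epsilon> > 0 \<Longrightarrow> psi_approx \<psi> (Phi \<Lambda>) \<epsilon> (expo l)"
  shows "dense_in_C_psi \<psi> (Phi \<Lambda>)"
  unfolding dense_in_C_psi_def
proof (intro conjI ballI allI impI Phi_subset_C_psi[OF lim])
  fix f :: "real ^ 'n \<Rightarrow> complex" and \<epsilon> :: real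
  assume f: "f \<in> C_psi \<psi>" and e: "\<epsilon> > 0"
  \<comment> \<open>Half of \<open>\<epsilon>\<close>, because a supremum preserves only the
    non-strict inequality.\<close>
  have "psi_approx \<psi> (Phi \<Lambda>) (\<epsilon> / 2) f"
    by (rule psi_approx_trans[where \<Lambda>' = UNIV])
      (use app e in \<open>auto intro: C_psi_trigonometric_approximation[OF f nonneg lim]\<close>)
  then obtain g where g: "g \<in> Phi \<Lambda>" "\<And>x. cmod (f x - g x) \<le> \<epsilon> / 2 * exp (\<psi> (norm x))"
    by (auto simp: psi_approx_def)
  have "norm_psi \<psi> (\<lambda>x. f x - g x) \<le> \<epsilon> / 2"
    unfolding norm_psi_def using g(2) by (intro cSUP_least) (auto simp: divide_le_eq)
  then show "\<exists>g\<in>Phi \<Lambda>. norm_psi \<psi> (\<lambda>x. f x - g x) < \<epsilon>" using g(1) e by (intro bexI[of _ g]) auto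
qed

subsection \<open>Variations of complex measures\<close>

text \<open>Suited to suprema over competitors: joining competitors gives superadditivity on two
  sets, cutting them gives countable subadditivity. The former bounds all partial sums, the latter
  the whole.\<close>

lemma countably_additive_of_superadditive:
  fixes V :: "'a set \<Rightarrow> ennreal"
  assumes emp: "V {} = 0"
    and super: "\<And>A B. A \<in> sets M \<Longrightarrow> B \<in> sets M \<Longrightarrow> A \<inter> B = {} \<Longrightarrow> V A + V B \<le> V (A \<union> B)"
    and sub: "\<And>A. range A \<subseteq> sets M \<Longrightarrow> disjoint_family A \<Longrightarrow> V (\<Union>i. A i) \<le> (\<Sum>i. V (A i))"
  shows "countably_additive (sets M) V"
proof (rule countably_additiveI)
  fix A :: "nat \<Rightarrow> 'a set"
  assume A: "range A \<subseteq> sets M" "disjoint_family A"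
  have "(\<Sum>i<n. V (A i)) \<le> V (\<Union>i<n. A i)" for n
  proof (induction n)
    case (Suc n)
    have "(\<Sum>i<Suc n. V (A i)) \<le> V (\<Union>i<n. A i) + V (A n)"
      using Suc by (simp add: add_right_mono)
    also have "\<dots> \<le> V ((\<Union>i<n. A i) \<union> A n)"
    proof (rule super)
      show "(\<Union>i<n. A i) \<inter> A n = {}"
      proof -
        have "A i \<inter> A n = {}" if "i < n" for i
          using disjoint_family_onD[OF A(2), of i n] that by auto
        then show ?thesis by blast
      qed
    qed (use A in auto)
    also have "(\<Union>i<n. A i) \<union> A n = (\<Union>i<Suc n. A i)" by (auto simp: less_Suc_eq)
    finally show ?case .
  qed (simp add: emp)
  moreover have "V (\<Union>i<n. A i) \<le> V (\<Union>i. A i)" for n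
  proof -
    have "V (\<Union>i<n. A i) \<le> V (\<Union>i<n. A i) + V ((\<Union>i. A i) - (\<Union>i<n. A i))" by simp
    also have "\<dots> \<le> V ((\<Union>i<n. A i) \<union> ((\<Union>i. A i) - (\<Union>i<n. A i)))"
      by (rule super) (use A in auto)
    also have "(\<Union>i<n. A i) \<union> ((\<Union>i. A i) - (\<Union>i<n. A i)) = (\<Union>i. A i)" by auto
    finally show ?thesis .
  qed
  ultimately have "(\<Sum>i<n. V (A i)) \<le> V (\<Union>i. A i)" for n
    by (rule order_trans)
  then have "(\<Sum>i. V (A i)) \<le> V (\<Union>i. A i)"
    by (intro suminf_le_const summableI)
  with sub[OF A] show "(\<Sum>i. V (A i)) = V (\<Union>i. A i)" by (intro antisym)
qed

lemma SUP_add_SUP_le: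
  fixes f :: "'a \<Rightarrow> ennreal" and g :: "'b \<Rightarrow> ennreal"
  assumes "A \<noteq> {}" "B \<noteq> {}" "\<And>a b. a \<in> A \<Longrightarrow> b \<in> B \<Longrightarrow> f a + g b \<le> c"
  shows "(SUP a\<in>A. f a) + (SUP b\<in>B. g b) \<le> c"
proof -
  have "(SUP a\<in>A. f a) + g b \<le> c" if "b \<in> B" for b
    using assms that by (subst ennreal_SUP_add_left[symmetric]) (auto intro!: SUP_least)
  then show ?thesis
    using assms by (subst ennreal_SUP_add_right) (auto intro!: SUP_least)
qed

lemma suminf_swap_ennreal:
  fixes f :: "nat \<Rightarrow> nat \<Rightarrow> ennreal"
  shows "(\<Sum>i. \<Sum>j. f i j) = (\<Sum>j. \<Sum>i. f i j)"
  using nn_integral_suminf[of "\<lambda>j i. f i j" "count_space UNIV"]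
  by (simp add: nn_integral_count_space_nat)

lemma ennreal_sums_le:
  fixes f :: "nat \<Rightarrow> real"
  assumes "f sums s"
  shows "ennreal s \<le> (\<Sum>i. ennreal (f i))"
proof (rule LIMSEQ_le_const2)
  show "(\<lambda>n. ennreal (\<Sum>i<n. f i)) \<longlonglongrightarrow> ennreal s"
    using assms unfolding sums_def by (rule tendsto_ennrealI)
  have "ennreal (\<Sum>i<n. f i) \<le> (\<Sum>i<n. ennreal (f i))" for n
  proof (induction n)
    case (Suc n)
    have "ennreal (a + b) \<le> ennreal a + ennreal b" for a b
      by (cases "0 \<le> a"; cases "0 \<le> b") (auto simp: ennreal_leI ennreal_neg ennreal_plus)
    from this[of "\<Sum>i<n. f i" "f n"] Suc show ?case
      by (simp add: order_trans[OF _ add_right_mono])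
  qed simp
  then have "ennreal (\<Sum>i<n. f i) \<le> (\<Sum>i. ennreal (f i))" for n
    using sum_le_suminf[of "\<lambda>i. ennreal (f i)" "{..<n}"] by (meson finite_lessThan order_trans summableI zero_le)
  then show "\<exists>N. \<forall>n\<ge>N. ennreal (\<Sum>i<n. f i) \<le> (\<Sum>i. ennreal (f i))" by blast
qed

lemma ennreal_norm_sums_le:
  fixes f :: "nat \<Rightarrow> 'b::real_normed_vector"
  assumes "f sums s"
  shows "ennreal (norm s) \<le> (\<Sum>i. ennreal (norm (f i)))"
proof (rule LIMSEQ_le_const2)
  show "(\<lambda>n. ennreal (norm (\<Sum>i<n. f i))) \<longlonglongrightarrow> ennreal (norm s)"
    using assms unfolding sums_def by (intro tendsto_ennrealI tendsto_norm)
  have "ennreal (norm (\<Sum>i<n. f i)) \<le> (\<Sum>i. ennreal (norm (f i)))" for n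
  proof -
    have "ennreal (norm (\<Sum>i<n. f i)) \<le> ennreal (\<Sum>i<n. norm (f i))" by (intro ennreal_leI norm_sum)
    also have "\<dots> = (\<Sum>i<n. ennreal (norm (f i)))" by (rule sum_ennreal[symmetric]) simp
    also have "\<dots> \<le> (\<Sum>i. ennreal (norm (f i)))" by (intro sum_le_suminf summableI) auto
    finally show ?thesis .
  qed
  then show "\<exists>N. \<forall>n\<ge>N. ennreal (norm (\<Sum>i<n. f i)) \<le> (\<Sum>i. ennreal (norm (f i)))" by blast
qed

text \<open>The condition of \<open>complex_measure\<close> with any normed target, so that
  \<open>\<mu>\<close> and its real and imaginary parts share the same lemmas.\<close>

definition vector_measure :: "'a measure \<Rightarrow> ('a set \<Rightarrow> 'b::real_normed_vector) \<Rightarrow> bool" where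
  "vector_measure M \<mu> \<longleftrightarrow>
     (\<forall>A :: nat \<Rightarrow> 'a set. range A \<subseteq> sets M \<longrightarrow> disjoint_family A \<longrightarrow>
        (\<lambda>i. \<mu> (A i)) sums \<mu> (\<Union>i. A i))"

lemma vector_measureD:
  "vector_measure M \<mu> \<Longrightarrow> range A \<subseteq> sets M \<Longrightarrow> disjoint_family A \<Longrightarrow> (\<lambda>i. \<mu> (A i)) sums \<mu> (\<Union>i. A i)"
  unfolding vector_measure_def by blast

lemma vector_measure_bounded_linear:
  fixes M :: "'a measure"
  assumes "bounded_linear f" "vector_measure M \<mu>"
  shows "vector_measure M (\<lambda>A. f (\<mu> A))"
  unfolding vector_measure_def
proof (intro allI impI)
  fix A :: "nat \<Rightarrow> 'a set" assume "range A \<subseteq> sets M" "disjoint_family A"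
  then show "(\<lambda>i. f (\<mu> (A i))) sums f (\<mu> (\<Union>i. A i))"
    by (intro bounded_linear.sums[OF assms(1)] vector_measureD[OF assms(2)])
qed

lemma vector_measure_empty:
  assumes "vector_measure M \<mu>"
  shows "\<mu> {} = 0"
proof -
  have "(\<lambda>i::nat. \<mu> {}) sums \<mu> {}"
    using vector_measureD[OF assms, of "\<lambda>_. {}"] by (simp add: disjoint_family_on_def)
  then have "(\<lambda>i::nat. \<mu> {}) \<longlonglongrightarrow> 0" by (intro summable_LIMSEQ_zero sums_summable)
  then show ?thesis by (simp add: LIMSEQ_const_iff)
qed

lemma disjoint_family_binaryset: "A \<inter> B = {} \<Longrightarrow> disjoint_family (binaryset A B)"
  by (auto simp: disjoint_family_on_def binaryset_def)

lemma vector_measure_Un: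
  assumes "vector_measure M \<mu>" "A \<in> sets M" "B \<in> sets M" "A \<inter> B = {}"
  shows "\<mu> (A \<union> B) = \<mu> A + \<mu> B"
proof -
  have "(\<lambda>i. \<mu> (binaryset A B i)) sums \<mu> (\<Union>i. binaryset A B i)"
    using assms by (intro vector_measureD disjoint_family_binaryset) (auto simp: range_binaryset_eq)
  moreover have "(\<lambda>i. \<mu> (binaryset A B i)) sums (\<mu> A + \<mu> B)"
    by (rule binaryset_sums) (rule vector_measure_empty[OF assms(1)])
  ultimately show ?thesis by (simp add: UN_binaryset_eq sums_unique2)
qed

lemma vector_measure_Int_sums:
  assumes "vector_measure M \<mu>" "B \<in> sets M" "range A \<subseteq> sets M" "disjoint_family A" "B \<subseteq> (\<Union>i. A i)"
  shows "(\<lambda>i. \<mu> (B \<inter> A i)) sums \<mu> B"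
proof -
  have "(\<lambda>i. \<mu> (B \<inter> A i)) sums \<mu> (\<Union>i. B \<inter> A i)"
    using assms by (intro vector_measureD) (auto simp: disjoint_family_on_def)
  moreover have "(\<Union>i. B \<inter> A i) = B" using assms(5) by blast
  ultimately show ?thesis by simp
qed

abbreviation partitions :: "'a measure \<Rightarrow> 'a set \<Rightarrow> (nat \<Rightarrow> 'a set) set" where
  "partitions M E \<equiv> {A. range A \<subseteq> sets M \<and> disjoint_family A \<and> (\<Union>i. A i) = E}"

text \<open>\<open>measure_of\<close> returns the given set function only once that is known to be
  countably additive. Partitions of two disjoint sets are interleaved into one of the union; a
  partition of a countable union is cut along the pieces and the double series is swapped.\<close>

lemma emeasure_total_variation:
  assumes \<mu>: "complex_measure M \<mu>" and E: "E \<in> sets M"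
  shows "emeasure (total_variation M \<mu>) E = (SUP A \<in> partitions M E. \<Sum>i. ennreal (cmod (\<mu> (A i))))"
proof -
  let ?V = "\<lambda>E. SUP A \<in> partitions M E. \<Sum>i. ennreal (cmod (\<mu> (A i)))"
  have vm: "vector_measure M \<mu>" using \<mu> by (simp add: complex_measure_def vector_measure_def)
  have emp: "?V {} = 0"
    using vector_measure_empty[OF vm] by (intro antisym SUP_least) auto
  have "countably_additive (sets M) ?V"
  proof (rule countably_additive_of_superadditive[where V = ?V])
    show "?V {} = 0" by (rule emp)
  next
    fix A B assume AB: "A \<in> sets M" "B \<in> sets M" "A \<inter> B = {}"
    show "?V A + ?V B \<le> ?V (A \<union> B)"
    proof (rule SUP_add_SUP_le)
      have "binaryset A {} \<in> partitions M A" "binaryset B {} \<in> partitions M B"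
        using AB by (auto simp: range_binaryset_eq UN_binaryset_eq disjoint_family_binaryset)
      then show "partitions M A \<noteq> {}" "partitions M B \<noteq> {}" by auto
    next
      fix P Q assume P: "P \<in> partitions M A" and Q: "Q \<in> partitions M B"
      define C where "C n = (if even n then P (n div 2) else Q (n div 2))" for n
      have "C \<in> partitions M (A \<union> B)"
      proof -
        have "range C \<subseteq> sets M" using P Q by (auto simp: C_def)
        moreover have "disjoint_family C"
          unfolding disjoint_family_on_def
        proof (intro ballI impI)
          fix m n :: nat assume mn: "m \<noteq> n"
          have PQ: "P i \<inter> Q j = {}" "Q j \<inter> P i = {}" for i j using P Q AB by blast+
          have ne: "m div 2 \<noteq> n div 2" if "even m = even n" using mn that by presburger
          have "P (m div 2) \<inter> P (n div 2) = {}" if "even m" "even n"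
            using P that disjoint_family_onD[of P UNIV, OF _ UNIV_I UNIV_I ne] by auto
          moreover have "Q (m div 2) \<inter> Q (n div 2) = {}" if "odd m" "odd n"
            using Q that disjoint_family_onD[of Q UNIV, OF _ UNIV_I UNIV_I ne] by auto
          ultimately show "C m \<inter> C n = {}" using PQ by (cases "even m"; cases "even n") (simp_all add: C_def)
        qed
        moreover have "(\<Union>i. C i) = A \<union> B"
        proof (intro antisym subsetI)
          fix x assume "x \<in> A \<union> B"
          then obtain i where "x \<in> P i \<or> x \<in> Q i" using P Q by blast
          then have "x \<in> C (2 * i) \<or> x \<in> C (2 * i + 1)" by (auto simp: C_def)
          then show "x \<in> (\<Union>i. C i)" by blast
        qed (use P Q in \<open>auto simp: C_def split: if_splits\<close>)
        ultimately show ?thesis by blast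
      qed
      have fin: "(\<Sum>i<n. ennreal (cmod (\<mu> (P i))) + ennreal (cmod (\<mu> (Q i)))) = (\<Sum>i<2*n. ennreal (cmod (\<mu> (C i))))" for n
        by (induction n) (auto simp: C_def add_ac)
      have "(\<Sum>i. ennreal (cmod (\<mu> (P i)))) + (\<Sum>i. ennreal (cmod (\<mu> (Q i))))
          = (\<Sum>i. ennreal (cmod (\<mu> (P i))) + ennreal (cmod (\<mu> (Q i))))"
        by (intro suminf_add summableI)
      also have "\<dots> \<le> (\<Sum>i. ennreal (cmod (\<mu> (C i))))"
        unfolding fin[symmetric] by (intro suminf_le_const summableI, subst fin) (intro sum_le_suminf summableI, auto)
      also have "\<dots> \<le> ?V (A \<union> B)" by (rule SUP_upper) fact
      finally show "(\<Sum>i. ennreal (cmod (\<mu> (P i)))) + (\<Sum>i. ennreal (cmod (\<mu> (Q i)))) \<le> ?V (A \<union> B)" .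
    qed
  next
    fix A :: "nat \<Rightarrow> 'a set" assume A: "range A \<subseteq> sets M" "disjoint_family A"
    show "?V (\<Union>i. A i) \<le> (\<Sum>i. ?V (A i))"
    proof (rule SUP_least)
      fix B assume B: "B \<in> partitions M (\<Union>i. A i)"
      have "(\<Sum>j. ennreal (cmod (\<mu> (B j)))) \<le> (\<Sum>j. \<Sum>i. ennreal (cmod (\<mu> (B j \<inter> A i))))"
      proof (intro suminf_le summableI ennreal_norm_sums_le vector_measure_Int_sums[OF vm _ A])
        show "B j \<in> sets M" "B j \<subseteq> (\<Union>i. A i)" for j using B by auto
      qed
      also have "\<dots> = (\<Sum>i. \<Sum>j. ennreal (cmod (\<mu> (B j \<inter> A i))))" by (rule suminf_swap_ennreal)
      also have "\<dots> \<le> (\<Sum>i. ?V (A i))"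
      proof (intro suminf_le summableI SUP_upper)
        fix i
        have "A i \<subseteq> (\<Union>j. B j)" using B by auto
        moreover have "disjoint_family (\<lambda>j. B j \<inter> A i)"
          using B unfolding disjoint_family_on_def by blast
        ultimately show "(\<lambda>j. B j \<inter> A i) \<in> partitions M (A i)"
          using A B by auto
      qed
      finally show "(\<Sum>j. ennreal (cmod (\<mu> (B j)))) \<le> (\<Sum>i. ?V (A i))" .
    qed
  qed
  moreover have "positive (sets M) ?V" using emp by (simp add: positive_def)
  ultimately show ?thesis
    using E unfolding total_variation_def
    by (intro emeasure_measure_of_sigma sets.sigma_algebra_axioms)
qed

lemma sets_total_variation [simp]: "sets (total_variation M \<mu>) = sets M"
  and sets_positive_variation [simp]: "sets (positive_variation M \<nu>) = sets M"
  by (simp_all add: total_variation_def positive_variation_def sets.space_closed)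

lemma emeasure_positive_variation:
  assumes \<nu>: "vector_measure M \<nu>" and E: "E \<in> sets M"
  shows "emeasure (positive_variation M \<nu>) E = (SUP B \<in> {B \<in> sets M. B \<subseteq> E}. ennreal (\<nu> B))"
proof -
  let ?V = "\<lambda>E. SUP B \<in> {B \<in> sets M. B \<subseteq> E}. ennreal (\<nu> B)"
  note ne = vector_measure_empty[OF \<nu>]
  have emp: "?V {} = 0" using ne by (intro antisym SUP_least) auto
  have "countably_additive (sets M) ?V"
  proof (rule countably_additive_of_superadditive[where V = ?V])
    show "?V {} = 0" by (rule emp)
  next
    fix A B assume AB: "A \<in> sets M" "B \<in> sets M" "A \<inter> B = {}"
    show "?V A + ?V B \<le> ?V (A \<union> B)"
    proof (rule SUP_add_SUP_le)
      fix P Q assume P: "P \<in> {B \<in> sets M. B \<subseteq> A}" and Q: "Q \<in> {C \<in> sets M. C \<subseteq> B}"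
      \<comment> \<open>\<open>ennreal\<close> is additive only on nonnegative reals, so a
        competitor of negative value is replaced by the empty set, with the same truncated value
        0.\<close>
      define P' Q' where "P' = (if \<nu> P \<ge> 0 then P else {})" and "Q' = (if \<nu> Q \<ge> 0 then Q else {})"
      have P': "P' \<in> sets M" "P' \<subseteq> A" "ennreal (\<nu> P) = ennreal (\<nu> P')" "\<nu> P' \<ge> 0"
        using P ne by (auto simp: P'_def ennreal_neg)
      have Q': "Q' \<in> sets M" "Q' \<subseteq> B" "ennreal (\<nu> Q) = ennreal (\<nu> Q')" "\<nu> Q' \<ge> 0"
        using Q ne by (auto simp: Q'_def ennreal_neg)
      have "ennreal (\<nu> P) + ennreal (\<nu> Q) = ennreal (\<nu> P' + \<nu> Q')"
        using P' Q' by (simp add: ennreal_plus)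
      also have "\<nu> P' + \<nu> Q' = \<nu> (P' \<union> Q')"
        using P' Q' AB by (intro vector_measure_Un[OF \<nu>, symmetric]) auto
      also have "ennreal (\<nu> (P' \<union> Q')) \<le> ?V (A \<union> B)"
        using P' Q' by (intro SUP_upper) auto
      finally show "ennreal (\<nu> P) + ennreal (\<nu> Q) \<le> ?V (A \<union> B)" .
    qed auto
  next
    fix A :: "nat \<Rightarrow> 'a set" assume A: "range A \<subseteq> sets M" "disjoint_family A"
    show "?V (\<Union>i. A i) \<le> (\<Sum>i. ?V (A i))"
    proof (rule SUP_least)
      fix B assume B: "B \<in> {B \<in> sets M. B \<subseteq> (\<Union>i. A i)}"
      have "ennreal (\<nu> B) \<le> (\<Sum>i. ennreal (\<nu> (B \<inter> A i)))"
        using B by (intro ennreal_sums_le vector_measure_Int_sums[OF \<nu> _ A]) auto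
      also have "\<dots> \<le> (\<Sum>i. ?V (A i))"
        using A B by (intro suminf_le summableI SUP_upper) auto
      finally show "ennreal (\<nu> B) \<le> (\<Sum>i. ?V (A i))" .
    qed
  qed
  moreover have "positive (sets M) ?V" using emp by (simp add: positive_def)
  ultimately show ?thesis
    using E unfolding positive_variation_def
    by (intro emeasure_measure_of_sigma sets.sigma_algebra_axioms)
qed

text \<open>A competitor \<open>B\<close> inside \<open>E\<close> is one cell of the partition of
  \<open>E\<close> into \<open>B\<close> and \<open>E - B\<close>.\<close>

lemma positive_variation_le_total_variation:
  assumes \<mu>: "complex_measure M \<mu>" and \<nu>: "vector_measure M \<nu>" "\<And>A. \<nu> A \<le> cmod (\<mu> A)"
  shows "positive_variation M \<nu> \<le> total_variation M \<mu>"
proof -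
  have vm: "vector_measure M \<mu>" using \<mu> by (simp add: complex_measure_def vector_measure_def)
  have "emeasure (positive_variation M \<nu>) E \<le> emeasure (total_variation M \<mu>) E" if E: "E \<in> sets M" for E
    unfolding emeasure_positive_variation[OF \<nu>(1) E] emeasure_total_variation[OF \<mu> E]
  proof (rule SUP_least)
    fix B assume B: "B \<in> {B \<in> sets M. B \<subseteq> E}"
    have s: "(\<lambda>i. ennreal (cmod (\<mu> (binaryset B (E - B) i)))) sums (ennreal (cmod (\<mu> B)) + ennreal (cmod (\<mu> (E - B))))"
      by (rule binaryset_sums[where f = "\<lambda>A. ennreal (cmod (\<mu> A))"]) (simp add: vector_measure_empty[OF vm])
    have "ennreal (\<nu> B) \<le> ennreal (cmod (\<mu> B)) + ennreal (cmod (\<mu> (E - B)))"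
      using \<nu>(2)[of B] by (simp add: ennreal_leI add_increasing2)
    also have "\<dots> = (\<Sum>i. ennreal (cmod (\<mu> (binaryset B (E - B) i))))" using s by (rule sums_unique)
    also have "\<dots> \<le> (SUP A \<in> partitions M E. \<Sum>i. ennreal (cmod (\<mu> (A i))))"
      using B E by (intro SUP_upper) (auto simp: range_binaryset_eq UN_binaryset_eq intro!: disjoint_family_binaryset)
    finally show "ennreal (\<nu> B) \<le> (SUP A \<in> partitions M E. \<Sum>i. ennreal (cmod (\<mu> (A i))))" .
  qed
  then show ?thesis by (subst le_measure) auto
qed

text \<open>For \<open>B\<close> inside \<open>E\<close>,
  \<open>\<nu> B = \<nu> E - \<nu> (E - B)\<close>, and the last term is controlled by the negative
  variation. Applied to \<open>\<nu>\<close> and to \<open>- \<nu>\<close> this is the Jordan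
  decomposition, with no Hahn sets involved.\<close>

lemma positive_variation_le_negative_variation:
  assumes \<nu>: "vector_measure M \<nu>" and E: "E \<in> sets M"
    and fin: "emeasure (positive_variation M (\<lambda>A. - \<nu> A)) E < \<infinity>"
  shows "measure (positive_variation M \<nu>) E \<le> \<nu> E + measure (positive_variation M (\<lambda>A. - \<nu> A)) E"
proof -
  have \<nu>': "vector_measure M (\<lambda>A. - \<nu> A)"
    using \<nu> by (intro vector_measure_bounded_linear[OF bounded_linear_minus[OF bounded_linear_ident]])
  define n where "n = measure (positive_variation M (\<lambda>A. - \<nu> A)) E"
  have n: "emeasure (positive_variation M (\<lambda>A. - \<nu> A)) E = ennreal n"
    using fin by (simp add: n_def emeasure_eq_ennreal_measure)
  have up: "- \<nu> B \<le> n" if "B \<in> sets M" "B \<subseteq> E" for B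
  proof -
    have "ennreal (- \<nu> B) \<le> ennreal n"
      unfolding n[symmetric] emeasure_positive_variation[OF \<nu>' E] using that by (intro SUP_upper) auto
    then show ?thesis by (simp add: n_def)
  qed
  have "emeasure (positive_variation M \<nu>) E \<le> ennreal (\<nu> E + n)"
    unfolding emeasure_positive_variation[OF \<nu> E]
  proof (intro SUP_least ennreal_leI)
    fix B assume B: "B \<in> {B \<in> sets M. B \<subseteq> E}"
    then have "\<nu> (B \<union> (E - B)) = \<nu> B + \<nu> (E - B)"
      using E by (intro vector_measure_Un[OF \<nu>]) auto
    moreover have "B \<union> (E - B) = E" using B by auto
    ultimately show "\<nu> B \<le> \<nu> E + n" using up[of "E - B"] B E by auto
  qed
  then show ?thesis
    using up[OF E] unfolding n_def[symmetric] measure_def[of "positive_variation M \<nu>"]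
    by (intro enn2real_leI) auto
qed

lemma jordan_decomposition:
  assumes \<nu>: "vector_measure M \<nu>" and E: "E \<in> sets M"
    and fin: "emeasure (positive_variation M \<nu>) E < \<infinity>" "emeasure (positive_variation M (\<lambda>A. - \<nu> A)) E < \<infinity>"
  shows "\<nu> E = measure (positive_variation M \<nu>) E - measure (positive_variation M (\<lambda>A. - \<nu> A)) E"
proof -
  have \<nu>': "vector_measure M (\<lambda>A. - \<nu> A)"
    using \<nu> by (intro vector_measure_bounded_linear[OF bounded_linear_minus[OF bounded_linear_ident]])
  show ?thesis
    using positive_variation_le_negative_variation[OF \<nu> E fin(2)]
      positive_variation_le_negative_variation[OF \<nu>' E] fin(1) by simp
qed

text \<open>The indicator of a nonempty closed \<open>F\<close> is the limit of the continuous
  functions \<open>max 0 (1 - n * infdist x F)\<close>, and closed sets form an intersection-stable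
  generator.\<close>

lemma finite_borel_measure_eqI:
  fixes M N :: "'a::metric_space measure"
  assumes sets: "sets M = sets borel" "sets N = sets borel"
    and fin: "finite_measure M" "finite_measure N"
    and eq: "\<And>f :: 'a \<Rightarrow> real. continuous_on UNIV f \<Longrightarrow> (\<And>x. \<bar>f x\<bar> \<le> 1) \<Longrightarrow> integral\<^sup>L M f = integral\<^sup>L N f"
  shows "M = N"
proof -
  interpret M: finite_measure M by fact
  interpret N: finite_measure N by fact
  have closed: "measure M F = measure N F" if F: "closed F" "F \<noteq> {}" for F :: "'a set"
  proof -
    define f where "f n x = max 0 (1 - real n * infdist x F)" for n :: nat and x
    have f01: "0 \<le> f n x" "f n x \<le> 1" for n x by (auto simp: f_def infdist_nonneg)
    have cf: "continuous_on UNIV (f n)" for n unfolding f_def by (intro continuous_intros)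
    have lim: "(\<lambda>n. f n x) \<longlonglongrightarrow> indicator F x" for x
    proof (cases "x \<in> F")
      case True
      then show ?thesis by (simp add: f_def)
    next
      case False
      then have pos: "infdist x F > 0" using F by (metis in_closed_iff_infdist_zero infdist_nonneg less_eq_real_def)
      obtain m :: nat where m: "real m > 1 / infdist x F" using reals_Archimedean2 by blast
      have "f n x = 0" if "n \<ge> m" for n
      proof -
        have "1 \<le> real m * infdist x F" using m pos by (simp add: field_simps)
        also have "\<dots> \<le> real n * infdist x F" using that pos by (intro mult_right_mono) auto
        finally show ?thesis by (simp add: f_def)
      qed
      then have "eventually (\<lambda>n. f n x = indicator F x) sequentially"
        using False by (auto simp: eventually_at_top_linorder intro!: exI[of _ m])
      then show ?thesis by (rule tendsto_eventually)
    qed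
    have conv: "(\<lambda>n. integral\<^sup>L K (f n)) \<longlonglongrightarrow> measure K F"
      if K: "sets K = sets borel" "finite_measure K" for K
    proof -
      interpret K: finite_measure K by fact
      have "(\<lambda>n. integral\<^sup>L K (f n)) \<longlonglongrightarrow> integral\<^sup>L K (indicat_real F)"
      proof (rule integral_dominated_convergence[where w = "\<lambda>_. 1"])
        show "f n \<in> borel_measurable K" for n
          using borel_measurable_continuous_onI[OF cf[of n]] measurable_cong_sets[OF K(1) refl] by blast
        show "indicat_real F \<in> borel_measurable K" using F K by (intro borel_measurable_indicator) auto
      qed (use f01 lim in auto)
      then show ?thesis using F K by (simp add: sets_eq_imp_space_eq[OF K(1)])
    qed
    have "integral\<^sup>L M (f n) = integral\<^sup>L N (f n)" for n
      using f01 by (intro eq cf) (auto simp: abs_le_iff intro: order_trans[of _ 0])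
    then show ?thesis
      using conv[OF sets(1) fin(1)] conv[OF sets(2) fin(2)] by (simp add: LIMSEQ_unique)
  qed
  show ?thesis
  proof (rule measure_eqI_generator_eq[where E = "Collect closed" and \<Omega> = UNIV and A = "\<lambda>_. UNIV"])
    show "Int_stable (Collect closed)" by (auto simp: Int_stable_def)
    show "sets M = sigma_sets UNIV (Collect closed)" "sets N = sigma_sets UNIV (Collect closed)"
      by (simp_all add: sets borel_eq_closed)
    show "emeasure M X = emeasure N X" if "X \<in> Collect closed" for X
      using closed[of X] that by (cases "X = {}") (auto simp: M.emeasure_eq_measure N.emeasure_eq_measure)
  qed (auto simp: M.emeasure_finite)
qed

section \<open>Duality between density and annihilating measures\<close>

lemma continuous_on_weight:
  fixes \<psi> :: "real \<Rightarrow> real"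
  assumes "continuous_on {0..} \<psi>"
  shows "continuous_on UNIV (\<lambda>x::'a::real_normed_vector. exp (\<psi> (norm x)))"
  by (intro continuous_intros continuous_on_compose2[OF assms]) auto

lemma integrable_weight_bound:
  fixes f :: "'a::euclidean_space \<Rightarrow> complex"
  assumes sets: "sets P = sets borel" and w: "integrable P (\<lambda>x. exp (\<psi> (norm x)))"
    and f: "continuous_on UNIV f" "\<And>x. cmod (f x) \<le> K * exp (\<psi> (norm x))"
  shows "integrable P f" "cmod (integral\<^sup>L P f) \<le> K * (\<integral>x. exp (\<psi> (norm x)) \<partial>P)"
proof -
  have m: "f \<in> borel_measurable P"
    using borel_measurable_continuous_onI[OF f(1)] measurable_cong_sets[OF sets refl] by blast
  have i: "integrable P (\<lambda>x. K * exp (\<psi> (norm x)))" using w by simp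
  show "integrable P f"
    by (rule Bochner_Integration.integrable_bound[OF i m])
      (use f(2) in \<open>auto intro: order_trans[OF _ abs_ge_self]\<close>)
  have "cmod (integral\<^sup>L P f) \<le> (\<integral>x. K * exp (\<psi> (norm x)) \<partial>P)"
    using \<open>integrable P f\<close> i f(2) by (intro order_trans[OF integral_norm_bound integral_mono]) auto
  then show "cmod (integral\<^sup>L P f) \<le> K * (\<integral>x. exp (\<psi> (norm x)) \<partial>P)" by simp
qed

text \<open>\<open>I\<close> stands for \<open>complex_measure_integral\<close>, and the four measures for the Jordan
  decompositions of the real and imaginary parts.\<close>

lemma four_measures_integral_zero:
  fixes P1 P2 P3 P4 :: "'a::euclidean_space measure"
  assumes nonneg: "\<And>x. x \<ge> 0 \<Longrightarrow> \<psi> x \<ge> 0"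
    and P: "\<And>P. P \<in> {P1, P2, P3, P4} \<Longrightarrow> sets P = sets borel"
      "\<And>P. P \<in> {P1, P2, P3, P4} \<Longrightarrow> integrable P (\<lambda>x. exp (\<psi> (norm x)))"
    and dense: "dense_in_C_psi \<psi> (Phi \<Lambda>)"
    and I: "\<And>f. I f = (integral\<^sup>L P1 f - integral\<^sup>L P2 f) + \<i> * (integral\<^sup>L P3 f - integral\<^sup>L P4 f)"
    and zero: "\<And>l. l \<in> \<Lambda> \<Longrightarrow> I (expo l) = 0"
    and f: "f \<in> C_psi \<psi>"
  shows "I f = (0::complex)"
proof -
  let ?S = "{P1, P2, P3, P4}"
  have cf: "continuous_on UNIV u" if "u \<in> C_psi \<psi>" for u :: "'a \<Rightarrow> complex" using that by (simp add: C_psi_def)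
  have bd: "cmod (u x) \<le> norm_psi \<psi> u * exp (\<psi> (norm x))" if "u \<in> C_psi \<psi>" for u :: "'a \<Rightarrow> complex" and x
  proof -
    have "cmod (u x) / exp (\<psi> (norm x)) \<le> norm_psi \<psi> u"
      unfolding norm_psi_def by (rule cSUP_upper2[OF C_psi_bdd[OF nonneg that] _ order_refl]) auto
    then show ?thesis by (simp add: divide_le_eq)
  qed
  have int: "integrable P u" if "P \<in> ?S" "u \<in> C_psi \<psi>" for P u
    using integrable_weight_bound(1)[OF P(1)[OF that(1)] P(2)[OF that(1)] cf[OF that(2)] bd[OF that(2)]] .
  have ei: "integrable P (expo l)" if "P \<in> ?S" for P l
    using nonneg by (intro integrable_weight_bound(1)[OF P(1)[OF that] P(2)[OF that] continuous_on_expo, of _ 1]) auto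
  have Phi0: "I g = 0" if g: "g \<in> Phi \<Lambda>" for g
  proof -
    obtain F c where F: "finite F" "F \<subseteq> \<Lambda>" "g = (\<lambda>x. \<Sum>l\<in>F. c l * expo l x)"
      using g by (auto simp: Phi_def)
    have "integral\<^sup>L P g = (\<Sum>l\<in>F. c l * integral\<^sup>L P (expo l))" if "P \<in> ?S" for P
      unfolding F(3) using ei[OF that] by (subst Bochner_Integration.integral_sum) auto
    then have "I g = (\<Sum>l\<in>F. c l * I (expo l))"
      unfolding I by (simp add: sum_subtractf[symmetric] sum.distrib[symmetric] sum_distrib_left algebra_simps)
    then show ?thesis using F zero by (auto intro!: sum.neutral)
  qed
  define W where "W P = (\<integral>x. exp (\<psi> (norm x)) \<partial>P)" for P :: "'a measure"
  define C where "C = W P1 + W P2 + W P3 + W P4"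
  have W: "W P \<ge> 0" for P by (simp add: W_def)
  have "cmod (I f) \<le> \<epsilon> * C" if e: "\<epsilon> > 0" for \<epsilon>
  proof -
    obtain g where g: "g \<in> Phi \<Lambda>" "norm_psi \<psi> (\<lambda>x. f x - g x) < \<epsilon>"
      using dense f e unfolding dense_in_C_psi_def by blast
    have gC: "g \<in> C_psi \<psi>" using dense g(1) by (auto simp: dense_in_C_psi_def)
    let ?d = "\<lambda>x. f x - g x"
    have dC: "?d \<in> C_psi \<psi>" by (rule C_psi_diff[OF f gC])
    have de: "cmod (?d x) \<le> \<epsilon> * exp (\<psi> (norm x))" for x
      using bd[OF dC, of x] g(2) by (meson exp_ge_zero less_imp_le mult_right_mono order_trans)
    have Wd: "cmod (integral\<^sup>L P ?d) \<le> \<epsilon> * W P" if "P \<in> ?S" for P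
      unfolding W_def using integrable_weight_bound(2)[OF P(1)[OF that] P(2)[OF that] cf[OF dC] de] .
    have "I ?d = I f - I g"
      unfolding I using int f gC by (simp add: algebra_simps)
    \<comment> \<open>As \<open>I\<close> vanishes on the span, \<open>I f\<close> is the integral
      of the small difference \<open>f - g\<close> alone.\<close>
    then have "I f = (integral\<^sup>L P1 ?d - integral\<^sup>L P2 ?d) + \<i> * (integral\<^sup>L P3 ?d - integral\<^sup>L P4 ?d)"
      using Phi0[OF g(1)] I[of ?d] by simp
    also have "cmod \<dots> \<le> cmod (integral\<^sup>L P1 ?d) + cmod (integral\<^sup>L P2 ?d)
        + (cmod (integral\<^sup>L P3 ?d) + cmod (integral\<^sup>L P4 ?d))"
      by (intro order_trans[OF norm_triangle_ineq] add_mono order_trans[OF norm_triangle_ineq4])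
        (auto simp: norm_mult intro: norm_triangle_ineq4)
    also have "\<dots> \<le> \<epsilon> * W P1 + \<epsilon> * W P2 + (\<epsilon> * W P3 + \<epsilon> * W P4)"
      by (intro add_mono Wd) auto
    finally show ?thesis by (simp add: C_def algebra_simps)
  qed
  note small = this
  have "cmod (I f) \<le> \<delta>" if "\<delta> > 0" for \<delta>
  proof -
    have C: "C \<ge> 0" using W by (simp add: C_def)
    have "cmod (I f) \<le> \<delta> / (C + 1) * C" using that C by (intro small) auto
    also have "\<dots> \<le> \<delta>" using that C by (simp add: field_simps)
    finally show ?thesis .
  qed
  then have "cmod (I f) \<le> 0" by (rule field_le_epsilon[of _ 0, simplified])
  then show ?thesis by simp
qed

text \<open>The four Jordan parts lie below the total variation, so they inherit the finite weighted
  integral. Bounded continuous functions belong to \<open>C_psi \<psi>\<close> and are therefore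
  annihilated.\<close>

lemma complex_measure_eq_zero:
  fixes \<mu> :: "'a::euclidean_space set \<Rightarrow> complex"
  assumes cont: "continuous_on {0..} \<psi>" and nonneg: "\<And>x. x \<ge> 0 \<Longrightarrow> \<psi> x \<ge> 0"
    and lim: "filterlim \<psi> at_top at_top"
    and \<mu>: "complex_measure borel \<mu>"
    and fin: "(\<integral>\<^sup>+x. ennreal (exp (\<psi> (norm x))) \<partial>total_variation borel \<mu>) < \<infinity>"
    and dense: "dense_in_C_psi \<psi> (Phi \<Lambda>)"
    and zero: "\<And>l. l \<in> \<Lambda> \<Longrightarrow> fourier \<mu> l = 0"
    and A: "A \<in> sets borel"
  shows "\<mu> A = 0"
proof -
  have vm: "vector_measure borel \<mu>" using \<mu> by (simp add: complex_measure_def vector_measure_def)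
  have re: "vector_measure borel (\<lambda>A. Re (\<mu> A))" and im: "vector_measure borel (\<lambda>A. Im (\<mu> A))"
    by (intro vector_measure_bounded_linear[OF _ vm] bounded_linear_Re bounded_linear_Im)+
  have re': "vector_measure borel (\<lambda>A. - Re (\<mu> A))" and im': "vector_measure borel (\<lambda>A. - Im (\<mu> A))"
    by (intro vector_measure_bounded_linear[OF bounded_linear_minus[OF bounded_linear_ident]] re im)+
  define P1 where "P1 = positive_variation borel (\<lambda>A. Re (\<mu> A))"
  define P2 where "P2 = positive_variation borel (\<lambda>A. - Re (\<mu> A))"
  define P3 where "P3 = positive_variation borel (\<lambda>A. Im (\<mu> A))"
  define P4 where "P4 = positive_variation borel (\<lambda>A. - Im (\<mu> A))"
  note P_defs = P1_def P2_def P3_def P4_def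
  have sets: "sets P = sets borel" if "P \<in> {P1, P2, P3, P4}" for P
    using that by (auto simp: P_defs)
  have le: "P \<le> total_variation borel \<mu>" if "P \<in> {P1, P2, P3, P4}" for P
    using that re im re' im' abs_Re_le_cmod abs_Im_le_cmod
    by (auto simp: P_defs abs_le_iff intro!: positive_variation_le_total_variation[OF \<mu>])
  have nn: "(\<integral>\<^sup>+x. ennreal (exp (\<psi> (norm x))) \<partial>P) < \<infinity>" if "P \<in> {P1, P2, P3, P4}" for P
  proof -
    have "(\<integral>\<^sup>+x. ennreal (exp (\<psi> (norm x))) \<partial>P) \<le> (\<integral>\<^sup>+x. ennreal (exp (\<psi> (norm x))) \<partial>total_variation borel \<mu>)"
      using sets[OF that] by (intro nn_integral_mono_measure le[OF that]) auto
    then show ?thesis using fin by (rule le_less_trans)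
  qed
  have int: "integrable P (\<lambda>x. exp (\<psi> (norm x)))" if "P \<in> {P1, P2, P3, P4}" for P
  proof (rule integrableI_nonneg)
    show "(\<lambda>x. exp (\<psi> (norm x))) \<in> borel_measurable P"
      using borel_measurable_continuous_onI[OF continuous_on_weight[OF cont]]
        measurable_cong_sets[OF sets[OF that] refl] by blast
  qed (use nn[OF that] in auto)
  have fm: "finite_measure P" if "P \<in> {P1, P2, P3, P4}" for P
  proof (rule finite_measureI)
    have "(\<integral>\<^sup>+x. 1 \<partial>P) \<le> (\<integral>\<^sup>+x. ennreal (exp (\<psi> (norm x))) \<partial>P)"
      using nonneg by (intro nn_integral_mono) (simp flip: ennreal_1 add: ennreal_leI)
    then show "emeasure P (space P) \<noteq> \<infinity>" using nn[OF that] by auto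
  qed
  have I0: "complex_measure_integral borel \<mu> f = 0" if "f \<in> C_psi \<psi>" for f
    by (rule four_measures_integral_zero[OF nonneg sets int dense _ _ that])
      (use zero in \<open>auto simp: complex_measure_integral_def P_defs fourier_def\<close>)
  \<comment> \<open>A real test function keeps the real and the imaginary parts of the measure
    apart, so each Jordan pair can be compared separately.\<close>
  have eq: "integral\<^sup>L P1 f = integral\<^sup>L P2 f \<and> integral\<^sup>L P3 f = integral\<^sup>L P4 f"
    if f: "continuous_on UNIV f" "\<And>x. \<bar>f x\<bar> \<le> 1" for f :: "'a \<Rightarrow> real"
  proof -
    have "(\<lambda>x. complex_of_real (f x)) \<in> C_psi \<psi>"
      using f by (intro bounded_continuous_in_C_psi[OF lim, of _ 1] continuous_intros) auto
    from I0[OF this] have "(of_real (integral\<^sup>L P1 f) - of_real (integral\<^sup>L P2 f))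
        + \<i> * (of_real (integral\<^sup>L P3 f) - of_real (integral\<^sup>L P4 f)) = 0"
      by (simp add: complex_measure_integral_def P_defs)
    then show ?thesis by (simp add: complex_eq_iff)
  qed
  have "P1 = P2" "P3 = P4"
    using eq by (auto intro!: finite_borel_measure_eqI sets fm)
  moreover have "emeasure P A < \<infinity>" if "P \<in> {P1, P2, P3, P4}" for P
    using finite_measure.emeasure_finite[OF fm[OF that]] by (simp add: less_top)
  ultimately show ?thesis
    using jordan_decomposition[OF re A] jordan_decomposition[OF im A]
    by (simp add: P_defs complex_eq_iff)
qed

subsection \<open>Convergent logarithmic integral\<close>

text \<open>Equal to \<open>- \<i> * z / (1 - \<i> * z)\<close>, with pole at \<open>- \<i>\<close>.
  Its real part on the real line is \<open>x\<^sup>2 / (1 + x\<^sup>2)\<close>, a smoothed indicator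
  of \<open>\<bar>x\<bar> \<ge> 1\<close>; its zero at 0 makes sums over dyadic dilations
  converge.\<close>

definition half_plane_map :: "complex \<Rightarrow> complex" where
  "half_plane_map z = 1 - 1 / (1 - \<i> * z)"

lemma Re_half_plane_map_nonneg:
  assumes "Im z \<ge> 0"
  shows "Re (half_plane_map z) \<ge> 0"
proof -
  let ?w = "1 - \<i> * z"
  have "1 \<le> Re ?w" using assms by simp
  also have "\<dots> \<le> cmod ?w" by (rule complex_Re_le_cmod)
  finally have w: "1 \<le> cmod ?w" .
  have "Re (1 / ?w) \<le> cmod (1 / ?w)" by (rule complex_Re_le_cmod)
  also have "\<dots> \<le> 1" using w by (simp add: norm_divide divide_le_eq)
  finally show ?thesis by (simp add: half_plane_map_def)
qed

lemma Re_half_plane_map_real: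
  assumes "\<bar>x\<bar> \<ge> 1"
  shows "Re (half_plane_map (of_real x)) \<ge> 1 / 2"
proof -
  have "Re (1 / (1 - \<i> * of_real x)) = 1 / (1 + x\<^sup>2)" by (simp add: Re_divide)
  also have "\<dots> \<le> 1 / 2"
    using power_mono[OF assms, of 2] by (intro divide_left_mono) auto
  finally show ?thesis by (simp add: half_plane_map_def)
qed

lemma norm_half_plane_map_le:
  assumes "Im z \<ge> - 1 / 2"
  shows "cmod (half_plane_map z) \<le> 2 * cmod z"
proof -
  let ?w = "1 - \<i> * z"
  have "1 / 2 \<le> Re ?w" using assms by simp
  also have "\<dots> \<le> cmod ?w" by (rule complex_Re_le_cmod)
  finally have w: "1 / 2 \<le> cmod ?w" .
  then have nz: "?w \<noteq> 0" by auto
  have "half_plane_map z = - \<i> * z / ?w" using nz by (simp add: half_plane_map_def field_simps)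
  then have "cmod (half_plane_map z) = cmod z / cmod ?w" by (simp add: norm_mult norm_divide)
  also have "\<dots> \<le> cmod z / (1 / 2)" using w by (intro divide_left_mono mult_pos_pos) auto
  finally show ?thesis by simp
qed

lemma half_plane_map_holomorphic: "half_plane_map holomorphic_on {z. Im z > - 1 / 2}"
proof -
  have "1 - \<i> * z \<noteq> 0" if "Im z > - 1 / 2" for z
  proof
    assume "1 - \<i> * z = 0"
    then have "Re (1 - \<i> * z) = 0" by simp
    then show False using that by simp
  qed
  then show ?thesis unfolding half_plane_map_def by (intro holomorphic_intros) auto
qed

text \<open>Cauchy's theorem on a half disc: the arc of radius \<open>R\<close> contributes at most
  \<open>pi / R\<close>. The domain extends below the real line so that the diameter lies in its
  interior. The bound excludes \<open>z = 0\<close>, where division by zero would force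
  \<open>F 0 = 0\<close>.\<close>

lemma integral_eq_0_by_upper_half_plane:
  fixes F :: "complex \<Rightarrow> complex"
  assumes hol: "F holomorphic_on {z. Im z > - 1 / 2}"
    and bound: "\<And>z. Im z \<ge> 0 \<Longrightarrow> z \<noteq> 0 \<Longrightarrow> cmod (F z) \<le> 1 / (cmod z)\<^sup>2"
    and int: "integrable lborel (\<lambda>x::real. F (of_real x))"
  shows "(\<integral>x. F (of_real x) \<partial>lborel) = 0"
proof -
  let ?S = "{z. Im z > - 1 / 2}"
  have cont: "continuous_on ?S F" by (rule holomorphic_on_imp_continuous_on[OF hol])
  have seg: "cmod (\<integral>x. indicator {- R..R} x *\<^sub>R F (of_real x) \<partial>lborel) \<le> pi / R" if R: "R > 0" for R :: real
  proof -
    let ?l = "linepath (of_real (- R)) (of_real R)" and ?c = "part_circlepath 0 R 0 pi"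
    have lS: "path_image ?l \<subseteq> ?S"
      using closed_segment_subset[OF _ _ convex_halfspace_Im_gt[of "-1/2"], of "of_real (- R)" "of_real R"] by simp
    have Im_c: "Im z \<ge> 0 \<and> cmod z = R" if z: "z \<in> path_image ?c" for z
    proof -
      obtain x where x: "x \<in> closed_segment 0 pi" "z = of_real R * cis x"
        using z by (auto simp: path_image_part_circlepath')
      have "sin x \<ge> 0" using x(1) by (intro sin_ge_zero) (auto simp: closed_segment_eq_real_ivl)
      then show ?thesis using x(2) R by (simp add: norm_mult)
    qed
    have cS: "path_image ?c \<subseteq> ?S" using Im_c by fastforce
    have il: "F contour_integrable_on ?l"
      by (intro contour_integrable_continuous_linepath continuous_on_subset[OF cont]) (use lS in simp)
    have ic: "F contour_integrable_on ?c"
      by (intro contour_integrable_continuous_part_circlepath continuous_on_subset[OF cont] cS)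
    have "(F has_contour_integral 0) (?l +++ ?c)"
      using lS cS R
      by (intro Cauchy_theorem_convex_simple[OF hol convex_halfspace_Im_gt] valid_path_join)
        (auto simp: path_image_join exp_Euler)
    then have "contour_integral (?l +++ ?c) F = 0" by (rule contour_integral_unique)
    then have "contour_integral ?l F = - contour_integral ?c F"
      using il ic R by (simp add: contour_integral_join eq_neg_iff_add_eq_0)
    also have "cmod \<dots> \<le> 1 / R\<^sup>2 * R * \<bar>pi - 0\<bar>"
      unfolding norm_minus_cancel
    proof (intro contour_integral_bound_part_circlepath ic)
      show "cmod (F z) \<le> 1 / R\<^sup>2" if "z \<in> path_image ?c" for z
        using bound[of z] Im_c[OF that] R by auto
    qed (use R in auto)
    also have "\<dots> = pi / R" using R by (simp add: power2_eq_square)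
    finally have *: "cmod (contour_integral ?l F) \<le> pi / R" .
    have "continuous_on {- R..R} (\<lambda>x. F (of_real x))"
      by (intro continuous_on_compose2[OF cont] continuous_intros) auto
    then have si: "set_integrable lborel {- R..R} (\<lambda>x. F (of_real x))"
      unfolding set_integrable_def by (intro borel_integrable_compact) auto
    have "contour_integral ?l F = integral {- R..R} (\<lambda>x. F (of_real x))"
      using R by (subst contour_integral_linepath_Reals_eq) auto
    also have "\<dots> = (\<integral>x. indicator {- R..R} x *\<^sub>R F (of_real x) \<partial>lborel)"
      using set_borel_integral_eq_integral(2)[OF si] by (simp add: set_lebesgue_integral_def)
    finally show ?thesis using * by simp
  qed
  have "(\<lambda>n. \<integral>x. indicator {- real (Suc n)..real (Suc n)} x *\<^sub>R F (of_real x) \<partial>lborel)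
      \<longlonglongrightarrow> (\<integral>x. F (of_real x) \<partial>lborel)"
  proof (rule integral_dominated_convergence[where w = "\<lambda>x. norm (F (of_real x))"])
    show "(\<lambda>x. F (of_real x)) \<in> borel_measurable lborel" using int by auto
    then show "(\<lambda>x. indicator {- real (Suc n)..real (Suc n)} x *\<^sub>R F (of_real x)) \<in> borel_measurable lborel" for n
      by (intro borel_measurable_scaleR borel_measurable_indicator) auto
    show "AE x in lborel. (\<lambda>n. indicator {- real (Suc n)..real (Suc n)} x *\<^sub>R F (of_real x)) \<longlonglongrightarrow> F (of_real x)"
    proof (rule AE_I2, rule tendsto_eventually)
      fix x :: real
      obtain m :: nat where "\<bar>x\<bar> \<le> real m" using real_arch_simple by blast
      then show "eventually (\<lambda>n. indicator {- real (Suc n)..real (Suc n)} x *\<^sub>R F (of_real x) = F (of_real x)) sequentially"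
        by (auto simp: eventually_at_top_linorder indicator_def intro!: exI[of _ m])
    qed
  qed (use int in \<open>auto simp: indicator_def intro!: always_eventually\<close>)
  moreover have "(\<lambda>n. \<integral>x. indicator {- real (Suc n)..real (Suc n)} x *\<^sub>R F (of_real x) \<partial>lborel) \<longlonglongrightarrow> 0"
  proof (rule Lim_null_comparison)
    show "\<forall>\<^sub>F n in sequentially. norm (\<integral>x. indicator {- real (Suc n)..real (Suc n)} x *\<^sub>R F (of_real x) \<partial>lborel) \<le> pi / real (Suc n)"
      by (intro always_eventually allI seg) simp
    show "(\<lambda>n. pi / real (Suc n)) \<longlonglongrightarrow> 0"
      by (intro tendsto_divide_0[OF tendsto_const] filterlim_at_top_imp_at_infinity
          filterlim_compose[OF filterlim_real_sequentially filterlim_Suc])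
  qed
  ultimately show ?thesis by (rule LIMSEQ_unique)
qed

lemma integrable_inverse_one_plus_square: "integrable lborel (\<lambda>x::real. 1 / (1 + x\<^sup>2))"
  using integrable_inverse_1_plus_square by (simp add: set_integrable_def inverse_eq_divide)

section \<open>Dyadic summability and the analytic function\<close>

context increasing_weight
begin

text \<open>On \<open>J k\<close>, of length \<open>2 ^ Suc k\<close>, the weight is at least its
  value at the left end, and \<open>1 + x\<^sup>2\<close> is at most
  \<open>2 * (4 * 2 ^ k)\<^sup>2 = 32 * 4 ^ k\<close>. Hence the factor 16.\<close>

lemma summable_dyadic_values:
  assumes conv: "(\<integral>\<^sup>+x\<in>{0..}. ennreal (\<psi> x / (1 + x\<^sup>2)) \<partial>lborel) < \<infinity>"
  shows "summable (\<lambda>k. \<psi> (2 ^ Suc k) / 2 ^ k)"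
proof -
  define J where "J k = {(2::real) ^ Suc k..<2 ^ Suc (Suc k)}" for k
  have J: "J k \<in> sets borel" "J k \<subseteq> {0..}" for k
    by (auto simp: J_def intro: order_trans[of 0 "2 ^ Suc k"])
  have "J i \<inter> J j = {}" if "i < j" for i j
  proof -
    have "(2::real) ^ Suc (Suc i) \<le> 2 ^ Suc j" using that by (intro power_increasing) auto
    then show ?thesis by (auto simp: J_def)
  qed
  then have disj: "disjoint_family J"
    unfolding disjoint_family_on_def by (metis Int_commute linorder_neqE_nat)
  have lower: "ennreal (\<psi> (2 ^ Suc k) / 2 ^ k / 16) \<le> emeasure log_measure (J k)" for k
  proof -
    define c where "c = \<psi> (2 ^ Suc k) / (32 * 4 ^ k)"
    have c: "c \<ge> 0" using nonneg by (simp add: c_def)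
    have "\<psi> (2 ^ Suc k) / 2 ^ k / 16 = c * 2 ^ Suc k"
    proof -
      have "(4::real) ^ k = 2 ^ k * 2 ^ k" by (simp flip: power_mult_distrib)
      then show ?thesis by (simp add: c_def)
    qed
    also have "ennreal (c * 2 ^ Suc k) = (\<integral>\<^sup>+x. ennreal c * indicator (J k) x \<partial>lborel)"
      using c by (simp add: nn_integral_cmult_indicator J_def ennreal_mult)
    also have "\<dots> \<le> (\<integral>\<^sup>+x\<in>J k. ennreal (\<psi> x / (1 + x\<^sup>2)) \<partial>lborel)"
    proof (rule nn_integral_mono)
      fix x
      have "c \<le> \<psi> x / (1 + x\<^sup>2)" if x: "x \<in> J k"
        unfolding c_def
      proof (rule frac_le)
        have "(2::real) ^ Suc k \<le> x" "x \<le> 2 ^ Suc (Suc k)" using x by (auto simp: J_def)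
        moreover have "(1::real) \<le> 2 ^ Suc k" by (rule one_le_power) simp
        ultimately have x': "1 \<le> x" "x \<le> 4 * 2 ^ k" "(2::real) ^ Suc k \<le> x" by auto
        show "\<psi> (2 ^ Suc k) \<le> \<psi> x" using x' by (intro mono') auto
        show "0 \<le> \<psi> x" using x' nonneg by simp
        show "0 < 1 + x\<^sup>2" by (simp add: add_pos_nonneg)
        have "1 \<le> x\<^sup>2" using x' by (simp add: one_le_power)
        moreover have "x\<^sup>2 \<le> (4 * 2 ^ k)\<^sup>2" using x' by (intro power_mono) auto
        moreover have "(4 * 2 ^ k)\<^sup>2 = 16 * (4::real) ^ k"
          by (simp add: power_mult_distrib power2_eq_square flip: power_mult_distrib)
        ultimately show "1 + x\<^sup>2 \<le> 32 * 4 ^ k" by linarith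
      qed
      then show "ennreal c * indicator (J k) x \<le> ennreal (\<psi> x / (1 + x\<^sup>2)) * indicator (J k) x"
        by (auto simp: indicator_def ennreal_leI)
    qed
    also have "\<dots> = emeasure log_measure (J k)" using J by (simp add: emeasure_log_measure)
    finally show ?thesis .
  qed
  have "(\<Sum>k. ennreal (\<psi> (2 ^ Suc k) / 2 ^ k / 16)) \<le> (\<Sum>k. emeasure log_measure (J k))"
    by (intro suminf_le lower summableI)
  also have "\<dots> = emeasure log_measure (\<Union>k. J k)"
    using J disj by (intro suminf_emeasure) auto
  also have "\<dots> \<le> emeasure log_measure {0..}"
    using J by (intro emeasure_mono) auto
  also have "\<dots> < \<infinity>" using conv by (simp add: emeasure_log_measure)
  finally have "summable (\<lambda>k. \<psi> (2 ^ Suc k) / 2 ^ k / 16)"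
    using nonneg by (intro summable_suminf_not_top) auto
  from summable_mult[OF this, of 16] show ?thesis by simp
qed

text \<open>The function is outer in the upper half plane, with boundary values of size
  \<open>exp (- \<psi> |x|) / (1 + x\<^sup>2)\<close>; a dyadic sum of rational functions replaces the Poisson integral.\<close>

lemma exists_one_sided_spectrum:
  assumes conv: "(\<integral>\<^sup>+x\<in>{0..}. ennreal (\<psi> x / (1 + x\<^sup>2)) \<partial>lborel) < \<infinity>"
  obtains u :: "real \<Rightarrow> complex" and K where
    "continuous_on UNIV u" "u 0 = - 1"
    "\<And>x. cmod (u x) * exp (\<psi> \<bar>x\<bar>) \<le> K / (1 + x\<^sup>2)"
    "\<And>l. l \<le> 0 \<Longrightarrow> (\<integral>x. u x * exp (- \<i> * of_real (l * x)) \<partial>lborel) = 0"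
proof -
  let ?S = "{z. Im z > - 1 / 2}"
  \<comment> \<open>The factor 2 compensates the lower bound 1/2 for the real part of
    \<open>half_plane_map\<close>: the \<open>k\<close>-th summand alone dominates the weight for
    \<open>2 ^ k \<le> \<bar>x\<bar> < 2 ^ Suc k\<close>.\<close>
  define c where "c k = 2 * \<psi> (2 ^ Suc k)" for k
  have c0: "c k \<ge> 0" for k using nonneg by (simp add: c_def)
  define q where "q k z = of_real (c k) * half_plane_map (z / 2 ^ k)" for k z
  define H where "H z = (\<Sum>k. q k z)" for z
  have scale: "Im (z / 2 ^ k) = Im z / 2 ^ k" for z :: complex and k
    by (metis Im_divide_of_real of_real_numeral of_real_power)
  have scale_half: "Im (z / 2 ^ k) > - 1 / 2" if "z \<in> ?S" for z k
  proof -
    have "1 \<le> (2::real) ^ k" by simp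
    then have "Im z / 2 ^ k > (- 1 / 2) / 2 ^ k" using that by (intro divide_strict_right_mono) auto
    moreover have "(- 1 / 2) / 2 ^ k \<ge> (- 1 / 2 :: real)" by (simp add: field_simps)
    ultimately show ?thesis unfolding scale by linarith
  qed
  have q_bound: "cmod (q k z) \<le> 4 * r * (\<psi> (2 ^ Suc k) / 2 ^ k)" if "z \<in> ?S" "cmod z \<le> r" for k z r
  proof -
    have "cmod (half_plane_map (z / 2 ^ k)) \<le> 2 * cmod (z / 2 ^ k)"
      using scale_half[OF that(1), of k] by (intro norm_half_plane_map_le) auto
    also have "\<dots> \<le> 2 * (r / 2 ^ k)" using that(2) by (simp add: norm_divide norm_power divide_right_mono)
    finally have "c k * cmod (half_plane_map (z / 2 ^ k)) \<le> c k * (2 * (r / 2 ^ k))"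
      using c0[of k] by (rule mult_left_mono)
    moreover have "cmod (q k z) = c k * cmod (half_plane_map (z / 2 ^ k))"
      using c0[of k] by (simp add: q_def norm_mult)
    ultimately have "cmod (q k z) \<le> c k * (2 * (r / 2 ^ k))" by simp
    then show ?thesis by (simp add: c_def mult_ac)
  qed
  have summ: "summable (\<lambda>k. 4 * r * (\<psi> (2 ^ Suc k) / 2 ^ k))" for r
    by (intro summable_mult summable_dyadic_values conv)
  have sq: "summable (\<lambda>k. q k z)" if "z \<in> ?S" for z
    by (rule summable_comparison_test'[OF summ[of "cmod z"]]) (use q_bound[OF that order_refl] in auto)
  have oS: "open ?S" by (rule open_halfspace_Im_gt)
  have H: "H holomorphic_on ?S"
  proof (rule holomorphic_uniform_sequence[OF oS])
    show "(\<lambda>z. \<Sum>k<n. q k z) holomorphic_on ?S" for n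
      unfolding q_def using scale_half
      by (intro holomorphic_intros holomorphic_on_compose_gen[OF _ half_plane_map_holomorphic, unfolded o_def]) auto
    fix z assume z: "z \<in> ?S"
    obtain d where d: "d > 0" "cball z d \<subseteq> ?S" using oS z open_contains_cball by blast
    have "uniform_limit (cball z d) (\<lambda>n z. \<Sum>k<n. q k z) (\<lambda>z. \<Sum>k. q k z) sequentially"
    proof (rule Weierstrass_m_test[OF _ summ[of "cmod z + d"]])
      fix k w assume w: "w \<in> cball z d"
      have "cmod w \<le> cmod z + cmod (w - z)" using norm_triangle_ineq[of z "w - z"] by simp
      then have "cmod w \<le> cmod z + d" using w by (simp add: dist_norm norm_minus_commute)
      then show "cmod (q k w) \<le> 4 * (cmod z + d) * (\<psi> (2 ^ Suc k) / 2 ^ k)"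
        using w d(2) by (intro q_bound) auto
    qed
    then show "\<exists>d>0. cball z d \<subseteq> ?S \<and> uniform_limit (cball z d) (\<lambda>n z. \<Sum>k<n. q k z) H sequentially"
      using d unfolding H_def by blast
  qed
  have Re_q: "Re (q k z) \<ge> 0" if "Im z \<ge> 0" for k z
    using c0[of k] that Re_half_plane_map_nonneg[of "z / 2 ^ k"] by (simp add: q_def scale)
  have Re_H: "Re (H z) = (\<Sum>k. Re (q k z))" "summable (\<lambda>k. Re (q k z))" if "Im z \<ge> 0" for z
    using sq[of z] that by (simp_all add: H_def Re_suminf summable_Re)
  have Re_H0: "Re (H z) \<ge> 0" if "Im z \<ge> 0" for z
    using Re_H[OF that] Re_q[OF that] by (simp add: suminf_nonneg)
  have Re_H_real: "\<psi> \<bar>x\<bar> \<le> \<psi> 1 + Re (H (of_real x))" for x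
  proof (cases "\<bar>x\<bar> \<le> 1")
    case True
    then show ?thesis using mono'[of "\<bar>x\<bar>" 1] Re_H0[of "of_real x"] by simp
  next
    case False
    obtain n where n: "\<bar>x\<bar> < 2 ^ n" using real_arch_pow[of 2 "\<bar>x\<bar>"] by auto
    define i where "i = (LEAST n. \<bar>x\<bar> < 2 ^ n)"
    have i: "\<bar>x\<bar> < 2 ^ i" unfolding i_def by (rule LeastI) (rule n)
    have "i \<noteq> 0" using i False by (intro notI) simp
    then obtain k where k: "i = Suc k" by (cases i) auto
    have "\<not> \<bar>x\<bar> < 2 ^ k" using not_less_Least[of k "\<lambda>n. \<bar>x\<bar> < 2 ^ n"] k by (simp add: i_def)
    then have "\<bar>x / 2 ^ k\<bar> \<ge> 1" by (simp add: abs_divide)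
    from Re_half_plane_map_real[OF this] have "1 / 2 \<le> Re (half_plane_map (of_real x / 2 ^ k))" by simp
    from mult_left_mono[OF this c0[of k]] have "c k * (1 / 2) \<le> Re (q k (of_real x))"
      by (simp add: q_def)
    moreover have "\<psi> \<bar>x\<bar> \<le> c k * (1 / 2)" using i k by (auto simp: c_def intro!: mono')
    moreover have "Re (q k (of_real x)) \<le> Re (H (of_real x))"
      using Re_H[of "of_real x"] Re_q[of "of_real x"] sum_le_suminf[of "\<lambda>k. Re (q k (of_real x))" "{k}"] by simp
    ultimately show ?thesis using nonneg[of 1] by linarith
  qed
  \<comment> \<open>The denominator supplies the decay needed on large arcs and the factor
    \<open>1 / (1 + x\<^sup>2)\<close> on the line; its zero \<open>- \<i>\<close> is outside the
    domain.\<close>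
  define h where "h z = exp (- H z) / (z + \<i>)\<^sup>2" for z
  have zi: "z + \<i> \<noteq> 0" if "z \<in> ?S" for z
  proof
    assume "z + \<i> = 0"
    then have "Im (z + \<i>) = 0" by simp
    then show False using that by simp
  qed
  have h: "h holomorphic_on ?S"
    unfolding h_def using zi by (intro holomorphic_intros H) auto
  have h_bound: "cmod (h z) \<le> 1 / (cmod z)\<^sup>2" if "Im z \<ge> 0" "z \<noteq> 0" for z
  proof -
    have "cmod z \<le> cmod (z + \<i>)" using that by (auto simp: cmod_def intro!: real_sqrt_le_mono power_mono)
    then have "(cmod z)\<^sup>2 \<le> (cmod (z + \<i>))\<^sup>2" by (intro power_mono) auto
    moreover have "cmod (exp (- H z)) \<le> 1" using Re_H0[OF that(1)] by simp
    ultimately show ?thesis unfolding h_def norm_divide norm_power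
      using that by (intro frac_le) auto
  qed
  define u where "u x = h (of_real x)" for x :: real
  have bound: "cmod (u x) * exp (\<psi> \<bar>x\<bar>) \<le> exp (\<psi> 1) / (1 + x\<^sup>2)" for x
  proof -
    have "(cmod (of_real x + \<i>))\<^sup>2 = 1 + x\<^sup>2" by (simp add: cmod_power2)
    then have "cmod (u x) = exp (- Re (H (of_real x))) / (1 + x\<^sup>2)"
      by (simp only: u_def h_def norm_divide norm_power norm_exp_eq_Re uminus_complex.sel)
    then have "cmod (u x) * exp (\<psi> \<bar>x\<bar>) = exp (\<psi> \<bar>x\<bar> - Re (H (of_real x))) / (1 + x\<^sup>2)"
      by (simp add: mult_exp_exp)
    also have "\<dots> \<le> exp (\<psi> 1) / (1 + x\<^sup>2)"
      using Re_H_real[of x] by (intro divide_right_mono) auto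
    finally show ?thesis .
  qed
  have cu: "continuous_on UNIV u"
    unfolding u_def by (intro continuous_on_compose2[OF holomorphic_on_imp_continuous_on[OF h]] continuous_intros) auto
  show ?thesis
  proof
    show "continuous_on UNIV u" by (rule cu)
    have "H 0 = 0" by (simp add: H_def q_def half_plane_map_def)
    then show "u 0 = - 1" by (simp add: u_def h_def)
    show "cmod (u x) * exp (\<psi> \<bar>x\<bar>) \<le> exp (\<psi> 1) / (1 + x\<^sup>2)" for x by (rule bound)
    fix l :: real assume l: "l \<le> 0"
    \<comment> \<open>The added factor has modulus \<open>exp (l * Im z)\<close>, at most 1 in the
      upper half plane exactly because \<open>l \<le> 0\<close>.\<close>
    define F where "F z = h z * exp (- \<i> * of_real l * z)" for z
    have "(\<integral>x. F (of_real x) \<partial>lborel) = 0"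
    proof (rule integral_eq_0_by_upper_half_plane)
      show "F holomorphic_on ?S" unfolding F_def by (intro holomorphic_intros h)
      show "cmod (F z) \<le> 1 / (cmod z)\<^sup>2" if "Im z \<ge> 0" "z \<noteq> 0" for z
      proof -
        have "cmod (F z) = cmod (h z) * exp (l * Im z)" by (simp add: F_def norm_mult)
        also have "\<dots> \<le> cmod (h z) * 1"
          using l that by (intro mult_left_mono) (auto simp: mult_nonpos_nonneg)
        finally show ?thesis using h_bound[OF that] by simp
      qed
      have cF: "continuous_on UNIV (\<lambda>x::real. F (of_real x))"
        unfolding F_def using cu unfolding u_def by (intro continuous_intros)
      show "integrable lborel (\<lambda>x::real. F (of_real x))"
      proof (rule Bochner_Integration.integrable_bound)
        show "integrable lborel (\<lambda>x. exp (\<psi> 1) * (1 / (1 + x\<^sup>2)))"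
          by (intro integrable_mult_right integrable_inverse_one_plus_square)
        show "(\<lambda>x. F (of_real x)) \<in> borel_measurable lborel"
          using borel_measurable_continuous_onI[OF cF] by simp
        have "cmod (F (of_real x)) \<le> exp (\<psi> 1) / (1 + x\<^sup>2)" for x :: real
        proof -
          have "cmod (F (of_real x)) = cmod (u x) * 1" by (simp add: F_def u_def norm_mult)
          also have "\<dots> \<le> cmod (u x) * exp (\<psi> \<bar>x\<bar>)" using nonneg[of "\<bar>x\<bar>"] by (intro mult_left_mono) auto
          finally show ?thesis using bound[of x] by linarith
        qed
        then show "AE x in lborel. norm (F (of_real x)) \<le> norm (exp (\<psi> 1) * (1 / (1 + x\<^sup>2)))"
          by (intro always_eventually allI) (simp add: abs_mult add_nonneg_pos)
      qed
    qed
    then show "(\<integral>x. u x * exp (- \<i> * of_real (l * x)) \<partial>lborel) = 0"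
      by (simp add: F_def u_def mult.assoc)
  qed
qed

end

section \<open>Image of a complex density under a map from the real line\<close>

locale line_density =
  fixes T :: "real \<Rightarrow> 'a::euclidean_space" and u :: "real \<Rightarrow> complex"
  assumes T [measurable]: "T \<in> borel_measurable borel"
    and u: "integrable lborel u"
begin

definition \<mu> :: "'a set \<Rightarrow> complex" where
  "\<mu> A = (\<integral>x. indicator A (T x) *\<^sub>R u x \<partial>lborel)"

lemma u_measurable [measurable]: "u \<in> borel_measurable borel"
  using u by auto

lemma vector_measure_density:
  fixes f :: "real \<Rightarrow> 'b::euclidean_space"
  assumes f: "integrable lborel f"
  shows "vector_measure borel (\<lambda>A. \<integral>x. indicator A (T x) *\<^sub>R f x \<partial>lborel)"
  unfolding vector_measure_def
proof (intro allI impI)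
  fix A :: "nat \<Rightarrow> 'a set" assume A: "range A \<subseteq> sets borel" "disjoint_family A"
  have [measurable]: "A i \<in> sets borel" for i using A by auto
  have [measurable]: "f \<in> borel_measurable borel" using f by auto
  have int: "integrable lborel (\<lambda>x. indicator B (T x) *\<^sub>R f x)" if [measurable]: "B \<in> sets borel" for B
    by (rule Bochner_Integration.integrable_bound[OF f]) (auto simp: indicator_def)
  have part: "(\<Sum>i<n. indicator (A i) (T x)) = (indicator (\<Union>i<n. A i) (T x) :: real)" for n x
    using A(2) by (intro indicator_UN_disjoint[symmetric]) (auto simp: disjoint_family_on_def)
  have "(\<lambda>n. \<integral>x. (\<Sum>i<n. indicator (A i) (T x)) *\<^sub>R f x \<partial>lborel) \<longlonglongrightarrow> (\<integral>x. indicator (\<Union>i. A i) (T x) *\<^sub>R f x \<partial>lborel)"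
  proof (rule integral_dominated_convergence[where w = "\<lambda>x. norm (f x)"])
    have "(\<lambda>i. indicator (A i) (T x) :: real) sums indicator (\<Union>i. A i) (T x)" for x
      using A(2) by (intro indicator_sums) (auto simp: disjoint_family_on_def)
    then show "AE x in lborel. (\<lambda>n. (\<Sum>i<n. indicator (A i) (T x)) *\<^sub>R f x) \<longlonglongrightarrow> indicator (\<Union>i. A i) (T x) *\<^sub>R f x"
      by (intro AE_I2 tendsto_intros) (auto simp: sums_def)
    show "AE x in lborel. norm ((\<Sum>i<n. indicator (A i) (T x)) *\<^sub>R f x) \<le> norm (f x)" for n
      unfolding part by (auto simp: indicator_def)
    show "integrable lborel (\<lambda>x. norm (f x))" using f by simp
    show "(\<lambda>x. indicator (\<Union>i. A i) (T x) *\<^sub>R f x) \<in> borel_measurable lborel"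
      by (intro borel_measurable_integrable int) auto
    show "(\<lambda>x. (\<Sum>i<n. indicator (A i) (T x)) *\<^sub>R f x) \<in> borel_measurable lborel" for n
      unfolding part by (intro borel_measurable_integrable int) auto
  qed
  then show "(\<lambda>i. \<integral>x. indicator (A i) (T x) *\<^sub>R f x \<partial>lborel) sums (\<integral>x. indicator (\<Union>i. A i) (T x) *\<^sub>R f x \<partial>lborel)"
    unfolding sums_def scaleR_sum_left using int by (subst (asm) Bochner_Integration.integral_sum) auto
qed

lemma complex_measure_\<mu>: "complex_measure borel \<mu>"
  using vector_measure_density[OF u] unfolding complex_measure_def vector_measure_def \<mu>_def .

text \<open>On every Borel set, hence on every cell of a partition, \<open>\<mu>\<close> is bounded
  by the image of \<open>cmod (u x) dx\<close>; this is the comparison that finiteness of the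
  weighted integral calls for.\<close>

lemma nn_integral_total_variation_\<mu>_le:
  assumes g [measurable]: "g \<in> borel_measurable borel"
  shows "(\<integral>\<^sup>+y. g y \<partial>total_variation borel \<mu>) \<le> (\<integral>\<^sup>+x. ennreal (cmod (u x)) * g (T x) \<partial>lborel)"
proof -
  let ?N = "distr (density lborel (\<lambda>x. ennreal (cmod (u x)))) borel T"
  have "emeasure (total_variation borel \<mu>) E \<le> emeasure ?N E" if E: "E \<in> sets borel" for E
    unfolding emeasure_total_variation[OF complex_measure_\<mu> E]
  proof (rule SUP_least)
    fix A assume A: "A \<in> partitions borel E"
    have "ennreal (cmod (\<mu> B)) \<le> emeasure ?N B" if [measurable]: "B \<in> sets borel" for B
    proof -
      have int: "integrable lborel (\<lambda>x. indicator B (T x) *\<^sub>R u x)"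
        by (rule Bochner_Integration.integrable_bound[OF u]) (auto simp: indicator_def)
      have "ennreal (cmod (\<mu> B)) \<le> (\<integral>\<^sup>+x. norm (indicator B (T x) *\<^sub>R u x) \<partial>lborel)"
        unfolding \<mu>_def by (rule integral_norm_bound_ennreal[OF int])
      also have "\<dots> = (\<integral>\<^sup>+x. ennreal (cmod (u x)) * indicator (T -` B) x \<partial>lborel)"
        by (intro nn_integral_cong) (auto simp: indicator_def)
      also have "\<dots> = emeasure ?N B"
        using measurable_sets_borel[OF T that] by (simp add: emeasure_distr emeasure_density)
      finally show ?thesis .
    qed
    then have "(\<Sum>i. ennreal (cmod (\<mu> (A i)))) \<le> (\<Sum>i. emeasure ?N (A i))"
      using A by (intro suminf_le summableI) auto
    also have "\<dots> = emeasure ?N E" using A by (subst suminf_emeasure) auto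
    finally show "(\<Sum>i. ennreal (cmod (\<mu> (A i)))) \<le> emeasure ?N E" .
  qed
  then have "total_variation borel \<mu> \<le> ?N" by (subst le_measure) auto
  then have "(\<integral>\<^sup>+y. g y \<partial>total_variation borel \<mu>) \<le> (\<integral>\<^sup>+y. g y \<partial>?N)"
    by (intro nn_integral_mono_measure) auto
  also have "\<dots> = (\<integral>\<^sup>+x. ennreal (cmod (u x)) * g (T x) \<partial>lborel)"
    by (simp add: nn_integral_distr nn_integral_density)
  finally show ?thesis .
qed

text \<open>The supremum is attained at the part of \<open>E\<close> where \<open>f\<close> is
  positive. The left inverse \<open>S\<close> makes that part a Borel set in the target. On the
  right, \<open>ennreal\<close> truncates \<open>f\<close> to its positive part.\<close>

lemma positive_variation_density:
  assumes f: "integrable lborel f" and S: "S \<in> borel_measurable borel" "\<And>x. S (T x) = x"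
  shows "positive_variation borel (\<lambda>A. \<integral>x. indicator A (T x) * f x \<partial>lborel)
    = distr (density lborel (\<lambda>x. ennreal (f x))) borel T" (is "?P = ?N")
proof (rule measure_eqI)
  fix E assume "E \<in> sets ?P"
  then have E [measurable]: "E \<in> sets borel" by simp
  have [measurable]: "f \<in> borel_measurable borel" using f by auto
  note [measurable] = S(1)
  have N: "emeasure ?N B = (\<integral>\<^sup>+x. ennreal (indicator B (T x) * f x) \<partial>lborel)" if [measurable]: "B \<in> sets borel" for B
    using measurable_sets_borel[OF T that]
    by (auto simp: emeasure_distr emeasure_density indicator_def intro!: nn_integral_cong)
  have int: "integrable lborel (\<lambda>x. indicator B (T x) * f x)" if [measurable]: "B \<in> sets borel" for B
    by (rule Bochner_Integration.integrable_bound[OF f]) (auto simp: indicator_def)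
  have vm: "vector_measure borel (\<lambda>A. \<integral>x. indicator A (T x) * f x \<partial>lborel)"
    using vector_measure_density[OF f] by simp
  have "emeasure ?P E = (SUP B \<in> {B \<in> sets borel. B \<subseteq> E}. ennreal (\<integral>x. indicator B (T x) * f x \<partial>lborel))"
    by (rule emeasure_positive_variation[OF vm E])
  also have "\<dots> = emeasure ?N E"
  proof (intro antisym SUP_least)
    fix B assume "B \<in> {B \<in> sets borel. B \<subseteq> E}"
    then have B [measurable]: "B \<in> sets borel" and BE: "B \<subseteq> E" by auto
    have "ennreal (\<integral>x. indicator B (T x) * f x \<partial>lborel) \<le> ennreal (\<integral>x. max 0 (indicator B (T x) * f x) \<partial>lborel)"
      using int[OF B] by (intro ennreal_leI integral_mono) auto
    also have "\<dots> = (\<integral>\<^sup>+x. ennreal (max 0 (indicator B (T x) * f x)) \<partial>lborel)"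
      using int[OF B] by (intro nn_integral_eq_integral[symmetric]) auto
    also have "\<dots> = emeasure ?N B"
      unfolding N[OF B] by (intro nn_integral_cong) (auto simp: max_def ennreal_neg)
    also have "\<dots> \<le> emeasure ?N E" using BE by (intro emeasure_mono) auto
    finally show "ennreal (\<integral>x. indicator B (T x) * f x \<partial>lborel) \<le> emeasure ?N E" .
  next
    define B where "B = E \<inter> {y. f (S y) > 0}"
    have B [measurable]: "B \<in> sets borel" unfolding B_def by measurable
    have "emeasure ?N E = (\<integral>\<^sup>+x. ennreal (indicator B (T x) * f x) \<partial>lborel)"
      unfolding N[OF E] by (intro nn_integral_cong) (auto simp: B_def S(2) indicator_def ennreal_neg not_less)
    also have "\<dots> = ennreal (\<integral>x. indicator B (T x) * f x \<partial>lborel)"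
      using int[OF B] by (intro nn_integral_eq_integral) (auto simp: B_def S(2) indicator_def)
    also have "\<dots> \<le> (SUP B \<in> {B \<in> sets borel. B \<subseteq> E}. ennreal (\<integral>x. indicator B (T x) * f x \<partial>lborel))"
      using B by (intro SUP_upper) (auto simp: B_def)
    finally show "emeasure ?N E \<le> (SUP B \<in> {B \<in> sets borel. B \<subseteq> E}. ennreal (\<integral>x. indicator B (T x) * f x \<partial>lborel))" .
  qed
  finally show "emeasure ?P E = emeasure ?N E" .
qed simp

text \<open>The negative variation is the positive variation of the density \<open>- f\<close>, so
  the difference reassembles \<open>f\<close> from its positive and negative parts.\<close>

lemma integral_variation_difference:
  fixes \<phi> :: "'a \<Rightarrow> complex" and f :: "real \<Rightarrow> real"
  assumes f: "integrable lborel f" and S: "S \<in> borel_measurable borel" "\<And>x. S (T x) = x"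
    and \<phi> [measurable]: "\<phi> \<in> borel_measurable borel" and b: "\<And>y. cmod (\<phi> y) \<le> 1"
  shows "(\<integral>y. \<phi> y \<partial>positive_variation borel (\<lambda>A. \<integral>x. indicator A (T x) * f x \<partial>lborel))
    - (\<integral>y. \<phi> y \<partial>positive_variation borel (\<lambda>A. - (\<integral>x. indicator A (T x) * f x \<partial>lborel)))
    = (\<integral>x. f x *\<^sub>R \<phi> (T x) \<partial>lborel)"
proof -
  have [measurable]: "f \<in> borel_measurable borel" using f by auto
  have pv: "(\<integral>y. \<phi> y \<partial>positive_variation borel (\<lambda>A. \<integral>x. indicator A (T x) * g x \<partial>lborel))
      = (\<integral>x. max 0 (g x) *\<^sub>R \<phi> (T x) \<partial>lborel)" if g: "integrable lborel g" for g
  proof -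
    have [measurable]: "g \<in> borel_measurable borel" using g by auto
    have eq: "density lborel (\<lambda>x. ennreal (g x)) = density lborel (\<lambda>x. ennreal (max 0 (g x)))"
      by (intro density_cong) (auto simp: max_def ennreal_neg)
    have "(\<integral>y. \<phi> y \<partial>distr (density lborel (\<lambda>x. ennreal (g x))) borel T)
        = (\<integral>x. \<phi> (T x) \<partial>density lborel (\<lambda>x. ennreal (max 0 (g x))))"
      unfolding eq by (rule integral_distr) auto
    also have "\<dots> = (\<integral>x. max 0 (g x) *\<^sub>R \<phi> (T x) \<partial>lborel)"
      by (rule integral_density) auto
    finally show ?thesis unfolding positive_variation_density[OF g S] .
  qed
  have neg: "(\<lambda>A. - (\<integral>x. indicator A (T x) * f x \<partial>lborel)) = (\<lambda>A. \<integral>x. indicator A (T x) * - f x \<partial>lborel)"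
    by simp
  have int: "integrable lborel (\<lambda>x. max 0 (g x) *\<^sub>R \<phi> (T x))" if g: "integrable lborel g" for g :: "real \<Rightarrow> real"
  proof (rule Bochner_Integration.integrable_bound[OF g])
    have [measurable]: "g \<in> borel_measurable borel" using g by auto
    show "(\<lambda>x. max 0 (g x) *\<^sub>R \<phi> (T x)) \<in> borel_measurable lborel" by measurable
    have "\<bar>max 0 (g x)\<bar> * cmod (\<phi> (T x)) \<le> \<bar>g x\<bar> * 1" for x
      using b by (intro mult_mono) auto
    then show "AE x in lborel. norm (max 0 (g x) *\<^sub>R \<phi> (T x)) \<le> norm (g x)" by simp
  qed
  have "(\<integral>x. max 0 (f x) *\<^sub>R \<phi> (T x) \<partial>lborel) - (\<integral>x. max 0 (- f x) *\<^sub>R \<phi> (T x) \<partial>lborel)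
      = (\<integral>x. max 0 (f x) *\<^sub>R \<phi> (T x) - max 0 (- f x) *\<^sub>R \<phi> (T x) \<partial>lborel)"
    using int[OF f] int[of "\<lambda>x. - f x"] f by (intro Bochner_Integration.integral_diff[symmetric]) auto
  also have "\<dots> = (\<integral>x. f x *\<^sub>R \<phi> (T x) \<partial>lborel)"
    by (intro Bochner_Integration.integral_cong refl) (auto simp: max_def)
  finally show ?thesis
    unfolding neg using pv[OF f] pv[of "\<lambda>x. - f x"] f by simp
qed

lemma complex_measure_integral_\<mu>:
  assumes S: "S \<in> borel_measurable borel" "\<And>x. S (T x) = x"
    and \<phi> [measurable]: "\<phi> \<in> borel_measurable borel" and b: "\<And>y. cmod (\<phi> y) \<le> 1"
  shows "complex_measure_integral borel \<mu> \<phi> = (\<integral>x. u x * \<phi> (T x) \<partial>lborel)"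
proof -
  have Re: "integrable lborel (\<lambda>x. Re (u x))" and Im: "integrable lborel (\<lambda>x. Im (u x))"
    using u by auto
  have ind: "integrable lborel (\<lambda>x. indicator A (T x) *\<^sub>R u x)" if [measurable]: "A \<in> sets borel" for A
    by (rule Bochner_Integration.integrable_bound[OF u]) (auto simp: indicator_def)
  \<comment> \<open>The real part of \<open>\<mu>\<close> and the integral of the real part are
    identified on Borel sets only; \<open>positive_variation\<close> reads no other values.\<close>
  have pv_cong: "positive_variation borel f = positive_variation borel g"
    if fg: "\<And>A. A \<in> sets borel \<Longrightarrow> f A = g A" for f g :: "'a set \<Rightarrow> real"
  proof -
    have "(SUP B \<in> {B \<in> sets borel. B \<subseteq> E}. ennreal (f B)) = (SUP B \<in> {B \<in> sets borel. B \<subseteq> E}. ennreal (g B))" for E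
      using fg by (intro SUP_cong) auto
    then show ?thesis by (simp add: positive_variation_def)
  qed
  have R: "Re (\<mu> A) = (\<integral>x. indicator A (T x) * Re (u x) \<partial>lborel)"
    and I: "Im (\<mu> A) = (\<integral>x. indicator A (T x) * Im (u x) \<partial>lborel)" if "A \<in> sets borel" for A
    using integral_Re[OF ind[OF that]] integral_Im[OF ind[OF that]] by (simp_all add: \<mu>_def)
  have int: "integrable lborel (\<lambda>x. f x *\<^sub>R \<phi> (T x))" if f: "integrable lborel f" for f :: "real \<Rightarrow> real"
  proof (rule Bochner_Integration.integrable_bound[OF f])
    have [measurable]: "f \<in> borel_measurable borel" using f by auto
    show "(\<lambda>x. f x *\<^sub>R \<phi> (T x)) \<in> borel_measurable lborel" by measurable
    show "AE x in lborel. norm (f x *\<^sub>R \<phi> (T x)) \<le> norm (f x)"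
      using b by (auto intro!: mult_left_le)
  qed
  have "complex_measure_integral borel \<mu> \<phi>
      = (\<integral>x. Re (u x) *\<^sub>R \<phi> (T x) \<partial>lborel) + \<i> * (\<integral>x. Im (u x) *\<^sub>R \<phi> (T x) \<partial>lborel)"
    unfolding complex_measure_integral_def
      integral_variation_difference[OF Re S \<phi> b, symmetric] integral_variation_difference[OF Im S \<phi> b, symmetric]
    using R I by (simp cong: pv_cong)
  also have "\<dots> = (\<integral>x. Re (u x) *\<^sub>R \<phi> (T x) + \<i> * (Im (u x) *\<^sub>R \<phi> (T x)) \<partial>lborel)"
    by (simp only: Bochner_Integration.integral_add[OF int[OF Re] integrable_mult_right[OF int[OF Im]]]
        integral_mult_right_zero)
  also have "\<dots> = (\<integral>x. u x * \<phi> (T x) \<partial>lborel)"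
  proof (intro Bochner_Integration.integral_cong refl)
    fix x
    have "u x = of_real (Re (u x)) + \<i> * of_real (Im (u x))" by (simp add: complex_eq)
    then show "Re (u x) *\<^sub>R \<phi> (T x) + \<i> * (Im (u x) *\<^sub>R \<phi> (T x)) = u x * \<phi> (T x)"
      by (metis distrib_right mult.assoc scaleR_conv_of_real)
  qed
  finally show ?thesis .
qed

text \<open>Over the preimage under \<open>S\<close> of the set where \<open>Re u < 0\<close>, an
  integrand of one sign would integrate to 0. That set would then be null, but it is open and
  contains \<open>x\<^sub>0\<close>.\<close>

lemma \<mu>_nonzero:
  assumes S: "S \<in> borel_measurable borel" "\<And>x. S (T x) = x"
    and cont: "continuous_on UNIV u" and neg: "Re (u x\<^sub>0) < 0"
  shows "\<exists>A\<in>sets borel. \<mu> A \<noteq> 0"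
proof (rule ccontr)
  assume "\<not> ?thesis"
  then have zero: "\<mu> A = 0" if "A \<in> sets borel" for A using that by blast
  note [measurable] = S(1)
  define A where "A = {y. Re (u (S y)) < 0}"
  have A [measurable]: "A \<in> sets borel" unfolding A_def by measurable
  have ind: "integrable lborel (\<lambda>x. indicator A (T x) *\<^sub>R u x)"
    by (rule Bochner_Integration.integrable_bound[OF u]) (auto simp: indicator_def)
  define g where "g = (\<lambda>x. - (indicator A (T x) * Re (u x)))"
  have g: "integrable lborel g" "integral\<^sup>L lborel g = 0"
    using integrable_Re[OF ind] integral_Re[OF ind] zero[OF A] by (auto simp: g_def \<mu>_def)
  have g0: "g x \<ge> 0" for x by (auto simp: g_def A_def S(2) indicator_def)
  have "AE x in lborel. g x = 0"
    using integral_nonneg_eq_0_iff_AE[OF g(1)] g0 g(2) by simp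
  then have "AE x in lborel. x \<notin> {x. Re (u x) < 0}"
    by eventually_elim (auto simp: g_def A_def S(2) indicator_def)
  moreover have op: "open {x. Re (u x) < 0}"
    by (intro open_Collect_less continuous_intros cont)
  ultimately have "{x. Re (u x) < 0} \<in> null_sets lborel"
    by (subst AE_iff_null_sets) auto
  then have "negligible {x. Re (u x) < 0}"
    using null_sets_completionI negligible_iff_null_sets by blast
  then show False using open_not_negligible[OF op] neg by blast
qed

end

section \<open>The counterexample for a convergent integral, and the equivalence\<close>

context increasing_weight
begin

text \<open>A measure on the \<open>i\<close>-th axis has a transform depending on
  \<open>l $ i\<close> alone; it vanishes for \<open>l $ i \<le> 0\<close>, in particular on the
  orthant, which is a product of closed half lines.\<close>

lemma exists_nonzero_measure_with_vanishing_fourier: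
  assumes conv: "(\<integral>\<^sup>+x\<in>{0..}. ennreal (\<psi> x / (1 + x\<^sup>2)) \<partial>lborel) < \<infinity>"
  shows "\<exists>\<mu> :: (real ^ 'n) set \<Rightarrow> complex. complex_measure borel \<mu>
    \<and> (\<integral>\<^sup>+x. ennreal (exp (\<psi> (norm x))) \<partial>total_variation borel \<mu>) < \<infinity>
    \<and> (\<forall>l\<in>box_prod (\<lambda>_. {..0}). fourier \<mu> l = 0) \<and> (\<exists>A\<in>sets borel. \<mu> A \<noteq> 0)"
proof -
  obtain u :: "real \<Rightarrow> complex" and K where u: "continuous_on UNIV u" "u 0 = - 1"
      "\<And>x. cmod (u x) * exp (\<psi> \<bar>x\<bar>) \<le> K / (1 + x\<^sup>2)"
      "\<And>l. l \<le> 0 \<Longrightarrow> (\<integral>x. u x * exp (- \<i> * of_real (l * x)) \<partial>lborel) = 0"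
    using exists_one_sided_spectrum[OF conv] by blast
  have K: "integrable lborel (\<lambda>x. K / (1 + x\<^sup>2))"
    using integrable_mult_right[OF integrable_inverse_one_plus_square, of K] by simp
  have "integrable lborel u"
  proof (rule Bochner_Integration.integrable_bound[OF K])
    show "u \<in> borel_measurable lborel" using borel_measurable_continuous_onI[OF u(1)] by simp
    have "cmod (u x) \<le> K / (1 + x\<^sup>2)" for x
    proof -
      have "cmod (u x) * 1 \<le> cmod (u x) * exp (\<psi> \<bar>x\<bar>)" using nonneg[of "\<bar>x\<bar>"] by (intro mult_left_mono) auto
      then show ?thesis using u(3)[of x] by simp
    qed
    then show "AE x in lborel. norm (u x) \<le> norm (K / (1 + x\<^sup>2))"
      unfolding real_norm_def by (intro AE_I2) (rule order_trans[OF _ abs_ge_self])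
  qed
  \<comment> \<open>Any coordinate serves; the index type is nonempty.\<close>
  define i :: 'n where "i = undefined"
  define T where "T x = x *\<^sub>R axis i (1::real)" for x :: real
  interpret D: line_density T u
  proof
    show "T \<in> borel_measurable borel"
      unfolding T_def by (intro borel_measurable_continuous_onI continuous_intros)
  qed fact
  let ?S = "\<lambda>y :: real ^ 'n. y $ i"
  have S: "?S \<in> borel_measurable borel" "?S (T x) = x" for x
    by (auto simp: T_def intro!: borel_measurable_continuous_onI continuous_intros)
  have nT: "norm (T x) = \<bar>x\<bar>" for x by (simp add: T_def)
  have "(\<integral>\<^sup>+x. ennreal (exp (\<psi> (norm x))) \<partial>total_variation borel D.\<mu>)
      \<le> (\<integral>\<^sup>+x. ennreal (cmod (u x)) * ennreal (exp (\<psi> (norm (T x)))) \<partial>lborel)"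
    using borel_measurable_continuous_onI[OF continuous_on_weight[OF cont]]
    by (intro D.nn_integral_total_variation_\<mu>_le) auto
  also have "\<dots> \<le> (\<integral>\<^sup>+x. ennreal (K / (1 + x\<^sup>2)) \<partial>lborel)"
    using u(3) by (intro nn_integral_mono) (auto simp: nT simp flip: ennreal_mult intro!: ennreal_leI)
  also have "\<dots> < \<infinity>"
  proof -
    have "0 \<le> cmod (u x) * exp (\<psi> \<bar>x\<bar>)" for x by simp
    then have "0 \<le> K / (1 + x\<^sup>2)" for x using u(3)[of x] by (rule order_trans)
    then show ?thesis using K by (subst nn_integral_eq_integral) auto
  qed
  finally have fin: "(\<integral>\<^sup>+x. ennreal (exp (\<psi> (norm x))) \<partial>total_variation borel D.\<mu>) < \<infinity>" .
  have "fourier D.\<mu> l = 0" if l: "l \<in> box_prod (\<lambda>_. {..0})" for l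
  proof -
    have "fourier D.\<mu> l = (\<integral>x. u x * expo l (T x) \<partial>lborel)"
      unfolding fourier_def
      by (intro D.complex_measure_integral_\<mu>[OF S] borel_measurable_continuous_onI continuous_on_expo) auto
    also have "\<dots> = (\<integral>x. u x * exp (- \<i> * of_real (l $ i * x)) \<partial>lborel)"
      by (simp add: expo_def T_def inner_axis mult.commute)
    also have "\<dots> = 0" using l by (intro u(4)) (auto simp: box_prod_def)
    finally show ?thesis .
  qed
  moreover have "\<exists>A\<in>sets borel. D.\<mu> A \<noteq> 0"
    by (rule D.\<mu>_nonzero[OF S u(1), of 0]) (simp add: u(2))
  ultimately show ?thesis using D.complex_measure_\<mu> fin by blast
qed

end

theorem theorem1p3:
  fixes \<psi> :: "real \<Rightarrow> real"
  assumes "continuous_on {0..} \<psi>"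
    and "mono_on {0..} \<psi>"
    and "\<And>x. x \<ge> 0 \<Longrightarrow> \<psi> x \<ge> 0"
    and "filterlim \<psi> at_top at_top"
  shows
    "((\<integral>\<^sup>+x\<in>{0..}. ennreal (\<psi> x / (1 + x\<^sup>2)) \<partial>lborel) = \<infinity>
      \<longleftrightarrow>
      (\<forall>L :: 'n::finite \<Rightarrow> real set.
         (\<forall>j. closed (L j) \<and> 0 < emeasure lborel (L j)) \<longrightarrow>
         dense_in_C_psi \<psi> (Phi (box_prod L))))
     \<and>
     ((\<forall>L :: 'n \<Rightarrow> real set.
         (\<forall>j. closed (L j) \<and> 0 < emeasure lborel (L j)) \<longrightarrow>
         dense_in_C_psi \<psi> (Phi (box_prod L)))
      \<longleftrightarrow>
      (\<forall>\<mu> :: (real ^ 'n) set \<Rightarrow> complex.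
         complex_measure borel \<mu> \<longrightarrow>
         (\<integral>\<^sup>+x. ennreal (exp (\<psi> (norm x))) \<partial>total_variation borel \<mu>) < \<infinity> \<longrightarrow>
         (\<exists>L :: 'n \<Rightarrow> real set.
            (\<forall>j. closed (L j) \<and> 0 < emeasure lborel (L j)) \<and>
            (\<forall>l\<in>box_prod L. fourier \<mu> l = 0)) \<longrightarrow>
         (\<forall>A\<in>sets borel. \<mu> A = 0)))"
    (is "(?one \<longleftrightarrow> ?two) \<and> (?two \<longleftrightarrow> ?three)")
proof -
  interpret increasing_weight \<psi> by (unfold_locales; fact assms)
  have "?two" if "?one"
  proof (intro allI impI)
    fix L :: "'n \<Rightarrow> real set" assume L: "\<forall>j. closed (L j) \<and> 0 < emeasure lborel (L j)"
    show "dense_in_C_psi \<psi> (Phi (box_prod L))"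
      by (intro dense_in_C_psi_of_approx nonneg lim approx_box_prod[OF mono] approx_line[OF that])
        (use L in auto)
  qed
  moreover have "?three" if "?two"
  proof (intro allI impI ballI)
    fix \<mu> :: "(real ^ 'n) set \<Rightarrow> complex" and A :: "(real ^ 'n) set"
    assume \<mu>: "complex_measure borel \<mu>"
        "(\<integral>\<^sup>+x. ennreal (exp (\<psi> (norm x))) \<partial>total_variation borel \<mu>) < \<infinity>"
        "\<exists>L :: 'n \<Rightarrow> real set. (\<forall>j. closed (L j) \<and> 0 < emeasure lborel (L j)) \<and> (\<forall>l\<in>box_prod L. fourier \<mu> l = 0)"
      and A: "A \<in> sets borel"
    obtain L :: "'n \<Rightarrow> real set" where L: "\<forall>j. closed (L j) \<and> 0 < emeasure lborel (L j)"
        "\<And>l. l \<in> box_prod L \<Longrightarrow> fourier \<mu> l = 0" using \<mu>(3) by blast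
    have "dense_in_C_psi \<psi> (Phi (box_prod L))" using \<open>?two\<close> L(1) by blast
    from complex_measure_eq_zero[OF cont nonneg lim \<mu>(1,2) this L(2) A] show "\<mu> A = 0" .
  qed
  moreover have "?one" if "?three"
  proof (rule ccontr)
    assume "\<not> ?one"
    then have conv: "(\<integral>\<^sup>+x\<in>{0..}. ennreal (\<psi> x / (1 + x\<^sup>2)) \<partial>lborel) < \<infinity>"
      by (simp add: less_top)
    obtain \<mu> :: "(real ^ 'n) set \<Rightarrow> complex" where \<mu>: "complex_measure borel \<mu>"
        "(\<integral>\<^sup>+x. ennreal (exp (\<psi> (norm x))) \<partial>total_variation borel \<mu>) < \<infinity>"
        "\<forall>l\<in>box_prod (\<lambda>_. {..0}). fourier \<mu> l = 0" "\<exists>A\<in>sets borel. \<mu> A \<noteq> 0"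
      using exists_nonzero_measure_with_vanishing_fourier[OF conv] by blast
    have "0 < emeasure lborel {..0::real}"
    proof -
      have "0 < emeasure lborel {-1..0::real}" by simp
      also have "\<dots> \<le> emeasure lborel {..0::real}" by (intro emeasure_mono) auto
      finally show ?thesis .
    qed
    then have "\<exists>L :: 'n \<Rightarrow> real set. (\<forall>j. closed (L j) \<and> 0 < emeasure lborel (L j))
        \<and> (\<forall>l\<in>box_prod L. fourier \<mu> l = 0)"
      using \<mu>(3) by (intro exI[of _ "\<lambda>_. {..0}"]) auto
    then show False using \<open>?three\<close> \<mu> by blast
  qed
  ultimately show ?thesis by blast
qed

end
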